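(* (a) There exists a half line Jacobi matrix $J_+$ that is reflectionless on $(-2,2)$, but is not the restriction of a whole line Jacobi matrix that is reflectionless on $(-2,2)$. (b) There exists a half line Schr\"odinger operator $H_+$ that is reflectionless on $(0,\infty)$, but is not the restriction of a whole line Schr\"odinger operator that is reflectionless on $(0,\infty)$.
   Context: A Herglotz function is a holomorphic map from the open upper half plane $\mathbb{C}^+$ to itself; its boundary values $m(x)=\lim_{y\to0+}m(x+iy)$ exist for a.e. $x\in\mathbb{R}$. Jacobi matrices: a whole line Jacobi matrix is $(Ju)_n=a_nu_{n+1}+a_{n-1}u_{n-1}+b_nu_n$ on $\ell^2(\mathbb{Z})$ with $a,b\in\ell^\infty(\mathbb{Z})$, $a_n>0$, $b_n\in\mathbb{R}$. With $f_\pm(\cdot,z)$ the solutions ($z\in\mathbb{C}^+$) of $a_nf(n+1)+a_{n-1}f(n-1)+b_nf(n)=zf(n)$ that are square summable near $\pm\infty$, its half line $m$ functions are the Herglotz functions $m_\pm(z)=\mp f_\pm(1,z)/(a_0f_\pm(0,z))$. A half line Jacobi matrix $J_+$ acts on $\ell^2(\mathbb{Z}_+)$, $\mathbb{Z}_+=\{1,2,3,\ldots\}$, with bounded coefficients $a_n>0$, $b_n\in\mathbb{R}$ ($n\ge1$): $(J_+u)_n=a_nu_{n+1}+a_{n-1}u_{n-1}+b_nu_n$ for $n\ge2$, $(J_+u)_1=a_1u_2+b_1u_1$; its $m$ function is $m_+(z)=\langle\delta_1,(J_+-z)^{-1}\delta_1\rangle$, which agrees with the $m_+$ of any whole line Jacobi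 matrix having the same coefficients for $n\ge1$. The restriction of $J$ is the half line Jacobi matrix with the coefficients $(a_n,b_n)_{n\ge1}$. Schr\"odinger operators: a whole line Schr\"odinger operator is $H=-d^2/dx^2+V$ on $L^2(\mathbb{R})$, with $V$ real valued, locally integrable on $\mathbb{R}$, and limit point case at $\pm\infty$. With $f_\pm(\cdot,z)$ the solutions ($z\in\mathbb{C}^+$) of $-f''+Vf=zf$ that are square integrable near $\pm\infty$, $m_\pm(z)=\pm f_\pm'(0,z)/f_\pm(0,z)$. A half line Schr\"odinger operator is $H_+=-d^2/dx^2+V$ on $L^2(0,\infty)$, with $V$ real valued, locally integrable on $[0,\infty)$, limit point case at $+\infty$; its $m$ function is $m_+(z)=f_+'(0,z)/f_+(0,z)$. The restriction of $H$ is the half line operator with potential $V|_{(0,\infty)}$. Reflectionless: a whole line operator is reflectionless on a Borel set $S\subset\mathbb{R}$ of positive Lebesgue measure if $m_+(x)=-\overline{m_-(x)}$ for Lebesgue-a.e. $x\in S$. A half line operator is called reflectionless on $S$ if its $m$ function $m_+$ satisfies $m_+(x)=-\overline{m_-(x)}$ for a.e. $x\in S$ for some Herglotz function $m_-$ (not required to be the $m$ function of any operator). *)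

theory Defs
  imports "HOL-Analysis.Analysis"
begin

section \<open>Herglotz functions and reflectionless pairs\<close>

definition upper_half_plane :: "complex set" where
  "upper_half_plane = {z. Im z > 0}"

definition Herglotz :: "(complex \<Rightarrow> complex) \<Rightarrow> bool" where
  "Herglotz m \<longleftrightarrow> m holomorphic_on upper_half_plane \<and> m ` upper_half_plane \<subseteq> upper_half_plane"

definition has_boundary_value :: "(complex \<Rightarrow> complex) \<Rightarrow> real \<Rightarrow> complex \<Rightarrow> bool" where
  "has_boundary_value m x w \<longleftrightarrow> ((\<lambda>y. m (Complex x y)) \<longlongrightarrow> w) (at_right 0)"

text \<open>For Herglotz functions the boundary values exist almost everywhere, so asking for their
  existence at almost every point of \<open>S\<close> is no restriction.\<close>

definition reflectionless_pair :: "(complex \<Rightarrow> complex) \<Rightarrow> (complex \<Rightarrow> complex) \<Rightarrow> real set \<Rightarrow> bool" where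
  "reflectionless_pair mp mm S \<longleftrightarrow>
     S \<in> sets borel \<and> emeasure lborel S > 0 \<and>
     (AE x in lebesgue. x \<in> S \<longrightarrow>
        (\<exists>wp wm. has_boundary_value mp x wp \<and> has_boundary_value mm x wm \<and> wp = - cnj wm))"

section \<open>Whole line Jacobi matrices\<close>

definition jacobi_matrix :: "(int \<Rightarrow> real) \<Rightarrow> (int \<Rightarrow> real) \<Rightarrow> bool" where
  "jacobi_matrix a b \<longleftrightarrow> bounded (range a) \<and> bounded (range b) \<and> (\<forall>n. a n > 0)"

definition jacobi_solution ::
    "(int \<Rightarrow> real) \<Rightarrow> (int \<Rightarrow> real) \<Rightarrow> complex \<Rightarrow> (int \<Rightarrow> complex) \<Rightarrow> bool" where
  "jacobi_solution a b z f \<longleftrightarrow>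
     (\<forall>n. of_real (a n) * f (n + 1) + of_real (a (n - 1)) * f (n - 1) + of_real (b n) * f n = z * f n)"

text \<open>For \<open>z\<close> in the upper half plane the solutions below are unique up to a nonzero constant
  factor, so the \<open>m\<close> functions do not depend on the choice.\<close>

definition jacobi_f_plus :: "(int \<Rightarrow> real) \<Rightarrow> (int \<Rightarrow> real) \<Rightarrow> complex \<Rightarrow> int \<Rightarrow> complex" where
  "jacobi_f_plus a b z = (SOME f. jacobi_solution a b z f \<and> (\<exists>n. f n \<noteq> 0) \<and>
     (\<lambda>n. (cmod (f n))\<^sup>2) summable_on {0..})"

definition jacobi_f_minus :: "(int \<Rightarrow> real) \<Rightarrow> (int \<Rightarrow> real) \<Rightarrow> complex \<Rightarrow> int \<Rightarrow> complex" where
  "jacobi_f_minus a b z = (SOME f. jacobi_solution a b z f \<and> (\<exists>n. f n \<noteq> 0) \<and>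
     (\<lambda>n. (cmod (f n))\<^sup>2) summable_on {..0})"

definition jacobi_m_plus :: "(int \<Rightarrow> real) \<Rightarrow> (int \<Rightarrow> real) \<Rightarrow> complex \<Rightarrow> complex" where
  "jacobi_m_plus a b z = - (jacobi_f_plus a b z 1 / (of_real (a 0) * jacobi_f_plus a b z 0))"

definition jacobi_m_minus :: "(int \<Rightarrow> real) \<Rightarrow> (int \<Rightarrow> real) \<Rightarrow> complex \<Rightarrow> complex" where
  "jacobi_m_minus a b z = jacobi_f_minus a b z 1 / (of_real (a 0) * jacobi_f_minus a b z 0)"

definition jacobi_reflectionless :: "(int \<Rightarrow> real) \<Rightarrow> (int \<Rightarrow> real) \<Rightarrow> real set \<Rightarrow> bool" where
  "jacobi_reflectionless a b S \<longleftrightarrow> reflectionless_pair (jacobi_m_plus a b) (jacobi_m_minus a b) S"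

section \<open>Half line Jacobi matrices\<close>

text \<open>Only the coefficients and components with index \<open>n \<ge> 1\<close> matter. A vector of
  \<open>\<ell>\<^sup>2({1,2,3,\<dots>})\<close> is represented by its extension by \<open>0\<close> to the index \<open>0\<close>, so that
  vectors are equal iff the representing functions are.\<close>

definition ell2_pos :: "(nat \<Rightarrow> complex) set" where
  "ell2_pos = {u. u 0 = 0 \<and> (\<lambda>n. (cmod (u n))\<^sup>2) summable_on {1..}}"

definition ell2_inner :: "(nat \<Rightarrow> complex) \<Rightarrow> (nat \<Rightarrow> complex) \<Rightarrow> complex" where
  "ell2_inner u v = (\<Sum>\<^sub>\<infinity>n\<in>{1..}. cnj (u n) * v n)"

definition delta1 :: "nat \<Rightarrow> complex" where
  "delta1 n = (if n = 1 then 1 else 0)"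

definition half_jacobi_matrix :: "(nat \<Rightarrow> real) \<Rightarrow> (nat \<Rightarrow> real) \<Rightarrow> bool" where
  "half_jacobi_matrix a b \<longleftrightarrow> bounded (a ` {1..}) \<and> bounded (b ` {1..}) \<and> (\<forall>n\<ge>1. a n > 0)"

definition half_jacobi_op ::
    "(nat \<Rightarrow> real) \<Rightarrow> (nat \<Rightarrow> real) \<Rightarrow> (nat \<Rightarrow> complex) \<Rightarrow> nat \<Rightarrow> complex" where
  "half_jacobi_op a b u n =
     (if n = 0 then 0
      else if n = 1 then of_real (a 1) * u 2 + of_real (b 1) * u 1
      else of_real (a n) * u (n + 1) + of_real (a (n - 1)) * u (n - 1) + of_real (b n) * u n)"

definition half_jacobi_resolvent ::
    "(nat \<Rightarrow> real) \<Rightarrow> (nat \<Rightarrow> real) \<Rightarrow> complex \<Rightarrow> (nat \<Rightarrow> complex) \<Rightarrow> nat \<Rightarrow> complex" where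
  "half_jacobi_resolvent a b z = inv_into ell2_pos (\<lambda>u n. half_jacobi_op a b u n - z * u n)"

definition half_jacobi_m :: "(nat \<Rightarrow> real) \<Rightarrow> (nat \<Rightarrow> real) \<Rightarrow> complex \<Rightarrow> complex" where
  "half_jacobi_m a b z = ell2_inner delta1 (half_jacobi_resolvent a b z delta1)"

definition half_jacobi_reflectionless :: "(nat \<Rightarrow> real) \<Rightarrow> (nat \<Rightarrow> real) \<Rightarrow> real set \<Rightarrow> bool" where
  "half_jacobi_reflectionless a b S \<longleftrightarrow>
     (\<exists>mm. Herglotz mm \<and> reflectionless_pair (half_jacobi_m a b) mm S)"

definition jacobi_restricts_to ::
    "(int \<Rightarrow> real) \<Rightarrow> (int \<Rightarrow> real) \<Rightarrow> (nat \<Rightarrow> real) \<Rightarrow> (nat \<Rightarrow> real) \<Rightarrow> bool" where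
  "jacobi_restricts_to A B a b \<longleftrightarrow> (\<forall>n\<ge>1. A (int n) = a n \<and> B (int n) = b n)"

section \<open>Schroedinger operators\<close>

text \<open>In this section \<open>I\<close> is \<open>UNIV\<close> for whole line and \<open>{0..}\<close> for half line operators.\<close>

definition locally_integrable :: "real set \<Rightarrow> (real \<Rightarrow> real) \<Rightarrow> bool" where
  "locally_integrable I V \<longleftrightarrow> (\<forall>K. compact K \<and> K \<subseteq> I \<longrightarrow> V absolutely_integrable_on K)"

text \<open>Solutions of \<open>- f'' + V f = z f\<close> for locally integrable \<open>V\<close>: the function \<open>f\<close> is
  differentiable with derivative \<open>f'\<close>, and \<open>f'\<close> is locally absolutely continuous, that is, an
  indefinite integral, with derivative \<open>(V - z) f\<close> almost everywhere. The second component of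
  a pair is \<open>f'\<close>.\<close>

definition schroedinger_solution ::
    "real set \<Rightarrow> (real \<Rightarrow> real) \<Rightarrow> complex \<Rightarrow> (real \<Rightarrow> complex) \<times> (real \<Rightarrow> complex) \<Rightarrow> bool" where
  "schroedinger_solution I V z = (\<lambda>(f, f').
     (\<forall>x\<in>I. (f has_vector_derivative f' x) (at x within I)) \<and>
     (\<forall>x\<in>I. \<forall>y\<in>I. x \<le> y \<longrightarrow>
        ((\<lambda>t. (of_real (V t) - z) * f t) has_integral (f' y - f' x)) {x..y}))"

definition sq_integrable_at_top :: "(real \<Rightarrow> complex) \<Rightarrow> bool" where
  "sq_integrable_at_top f \<longleftrightarrow> (\<lambda>x. (cmod (f x))\<^sup>2) absolutely_integrable_on {0..}"

definition sq_integrable_at_bot :: "(real \<Rightarrow> complex) \<Rightarrow> bool" where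
  "sq_integrable_at_bot f \<longleftrightarrow> (\<lambda>x. (cmod (f x))\<^sup>2) absolutely_integrable_on {..0}"

text \<open>An endpoint is in the limit circle case if for some (equivalently, by Weyl's theorem, every)
  complex \<open>z\<close> all solutions are square integrable near it, and in the limit point case otherwise.\<close>

definition limit_point_at_top :: "real set \<Rightarrow> (real \<Rightarrow> real) \<Rightarrow> bool" where
  "limit_point_at_top I V \<longleftrightarrow>
     \<not> (\<exists>z. \<forall>f f'. schroedinger_solution I V z (f, f') \<longrightarrow> sq_integrable_at_top f)"

definition limit_point_at_bot :: "real set \<Rightarrow> (real \<Rightarrow> real) \<Rightarrow> bool" where
  "limit_point_at_bot I V \<longleftrightarrow>
     \<not> (\<exists>z. \<forall>f f'. schroedinger_solution I V z (f, f') \<longrightarrow> sq_integrable_at_bot f)"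

definition schroedinger_op :: "(real \<Rightarrow> real) \<Rightarrow> bool" where
  "schroedinger_op V \<longleftrightarrow>
     locally_integrable UNIV V \<and> limit_point_at_top UNIV V \<and> limit_point_at_bot UNIV V"

definition half_schroedinger_op :: "(real \<Rightarrow> real) \<Rightarrow> bool" where
  "half_schroedinger_op V \<longleftrightarrow> locally_integrable {0..} V \<and> limit_point_at_top {0..} V"

text \<open>As for Jacobi matrices, these solutions are unique up to a nonzero constant factor for \<open>z\<close> in
  the upper half plane.\<close>

definition schroedinger_f_plus ::
    "real set \<Rightarrow> (real \<Rightarrow> real) \<Rightarrow> complex \<Rightarrow> (real \<Rightarrow> complex) \<times> (real \<Rightarrow> complex)" where
  "schroedinger_f_plus I V z = (SOME (f, f'). schroedinger_solution I V z (f, f') \<and>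
     (\<exists>x\<in>I. f x \<noteq> 0) \<and> sq_integrable_at_top f)"

definition schroedinger_f_minus ::
    "real set \<Rightarrow> (real \<Rightarrow> real) \<Rightarrow> complex \<Rightarrow> (real \<Rightarrow> complex) \<times> (real \<Rightarrow> complex)" where
  "schroedinger_f_minus I V z = (SOME (f, f'). schroedinger_solution I V z (f, f') \<and>
     (\<exists>x\<in>I. f x \<noteq> 0) \<and> sq_integrable_at_bot f)"

definition schroedinger_m_plus :: "real set \<Rightarrow> (real \<Rightarrow> real) \<Rightarrow> complex \<Rightarrow> complex" where
  "schroedinger_m_plus I V z = (case schroedinger_f_plus I V z of (f, f') \<Rightarrow> f' 0 / f 0)"

definition schroedinger_m_minus :: "real set \<Rightarrow> (real \<Rightarrow> real) \<Rightarrow> complex \<Rightarrow> complex" where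
  "schroedinger_m_minus I V z = (case schroedinger_f_minus I V z of (f, f') \<Rightarrow> - (f' 0 / f 0))"

definition schroedinger_reflectionless :: "(real \<Rightarrow> real) \<Rightarrow> real set \<Rightarrow> bool" where
  "schroedinger_reflectionless V S \<longleftrightarrow>
     reflectionless_pair (schroedinger_m_plus UNIV V) (schroedinger_m_minus UNIV V) S"

definition half_schroedinger_reflectionless :: "(real \<Rightarrow> real) \<Rightarrow> real set \<Rightarrow> bool" where
  "half_schroedinger_reflectionless V S \<longleftrightarrow>
     (\<exists>mm. Herglotz mm \<and> reflectionless_pair (schroedinger_m_plus {0..} V) mm S)"

text \<open>Potentials are identified when they agree almost everywhere.\<close>

definition schroedinger_restricts_to :: "(real \<Rightarrow> real) \<Rightarrow> (real \<Rightarrow> real) \<Rightarrow> bool" where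
  "schroedinger_restricts_to W V \<longleftrightarrow> (AE x in lebesgue. x > 0 \<longrightarrow> W x = V x)"

end

theory Submission
  imports Defs "HOL-Complex_Analysis.Complex_Analysis"
begin

text \<open>
  A Herglotz function is determined by its boundary values on an interval. Hence a half line operator
  that is reflectionless on an interval determines the only function \<open>m\<^sub>-\<close> that a reflectionless
  whole line extension could have. In both parts this \<open>m\<^sub>-\<close> violates a growth condition that holds for
  whole line operators.

  (a) Let \<open>a\<^sub>n = 1\<close>, \<open>b\<^sub>1 = 1\<close> and \<open>b\<^sub>n = 0\<close> for \<open>n > 1\<close>. With \<open>w + 1/w = z\<close> and \<open>|w| < 1\<close>, the function
  \<open>m\<^sub>-\<close> must be \<open>1/(w - 1)\<close>, which stays bounded as \<open>z\<close> goes to infinity along the imaginary axis,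
  whereas the \<open>m\<^sub>-\<close> of a whole line Jacobi matrix grows like \<open>Im z / a\<^sub>0\<^sup>2\<close>.

  (b) Let \<open>V = -q/(1 - q)\<^sup>2\<close> with \<open>q = exp(-2x)/16\<close>, a translate of \<open>-1/(4 sinh\<^sup>2 x)\<close>. Its Jost solutions
  are hypergeometric series in \<open>q\<close>, so that \<open>m\<^sub>+ = M(\<kappa>)\<close> with \<open>M\<close> meromorphic and \<open>z = -\<kappa>\<^sup>2\<close>. Then \<open>m\<^sub>-\<close>
  must be \<open>-M(-\<kappa>)\<close>, and it is close to the free value of the wrong sign exponentially near
  \<open>z = -n\<^sup>2\<close>: the solution with these data grows like \<open>exp(n|x|)\<close> to the left for every locally integrable
  potential there, once \<open>n\<close> is large. But the Weyl identity \<open>Im z * \<integral>|f|\<^sup>2 = Im m\<^sub>-\<close> bounds the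
  mass of this solution on an interval of length \<open>10\<close>, which gives a contradiction for
  \<open>Im z\<close> of the order \<open>2 ^ (-10 n)\<close>.
\<close>

section \<open>Herglotz functions\<close>

text \<open>In (a), \<open>b\<^sub>1 = c\<close> would give \<open>m\<^sub>+ = w/(c w - 1)\<close>
  and hence \<open>m\<^sub>- = 1/(w - c)\<close>, which stays bounded at infinity for every
  \<open>c\<close> other than 0; 1 is a convenient choice. In (b) the usual asymptotics of m
  functions lead to no contradiction: in sectors away from the real axis,
  \<open>-M(-\<kappa>)\<close> has the same leading term \<open>-\<kappa>\<close> as for every
  potential. The defect sits at the poles \<open>k = -n\<close> of the hypergeometric coefficients,
  near which the summand of index n swamps all others. That summand carries the factor
  \<open>q ^ n = 16 ^ (-n)\<close>, so it wins only if \<open>k\<close> is exponentially close to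
  \<open>-n\<close>, at a distance \<eta>. At such a point the Weyl identity still allows a mass of
  order \<open>1/\<eta>\<close>, so \<eta> must not be too small either: growth like
  \<open>exp(n x)\<close> on [9, 10] produces at least \<open>2 ^ (18 n) / 4\<close>. The choice
  \<open>\<eta> = 2 ^ (-10 n)\<close> meets both demands. That \<open>-M(-\<kappa>)\<close> is
  Herglotz at all rests on the coupling \<open>-1/4\<close>, for which the coefficients of the
  series are products whose arguments can be controlled.\<close>

lemma upper_half_plane_iff [simp]: "z \<in> upper_half_plane \<longleftrightarrow> Im z > 0"
  by (simp add: upper_half_plane_def)

lemma open_upper_half_plane: "open upper_half_plane"
  by (simp add: upper_half_plane_def open_halfspace_Im_gt)

lemma convex_upper_half_plane: "convex upper_half_plane"
  by (simp add: upper_half_plane_def convex_halfspace_Im_gt)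

lemma HerglotzD:
  assumes "Herglotz m"
  shows "m holomorphic_on upper_half_plane" "\<And>z. Im z > 0 \<Longrightarrow> Im (m z) > 0"
  using assms by (auto simp: Herglotz_def image_subset_iff)

lemma HerglotzI:
  assumes "m holomorphic_on upper_half_plane" "\<And>z. Im z > 0 \<Longrightarrow> Im (m z) > 0"
  shows "Herglotz m"
  using assms by (auto simp: Herglotz_def)

lemma norm_add_ii_ge_1: "Im w > 0 \<Longrightarrow> cmod (w + \<i>) \<ge> 1"
  using abs_Im_le_cmod[of "w + \<i>"] by simp

lemma add_ii_nonzero: "Im w > 0 \<Longrightarrow> w + \<i> \<noteq> 0"
  using norm_add_ii_ge_1[of w] by auto

text \<open>The transform \<open>1 / (m z + \<i>)\<close> is bounded and determines
  \<open>m\<close>, so questions on Herglotz functions reduce to bounded holomorphic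
  functions.\<close>

lemma Herglotz_Cayley:
  assumes "Herglotz m"
  shows "(\<lambda>z. 1 / (m z + \<i>)) holomorphic_on upper_half_plane"
    and "\<And>z. Im z > 0 \<Longrightarrow> cmod (1 / (m z + \<i>)) \<le> 1"
proof -
  show "(\<lambda>z. 1 / (m z + \<i>)) holomorphic_on upper_half_plane"
    using HerglotzD[OF assms] add_ii_nonzero by (intro holomorphic_intros) auto
  show "cmod (1 / (m z + \<i>)) \<le> 1" if "Im z > 0" for z
    using norm_add_ii_ge_1[of "m z"] HerglotzD(2)[OF assms that]
    by (simp add: norm_divide divide_le_eq_1)
qed

text \<open>Montel's theorem for the bounded transforms \<open>1 / (m n z + \<i>)\<close> makes the
  pointwise limit holomorphic. Strict positivity of \<open>Im (l z)\<close> has to be assumed, since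
  a limit may be a real constant.\<close>

lemma Herglotz_limit:
  fixes m :: "nat \<Rightarrow> complex \<Rightarrow> complex"
  assumes H: "\<And>n. Herglotz (m n)"
    and lim: "\<And>z. Im z > 0 \<Longrightarrow> (\<lambda>n. m n z) \<longlonglongrightarrow> l z"
    and pos: "\<And>z. Im z > 0 \<Longrightarrow> Im (l z) > 0"
  shows "Herglotz l"
proof -
  define \<F> where "\<F> = (\<lambda>n z. 1 / (m n z + \<i>))"
  obtain g r where g: "g holomorphic_on upper_half_plane" and r: "strict_mono (r :: nat \<Rightarrow> nat)"
    and gl: "\<And>x. x \<in> upper_half_plane \<Longrightarrow> (\<lambda>n. \<F> (r n) x) \<longlonglongrightarrow> g x"
  proof (rule Montel[OF open_upper_half_plane, of "range \<F>" \<F>])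
    show "h holomorphic_on upper_half_plane" if "h \<in> range \<F>" for h
      using that Herglotz_Cayley(1)[OF H] by (auto simp: \<F>_def)
    show "\<exists>B. \<forall>h\<in>range \<F>. \<forall>z\<in>K. cmod (h z) \<le> B" if "compact K" "K \<subseteq> upper_half_plane" for K
    proof -
      have "cmod (\<F> n z) \<le> 1" if "z \<in> K" for n z
        using Herglotz_Cayley(2)[OF H, of z n] that \<open>K \<subseteq> _\<close> by (auto simp: \<F>_def subset_iff)
      then show ?thesis by blast
    qed
  qed auto
  have gl': "g z = 1 / (l z + \<i>)" if "Im z > 0" for z
  proof -
    have "(\<lambda>n. \<F> n z) \<longlonglongrightarrow> 1 / (l z + \<i>)"
      unfolding \<F>_def using add_ii_nonzero[OF pos[OF that]]
      by (intro tendsto_intros lim that) auto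
    from LIMSEQ_subseq_LIMSEQ[OF this r] gl[of z] that show ?thesis
      using LIMSEQ_unique by (fastforce simp: o_def)
  qed
  have "(\<lambda>z. 1 / g z - \<i>) holomorphic_on upper_half_plane"
    using g gl' add_ii_nonzero[OF pos] by (intro holomorphic_intros) auto
  then have "l holomorphic_on upper_half_plane"
    by (rule holomorphic_transform) (use gl' add_ii_nonzero[OF pos] in auto)
  then show ?thesis using pos by (rule HerglotzI)
qed

section \<open>Uniqueness from boundary values on an interval\<close>

text \<open>Integration gains the regularity that \<phi> lacks. Its primitive \<Phi> is Lipschitz up
  to the boundary, and dominated convergence makes the boundary value of \<Phi> a constant
  \<open>c\<close> on the interval. So \<open>\<Phi> - c\<close>, continued by 0 into the lower half
  plane, is continuous, hence holomorphic across the interval, and vanishes identically.\<close>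

lemma bounded_holomorphic_zero_boundary:
  fixes \<phi> :: "complex \<Rightarrow> complex"
  assumes hol: "\<phi> holomorphic_on upper_half_plane"
    and bd: "\<And>z. Im z > 0 \<Longrightarrow> cmod (\<phi> z) \<le> B"
    and "a < b"
    and ae: "AE x in lebesgue. x \<in> {a<..<b} \<longrightarrow> has_boundary_value \<phi> x 0"
    and z: "Im z > 0"
  shows "\<phi> z = 0"
proof -
  have "B \<ge> 0" using bd[OF z] norm_ge_zero order_trans by blast
  obtain \<Phi> where \<Phi>0: "\<And>x. x \<in> upper_half_plane \<Longrightarrow> (\<Phi> has_field_derivative \<phi> x) (at x within upper_half_plane)"
    using holomorphic_convex_primitive'[OF convex_upper_half_plane open_upper_half_plane hol] by blast
  have \<Phi>: "(\<Phi> has_field_derivative \<phi> x) (at x)" if "Im x > 0" for x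
    using \<Phi>0[of x] that at_within_open[OF _ open_upper_half_plane, of x] by simp
  have Lip: "cmod (\<Phi> u - \<Phi> v) \<le> B * cmod (u - v)" if "Im u > 0" "Im v > 0" for u v
    by (rule field_differentiable_bound[OF convex_upper_half_plane \<Phi>0]) (use that bd in auto)
  have cont\<phi>: "continuous_on upper_half_plane \<phi>" by (rule holomorphic_on_imp_continuous_on[OF hol])
  define e where "e = (\<lambda>n::nat. 1 / real (Suc n))"
  have e: "e n > 0" "e \<longlonglongrightarrow> 0" for n
    unfolding e_def using LIMSEQ_inverse_real_of_nat by (auto simp: inverse_eq_divide)
  define X where "X = {x \<in> {a<..<b}. \<not> has_boundary_value \<phi> x 0}"
  have negX: "negligible X"
  proof -
    from ae obtain N where N: "N \<in> null_sets lebesgue" "X \<subseteq> N"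
      by (auto simp: X_def eventually_ae_filter subset_iff)
    then show ?thesis
      using negligible_iff_null_sets negligible_subset by blast
  qed
  have diff0: "(\<lambda>n. \<Phi> (Complex y (e n)) - \<Phi> (Complex x (e n))) \<longlonglongrightarrow> 0" if xy: "a < x" "x \<le> y" "y < b" for x y
  proof -
    \<comment> \<open>Setting the integrand to 0 on the exceptional null set gives convergence at
      every point, as \<open>dominated_convergence\<close> demands, and leaves the integrals
      unchanged.\<close>
    define f where "f = (\<lambda>n t. if t \<in> X then 0 else \<phi> (Complex t (e n)))"
    have hi: "((\<lambda>t. \<phi> (Complex t (e n))) has_integral \<Phi> (Complex y (e n)) - \<Phi> (Complex x (e n))) {x..y}" for n
    proof (rule fundamental_theorem_of_calculus[OF xy(2)])
      fix t
      have "((\<lambda>t. Complex t (e n)) has_vector_derivative 1) (at t within {x..y})"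
        unfolding Complex_eq by (auto intro!: derivative_eq_intros simp: has_vector_derivative_def scaleR_conv_of_real)
      from field_vector_diff_chain_within[OF this] \<Phi>[of "Complex t (e n)"] e(1)[of n]
      show "((\<lambda>t. \<Phi> (Complex t (e n))) has_vector_derivative \<phi> (Complex t (e n))) (at t within {x..y})"
        by (auto simp: o_def has_field_derivative_at_within)
    qed
    have hi': "(f n has_integral \<Phi> (Complex y (e n)) - \<Phi> (Complex x (e n))) {x..y}" for n
      by (rule has_integral_spike[OF negX _ hi[of n]]) (auto simp: f_def)
    have lim: "(\<lambda>n. f n t) \<longlonglongrightarrow> 0" if "t \<in> {x..y}" for t
    proof (cases "t \<in> X")
      case False
      then have "has_boundary_value \<phi> t 0" using that xy by (auto simp: X_def)
      then have "((\<lambda>y. \<phi> (Complex t y)) \<longlongrightarrow> 0) (at_right 0)" by (simp add: has_boundary_value_def)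
      moreover have "filterlim e (at_right 0) sequentially"
        using e(2) e(1)[THEN less_imp_neq, THEN not_sym] e(1) by (simp add: filterlim_at)
      ultimately have "(\<lambda>n. \<phi> (Complex t (e n))) \<longlonglongrightarrow> 0"
        by (rule filterlim_compose)
      then show ?thesis using False by (simp add: f_def)
    qed (simp add: f_def)
    have "(\<lambda>n. integral {x..y} (f n)) \<longlonglongrightarrow> integral {x..y} (\<lambda>t. 0)"
      by (rule dominated_convergence(2)[where h = "\<lambda>_. B"])
         (use hi' lim bd e(1) \<open>B \<ge> 0\<close> in \<open>auto simp: f_def integrable_on_def intro: that\<close>)
    moreover have "integral {x..y} (f n) = \<Phi> (Complex y (e n)) - \<Phi> (Complex x (e n))" for n
      using hi' by (rule integral_unique)
    ultimately show ?thesis by simp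
  qed
  define x0 where "x0 = (a + b) / 2"
  have x0: "a < x0" "x0 < b" using \<open>a < b\<close> by (auto simp: x0_def)
  \<comment> \<open>The Lipschitz bound on one vertical line yields a limit \<open>c\<close>;
    \<open>diff0\<close> carries it to all other points of the interval.\<close>
  have "Cauchy (\<lambda>n. \<Phi> (Complex x0 (e n)))"
  proof (rule metric_CauchyI)
    fix d :: real assume "d > 0"
    have "Cauchy e" using e(2) LIMSEQ_imp_Cauchy by blast
    then obtain M where M: "\<And>m n. m \<ge> M \<Longrightarrow> n \<ge> M \<Longrightarrow> dist (e m) (e n) < d / (B + 1)"
      using metric_CauchyD[of e "d / (B+1)"] \<open>d > 0\<close> \<open>B \<ge> 0\<close> by auto
    have "dist (\<Phi> (Complex x0 (e m))) (\<Phi> (Complex x0 (e n))) < d" if "m \<ge> M" "n \<ge> M" for m n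
    proof -
      have "dist (\<Phi> (Complex x0 (e m))) (\<Phi> (Complex x0 (e n))) \<le> B * cmod (Complex x0 (e m) - Complex x0 (e n))"
        unfolding dist_norm by (rule Lip) (use e in auto)
      also have "cmod (Complex x0 (e m) - Complex x0 (e n)) = dist (e m) (e n)"
        by (simp add: cmod_def dist_real_def)
      also have "B * dist (e m) (e n) \<le> (B + 1) * dist (e m) (e n)" by (simp add: mult_right_mono)
      also have "\<dots> < d" using M[OF that] \<open>B \<ge> 0\<close> by (simp add: field_simps)
      finally show ?thesis .
    qed
    then show "\<exists>M. \<forall>m\<ge>M. \<forall>n\<ge>M. dist (\<Phi> (Complex x0 (e m))) (\<Phi> (Complex x0 (e n))) < d" by blast
  qed
  then obtain c where c0: "(\<lambda>n. \<Phi> (Complex x0 (e n))) \<longlonglongrightarrow> c"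
    using Cauchy_convergent convergent_def by blast
  have c: "(\<lambda>n. \<Phi> (Complex x (e n))) \<longlonglongrightarrow> c" if "a < x" "x < b" for x
  proof (cases "x0 \<le> x")
    case True
    from tendsto_add[OF diff0[of x0 x] c0] that x0 True show ?thesis by simp
  next
    case False
    from tendsto_diff[OF c0 diff0[of x x0]] that x0 False show ?thesis by simp
  qed
  \<comment> \<open>The bound \<open>cmod (\<Psi> u) \<le> B * \<bar>Im u\<bar>\<close> proved below
    is what makes this extension by 0 continuous on the real segment.\<close>
  define \<Psi> where "\<Psi> = (\<lambda>u. if Im u > 0 then \<Phi> u - c else 0)"
  define S where "S = {u. a < Re u \<and> Re u < b}"
  have S: "open S" "convex S"
  proof -
    have "S = {u. Re u > a} \<inter> {u. Re u < b}" by (auto simp: S_def)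
    then show "open S" "convex S"
      by (simp_all add: open_Int open_halfspace_Re_gt open_halfspace_Re_lt convex_Int convex_halfspace_Re_gt convex_halfspace_Re_lt)
  qed
  have \<Psi>le: "cmod (\<Psi> u) \<le> B * \<bar>Im u\<bar>" if "u \<in> S" for u
  proof (cases "Im u > 0")
    case True
    have "(\<lambda>n. cmod (\<Phi> u - \<Phi> (Complex (Re u) (e n)))) \<longlonglongrightarrow> cmod (\<Phi> u - c)"
      using that by (intro tendsto_intros c) (auto simp: S_def)
    moreover have "(\<lambda>n. B * cmod (u - Complex (Re u) (e n))) \<longlonglongrightarrow> B * cmod (u - Complex (Re u) 0)"
      unfolding Complex_eq by (intro tendsto_intros e)
    ultimately have "cmod (\<Phi> u - c) \<le> B * cmod (u - Complex (Re u) 0)"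
      by (rule LIMSEQ_le) (use Lip True e in auto)
    moreover have "cmod (u - Complex (Re u) 0) = \<bar>Im u\<bar>" by (simp add: cmod_def)
    ultimately show ?thesis using True by (simp add: \<Psi>_def)
  qed (use \<open>B \<ge> 0\<close> in \<open>simp add: \<Psi>_def mult_nonneg_nonpos\<close>)
  have h1: "\<Psi> holomorphic_on (S \<inter> {u. \<i> \<bullet> u < 0})"
    by (rule holomorphic_transform[of "\<lambda>_. 0"]) (auto simp: \<Psi>_def)
  have h2: "\<Psi> holomorphic_on (S \<inter> {u. 0 < \<i> \<bullet> u})"
  proof (rule holomorphic_transform[of "\<lambda>u. \<Phi> u - c"])
    have "\<Phi> holomorphic_on upper_half_plane"
      using \<Phi>0 unfolding holomorphic_on_def field_differentiable_def by blast
    then show "(\<lambda>u. \<Phi> u - c) holomorphic_on (S \<inter> {u. 0 < \<i> \<bullet> u})"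
      by (intro holomorphic_intros) (auto elim: holomorphic_on_subset)
  qed (auto simp: \<Psi>_def)
  have "isCont \<Psi> u" if "u \<in> S" for u
  proof (cases "Im u = 0")
    case True
    have "eventually (\<lambda>v. v \<in> S) (at u)"
      using S(1) that by (rule eventually_at_in_open')
    then have ev: "eventually (\<lambda>v. cmod (\<Psi> v) \<le> B * \<bar>Im v\<bar>) (at u)"
      by eventually_elim (rule \<Psi>le)
    have "((\<lambda>v. B * \<bar>Im v\<bar>) \<longlongrightarrow> B * \<bar>Im u\<bar>) (at u)" by (intro tendsto_intros)
    then have "(\<Psi> \<longlongrightarrow> 0) (at u)"
      using Lim_null_comparison[OF ev] True by simp
    then show ?thesis using True by (simp add: isCont_def \<Psi>_def)
  next
    case False
    have "open (S \<inter> {u. \<i> \<bullet> u < 0})" "open (S \<inter> {u. 0 < \<i> \<bullet> u})"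
      using S(1) by (auto intro!: open_Int open_halfspace_Im_lt open_halfspace_Im_gt)
    moreover have "u \<in> S \<inter> {u. \<i> \<bullet> u < 0} \<or> u \<in> S \<inter> {u. 0 < \<i> \<bullet> u}"
      using False that by auto
    ultimately show ?thesis
      using holomorphic_on_imp_differentiable_at[OF h1] holomorphic_on_imp_differentiable_at[OF h2]
        field_differentiable_imp_continuous_at by blast
  qed
  then have cont: "continuous_on S \<Psi>" by (simp add: continuous_at_imp_continuous_on)
  have hol\<Psi>: "\<Psi> holomorphic_on S"
    by (rule holomorphic_on_paste_across_line[OF S(1) _ h1 h2 cont]) auto
  have \<Psi>0: "\<Psi> u = 0" if "u \<in> S" for u
  proof (rule analytic_continuation_open[of "S \<inter> {u. \<i> \<bullet> u < 0}" S \<Psi> "\<lambda>_. 0"])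
    show "open (S \<inter> {u. \<i> \<bullet> u < 0})" using S(1) by (auto intro!: open_Int open_halfspace_Im_lt)
    have "Complex x0 (-1) \<in> S \<inter> {u. \<i> \<bullet> u < 0}" using x0 by (auto simp: S_def)
    then show "S \<inter> {u. \<i> \<bullet> u < 0} \<noteq> {}" by blast
    show "connected S" using S(2) convex_connected by blast
  qed (use S that hol\<Psi> in \<open>auto simp: \<Psi>_def\<close>)
  define T where "T = S \<inter> upper_half_plane"
  have T: "open T" using S open_upper_half_plane by (auto simp: T_def)
  have \<phi>T: "\<phi> u = 0" if "u \<in> T" for u
  proof -
    have "(\<Phi> has_field_derivative \<phi> u) (at u)" using that \<Phi> by (simp add: T_def)
    moreover have "((\<lambda>_. c) has_field_derivative 0) (at u)" by simp
    then have "(\<Phi> has_field_derivative 0) (at u)"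
      by (rule has_field_derivative_transform_within_open[OF _ T that]) (use \<Psi>0 in \<open>force simp: T_def \<Psi>_def\<close>)
    ultimately show ?thesis using DERIV_unique by blast
  qed
  show ?thesis
  proof (rule analytic_continuation_open[of T upper_half_plane \<phi> "\<lambda>_. 0"])
    have "Complex x0 1 \<in> T" using x0 by (auto simp: S_def T_def)
    then show "T \<noteq> {}" by blast
    show "connected upper_half_plane" using convex_upper_half_plane convex_connected by blast
  qed (use T open_upper_half_plane hol z \<phi>T in \<open>auto simp: T_def\<close>)
qed

text \<open>The difference of the two bounded transforms is bounded by 2. A boundary value
  \<open>w\<close> lies in the closed upper half plane, so \<open>w + \<i>\<close> is nonzero and
  the transforms have equal boundary values where \<open>g\<close> and \<open>h\<close> do.\<close>

lemma Herglotz_unique: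
  assumes g: "Herglotz g" and h: "Herglotz h" and "a < b"
    and ae: "AE x in lebesgue. x \<in> {a<..<b} \<longrightarrow> (\<exists>w. has_boundary_value g x w \<and> has_boundary_value h x w)"
    and z: "Im z > 0"
  shows "g z = h z"
proof -
  define \<phi> where "\<phi> = (\<lambda>z. 1 / (g z + \<i>) - 1 / (h z + \<i>))"
  have "\<phi> z = 0"
  proof (rule bounded_holomorphic_zero_boundary[of _ 2, OF _ _ \<open>a < b\<close> _ z])
    show "\<phi> holomorphic_on upper_half_plane"
      unfolding \<phi>_def using Herglotz_Cayley(1) g h by (intro holomorphic_on_diff)
    show "cmod (\<phi> u) \<le> 2" if "Im u > 0" for u
      unfolding \<phi>_def using Herglotz_Cayley(2)[OF g that] Herglotz_Cayley(2)[OF h that]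
      by (intro norm_triangle_le_diff) simp
    show "AE x in lebesgue. x \<in> {a<..<b} \<longrightarrow> has_boundary_value \<phi> x 0"
      using ae
    proof eventually_elim
      case (elim x)
      show ?case
      proof
        assume "x \<in> {a<..<b}"
        with elim obtain w where w: "((\<lambda>y. g (Complex x y)) \<longlongrightarrow> w) (at_right 0)" "((\<lambda>y. h (Complex x y)) \<longlongrightarrow> w) (at_right 0)"
          by (auto simp: has_boundary_value_def)
        have "eventually (\<lambda>y. 0 \<le> Im (g (Complex x y))) (at_right 0)"
          using eventually_at_right_less[of 0]
          by eventually_elim (use HerglotzD(2)[OF g] in \<open>simp add: less_imp_le\<close>)
        then have "0 \<le> Im w"
          by (intro tendsto_lowerbound[OF tendsto_Im[OF w(1)]]) auto
        then have "w + \<i> \<noteq> 0" by (auto simp: complex_eq_iff)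
        then have "((\<lambda>y. \<phi> (Complex x y)) \<longlongrightarrow> 1 / (w + \<i>) - 1 / (w + \<i>)) (at_right 0)"
          unfolding \<phi>_def by (intro tendsto_intros w) auto
        then show "has_boundary_value \<phi> x 0" by (simp add: has_boundary_value_def)
      qed
    qed
  qed
  then show ?thesis
    using add_ii_nonzero HerglotzD(2)[OF g z] HerglotzD(2)[OF h z] by (simp add: \<phi>_def)
qed

lemma bounded_unique_limit_point_imp_tendsto:
  fixes x :: "nat \<Rightarrow> 'a::heine_borel"
  assumes bd: "bounded (range x)"
    and uniq: "\<And>r l'. strict_mono (r::nat \<Rightarrow> nat) \<Longrightarrow> (x \<circ> r) \<longlonglongrightarrow> l' \<Longrightarrow> l' = l"
  shows "x \<longlonglongrightarrow> l"
proof (rule ccontr)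
  assume "\<not> x \<longlonglongrightarrow> l"
  then obtain e where e: "e > 0" "\<And>N. \<exists>n\<ge>N. dist (x n) l \<ge> e"
    unfolding lim_sequentially not_all not_ex not_imp not_less by blast
  define I where "I = {n. dist (x n) l \<ge> e}"
  have "infinite I"
    unfolding infinite_nat_iff_unbounded_le I_def using e(2) by simp
  then obtain r :: "nat \<Rightarrow> nat" where r: "strict_mono r" "\<And>n. r n \<in> I"
    using infinite_enumerate by blast
  have "bounded (range (x \<circ> r))"
    by (rule bounded_subset[OF bd]) auto
  then obtain l' s where s: "strict_mono s" "((x \<circ> r) \<circ> s) \<longlonglongrightarrow> l'"
    using bounded_imp_convergent_subsequence by blast
  have "(\<lambda>n. dist (x (r (s n))) l) \<longlonglongrightarrow> dist l' l"
    using tendsto_dist[OF s(2) tendsto_const[of l]] by (simp add: comp_def)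
  then have "e \<le> dist l' l"
    by (rule LIMSEQ_le_const) (use r(2) in \<open>simp add: I_def\<close>)
  moreover have "l' = l"
    using uniq[OF strict_mono_o[OF r(1) s(1)]] s(2) by (simp add: comp_assoc)
  ultimately show False using e(1) by simp
qed

section \<open>Jacobi matrices\<close>

lemma square_root_quadrant:
  fixes w :: complex
  assumes "Re w \<ge> 0"
  shows "Im (w\<^sup>2) > 0 \<Longrightarrow> Re w > 0 \<and> Im w > 0"
    and "Im (w\<^sup>2) < 0 \<Longrightarrow> Re w > 0 \<and> Im w < 0"
  using assms by (auto simp: power2_eq_square zero_less_mult_iff mult_less_0_iff)

lemma csqrt_upper:
  assumes "Im z > 0"
  shows "Re (csqrt z) > 0" "Im (csqrt z) > 0"
  using square_root_quadrant(1)[of "csqrt z"] assms csqrt_principal[of z]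
  unfolding power2_csqrt by fastforce+

lemma csqrt_lower:
  assumes "Im z < 0"
  shows "Re (csqrt z) > 0" "Im (csqrt z) < 0"
  using square_root_quadrant(2)[of "csqrt z"] assms csqrt_principal[of z]
  unfolding power2_csqrt by fastforce+

text \<open>The root of \<open>w + 1/w = z\<close> in the unit disc. As a square root of
  \<open>z\<^sup>2 - 4\<close>, the product \<open>\<i> * csqrt (2 - z) * csqrt (z + 2)\<close> has
  its cuts on the real rays beyond -2 and 2, so \<open>jouk\<close> is continuous up to the interval
  in between; \<open>csqrt (z\<^sup>2 - 4)\<close> would jump across the imaginary axis.\<close>

definition jouk :: "complex \<Rightarrow> complex" where
  "jouk z = (z - \<i> * csqrt (2 - z) * csqrt (z + 2)) / 2"

lemma jouk_eq: "(jouk z)\<^sup>2 - z * jouk z + 1 = 0"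
proof -
  define s where "s = \<i> * csqrt (2 - z) * csqrt (z + 2)"
  have "s\<^sup>2 = - ((2 - z) * (z + 2))"
    unfolding s_def power_mult_distrib power2_csqrt by (simp add: algebra_simps)
  then have s: "s\<^sup>2 = z\<^sup>2 - 4" by (simp add: power2_eq_square algebra_simps)
  have "(jouk z)\<^sup>2 - z * jouk z + 1 = (s\<^sup>2 - z\<^sup>2 + 4) / 4"
    unfolding jouk_def s_def[symmetric] by (simp add: power2_eq_square algebra_simps add_divide_distrib diff_divide_distrib)
  then show ?thesis using s by simp
qed

lemma jouk_nonzero: "jouk z \<noteq> 0"
  using jouk_eq[of z] by auto

lemma jouk_sum: "jouk z + 1 / jouk z = z"
proof -
  have "jouk z * jouk z + 1 = z * jouk z" using jouk_eq[of z] by (simp add: power2_eq_square algebra_simps)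
  then show ?thesis using jouk_nonzero[of z] by (simp add: field_simps)
qed

text \<open>The product of \<open>jouk z\<close> and the other root \<open>w'\<close> is 1, so it
  suffices that \<open>w'\<close> has the larger modulus. The difference of the squared moduli is a
  positive multiple of \<open>Re (p * cnj q)\<close>, and \<open>p\<close> and \<open>q\<close> both
  lie in the open first quadrant.\<close>

lemma norm_jouk_less_1:
  assumes "Im z > 0"
  shows "cmod (jouk z) < 1"
proof -
  define p q where "p = \<i> * csqrt (2 - z)" and "q = csqrt (z + 2)"
  have p: "Re p > 0" "Im p > 0" using csqrt_lower[of "2 - z"] assms by (auto simp: p_def)
  have q: "Re q > 0" "Im q > 0" using csqrt_upper[of "z + 2"] assms by (auto simp: q_def)
  have pz: "p\<^sup>2 = z - 2" "q\<^sup>2 = z + 2" by (simp_all add: p_def q_def power_mult_distrib)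
  have w: "jouk z = (z - p * q) / 2" by (simp add: jouk_def p_def q_def)
  define w' where "w' = (z + p * q) / 2"
  have prod: "jouk z * w' = 1"
  proof -
    have "jouk z * w' = (z\<^sup>2 - p\<^sup>2 * q\<^sup>2) / 4"
      by (simp add: w w'_def power2_eq_square algebra_simps)
    also have "\<dots> = 1" unfolding pz by (simp add: power2_eq_square algebra_simps)
    finally show ?thesis .
  qed
  have z: "z = (p\<^sup>2 + q\<^sup>2) / 2" unfolding pz by simp
  have id: "(cmod w')\<^sup>2 - (cmod (jouk z))\<^sup>2 = Re (z * cnj (p * q))"
    unfolding w w'_def cmod_power2 by (simp add: power2_eq_square field_simps)
  also have "\<dots> = ((cmod p)\<^sup>2 + (cmod q)\<^sup>2) * Re (p * cnj q) / 2"
    unfolding z cmod_power2 by (simp add: power2_eq_square field_simps)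
  also have "\<dots> > 0"
  proof -
    have "Re (p * cnj q) > 0" using p q by (simp add: add_pos_pos)
    moreover have "(cmod p)\<^sup>2 + (cmod q)\<^sup>2 > 0" using p by (intro add_pos_nonneg) auto
    ultimately show ?thesis by simp
  qed
  finally have lt: "cmod (jouk z) < cmod w'" by (simp add: power_less_imp_less_base)
  have "cmod (jouk z) * cmod w' = 1" using arg_cong[OF prod, of cmod] by (simp add: norm_mult)
  moreover have "cmod (jouk z) * cmod (jouk z) < cmod (jouk z) * cmod w'"
    using lt jouk_nonzero[of z] by (intro mult_strict_left_mono) auto
  ultimately have "(cmod (jouk z))\<^sup>2 < 1" by (simp add: power2_eq_square)
  then show ?thesis by (simp add: abs_square_less_1)
qed

lemma Im_jouk_neg:
  assumes "Im z > 0"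
  shows "Im (jouk z) < 0"
proof -
  define w where "w = jouk z"
  have w: "cmod w < 1" "w \<noteq> 0" using norm_jouk_less_1[OF assms] jouk_nonzero by (auto simp: w_def)
  have "Im z = Im w + Im (1 / w)" using arg_cong[OF jouk_sum[of z], of Im] by (simp add: w_def)
  also have "Im (1 / w) = - Im w / (cmod w)\<^sup>2" by (simp add: Im_divide cmod_power2)
  finally have eq: "Im z = Im w * (1 - 1 / (cmod w)\<^sup>2)" by (simp add: field_simps)
  have "(cmod w)\<^sup>2 < 1" using w by (simp add: power_less_one_iff abs_square_less_1)
  then have "1 - 1 / (cmod w)\<^sup>2 < 0" using w by (simp add: field_simps)
  with eq assms have "Im w * (1 - 1 / (cmod w)\<^sup>2) > 0" by simp
  with \<open>1 - 1 / (cmod w)\<^sup>2 < 0\<close> show ?thesis by (auto simp: zero_less_mult_iff w_def)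
qed

lemma jouk_holomorphic: "jouk holomorphic_on upper_half_plane"
  unfolding jouk_def by (intro holomorphic_intros) (auto simp: complex_nonpos_Reals_iff)

lemma jouk_boundary:
  assumes "-2 < x" "x < 2"
  shows "((\<lambda>y. jouk (Complex x y)) \<longlongrightarrow> jouk (of_real x)) (at_right 0)"
    and "cmod (jouk (of_real x)) = 1" and "jouk (of_real x) \<noteq> 1"
proof -
  have C: "((\<lambda>y. Complex x y) \<longlongrightarrow> of_real x) (at_right 0)"
  proof -
    have "((\<lambda>y. of_real x + \<i> * of_real y) \<longlongrightarrow> of_real x + \<i> * of_real 0) (at_right 0)"
      by (intro tendsto_intros)
    then show ?thesis by (simp add: Complex_eq)
  qed
  have "isCont jouk (of_real x)"
    unfolding jouk_def using assms by (intro continuous_intros) (auto simp: complex_nonpos_Reals_iff)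
  from isCont_tendsto_compose[OF this C]
  show "((\<lambda>y. jouk (Complex x y)) \<longlongrightarrow> jouk (of_real x)) (at_right 0)" .
  have 1: "csqrt (2 - of_real x) = of_real (sqrt (2 - x))"
    using assms of_real_sqrt[of "2 - x"] by simp
  have 2: "csqrt (of_real x + 2) = of_real (sqrt (x + 2))"
    using assms of_real_sqrt[of "x + 2"] by simp
  have j: "jouk (of_real x) = Complex (x / 2) (- sqrt (2 - x) * sqrt (x + 2) / 2)"
    unfolding jouk_def 1 2 by (simp add: complex_eq_iff)
  have "(cmod (jouk (of_real x)))\<^sup>2 = 1"
    unfolding cmod_power2 j using assms
    by (simp add: power_divide power_mult_distrib) (simp add: power2_eq_square field_simps)
  then show "cmod (jouk (of_real x)) = 1" by (intro power2_eq_imp_eq[of _ 1]) auto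
  show "jouk (of_real x) \<noteq> 1"
    unfolding j using assms by (simp add: complex_eq_iff)
qed

text \<open>With \<open>w = jouk z\<close>, the other solutions of the free recursion grow like \<open>w ^ (-n)\<close>.\<close>

lemma free_recursion_decaying:
  fixes f :: "nat \<Rightarrow> complex"
  assumes rec: "\<And>n. n \<ge> 2 \<Longrightarrow> f (n + 1) + f (n - 1) = z * f n"
    and lim: "f \<longlonglongrightarrow> 0" and z: "Im z > 0" and "n \<ge> 1"
  shows "f (n + 1) = jouk z * f n"
proof -
  define w where "w = jouk z"
  have w: "w\<^sup>2 - z * w + 1 = 0" "w \<noteq> 0" "cmod w < 1"
    using jouk_eq jouk_nonzero norm_jouk_less_1[OF z] by (auto simp: w_def)
  \<comment> \<open>This combination annihilates the mode \<open>w ^ n\<close>. What is left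
    satisfies \<open>g k = w * g (k + 1)\<close>, so the decay of \<open>f\<close> forces it to be
    0.\<close>
  define g where "g n = f (n + 1) - w * f n" for n
  have step: "g k = w * g (k + 1)" if "k \<ge> 1" for k
  proof -
    have "f (k + 2) = z * f (k + 1) - f k" using rec[of "k + 1"] that by (simp add: algebra_simps)
    have "w * g (k + 1) = w * f (k + 2) - w * w * f (k + 1)"
      by (simp add: g_def right_diff_distrib mult.assoc)
    also have "\<dots> = (w * z - w\<^sup>2) * f (k + 1) - w * f k"
      unfolding \<open>f (k + 2) = _\<close> by (simp add: power2_eq_square algebra_simps)
    also have "w * z - w\<^sup>2 = 1" using w(1) by (auto simp: algebra_simps diff_eq_eq eq_diff_eq)
    finally show ?thesis by (simp add: g_def)
  qed
  have pow: "g n = w ^ k * g (n + k)" for k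
  proof (induction k)
    case (Suc k)
    then show ?case using step[of "n + k"] \<open>n \<ge> 1\<close> by (simp add: mult.assoc mult.commute)
  qed simp
  have "(\<lambda>k. f (k + n)) \<longlonglongrightarrow> 0" "(\<lambda>k. f (k + (n + 1))) \<longlonglongrightarrow> 0"
    using LIMSEQ_ignore_initial_segment[OF lim] by blast+
  then have "(\<lambda>k. f (k + (n + 1)) - w * f (k + n)) \<longlonglongrightarrow> 0 - w * 0"
    by (intro tendsto_intros)
  then have g0: "(\<lambda>k. g (n + k)) \<longlonglongrightarrow> 0" by (simp add: g_def ac_simps)
  have "(\<lambda>k. w ^ k * g (n + k)) \<longlonglongrightarrow> 0 * 0"
    by (intro tendsto_intros g0 LIMSEQ_power_zero w)
  then have "(\<lambda>k::nat. g n) \<longlonglongrightarrow> 0" unfolding pow[symmetric] by simp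
  then have "g n = 0" by (simp add: LIMSEQ_const_iff)
  then show ?thesis by (simp add: g_def w_def)
qed

lemma square_summable_on_imp_tendsto_0:
  fixes f :: "nat \<Rightarrow> complex"
  assumes "(\<lambda>n. (cmod (f n))\<^sup>2) summable_on {k..}"
  shows "f \<longlonglongrightarrow> 0"
proof -
  have "(\<lambda>n. (cmod (f n))\<^sup>2) summable_on ({k..} \<union> {..<k})"
    using assms by (intro summable_on_union) auto
  also have "{k..} \<union> {..<k} = UNIV" by auto
  finally have "summable (\<lambda>n. (cmod (f n))\<^sup>2)"
    by (simp add: summable_on_UNIV_nonneg_real_iff)
  then have "(\<lambda>n. (cmod (f n))\<^sup>2) \<longlonglongrightarrow> 0" by (rule summable_LIMSEQ_zero)
  then have "(\<lambda>n. sqrt ((cmod (f n))\<^sup>2)) \<longlonglongrightarrow> sqrt 0" by (intro tendsto_intros)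
  then show ?thesis by (simp add: tendsto_norm_zero_iff)
qed

lemma summable_on_power:
  assumes "cmod w < 1"
  shows "(\<lambda>n. (cmod (c * w ^ n))\<^sup>2) summable_on A"
proof -
  have "summable (\<lambda>n. (cmod c)\<^sup>2 * ((cmod w)\<^sup>2) ^ n)"
    using assms by (intro summable_mult summable_geometric) (simp add: abs_square_less_1)
  then have "summable (\<lambda>n. (cmod (c * w ^ n))\<^sup>2)"
    by (simp add: norm_mult norm_power power_mult_distrib power_mult[symmetric] mult.commute)
  then have "(\<lambda>n. (cmod (c * w ^ n))\<^sup>2) summable_on UNIV"
    by (simp add: summable_on_UNIV_nonneg_real_iff)
  then show ?thesis by (rule summable_on_subset_banach) auto
qed

section \<open>The perturbed free half line matrix\<close>

definition pert_b :: "nat \<Rightarrow> real" where "pert_b n = (if n = 1 then 1 else 0)"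

text \<open>The resolvent is an \<open>inv_into\<close>, which is meaningful only once
  \<open>delta1\<close> is known to be in the range; the geometric sequence \<open>u\<close> shows
  this. Any preimage in \<open>ell2_pos\<close> decays, so \<open>r 2 = w * r 1\<close>, and the
  first row then determines \<open>r 1\<close>.\<close>

lemma half_jacobi_m_pert:
  assumes z: "Im z > 0"
  shows "half_jacobi_m (\<lambda>_. 1) pert_b z = jouk z / (jouk z - 1)"
proof -
  define w where "w = jouk z"
  have w: "w + 1 / w = z" "w \<noteq> 0" "cmod w < 1"
    using jouk_sum jouk_nonzero norm_jouk_less_1[OF z] by (auto simp: w_def)
  have w1: "w \<noteq> 1" using w by auto
  define L where "L = (\<lambda>u n. half_jacobi_op (\<lambda>_. 1) pert_b u n - z * u n)"
  define u where "u n = (if n = 0 then 0 else 1 / (w - 1) * w ^ n)" for n :: nat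
  have zw: "z * w = w * w + 1" using w by (auto simp: field_simps)
  have "u \<in> ell2_pos"
  proof -
    have "(\<lambda>n. (cmod (1 / (w - 1) * w ^ n))\<^sup>2) summable_on {1..}" using w(3) by (rule summable_on_power)
    then have "(\<lambda>n. (cmod (u n))\<^sup>2) summable_on {1..}"
      by (rule summable_on_cong[THEN iffD1, rotated]) (auto simp: u_def)
    then show ?thesis by (simp add: ell2_pos_def u_def)
  qed
  moreover have "L u = delta1"
  proof
    fix n :: nat
    have zwk: "z * (w * x) = w * w * x + x" for x
      using zw by (metis mult.assoc mult.left_commute distrib_right mult_1)
    consider "n = 0" | "n = 1" | k where "n = Suc (Suc k)" by (metis One_nat_def not0_implies_Suc)
    then show "L u n = delta1 n"
    proof cases
      case 2
      have "L u n = (w * w + w - z * w) / (w - 1)"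
        using 2 by (simp add: L_def half_jacobi_op_def u_def pert_b_def numeral_2_eq_2 diff_divide_distrib add_divide_distrib)
      then show ?thesis using 2 w1 by (simp add: zw delta1_def)
    next
      case (3 k)
      have "L u n = (w * (w * (w * w ^ k)) + w * w ^ k - z * (w * (w * w ^ k))) / (w - 1)"
        using 3 by (simp add: L_def half_jacobi_op_def u_def pert_b_def diff_divide_distrib add_divide_distrib)
      then show ?thesis using 3 by (simp add: zwk delta1_def)
    qed (simp add: L_def half_jacobi_op_def u_def delta1_def)
  qed
  ultimately have im: "delta1 \<in> L ` ell2_pos" by force
  define r where "r = half_jacobi_resolvent (\<lambda>_. 1) pert_b z delta1"
  have r: "r \<in> ell2_pos" "L r = delta1"
    using inv_into_into[OF im] f_inv_into_f[OF im]
    by (simp_all add: r_def half_jacobi_resolvent_def L_def)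
  have "r (1 + 1) = jouk z * r 1"
  proof (rule free_recursion_decaying[OF _ _ z])
    show "r (n + 1) + r (n - 1) = z * r n" if "n \<ge> 2" for n
      using fun_cong[OF r(2), of n] that by (simp add: L_def half_jacobi_op_def pert_b_def delta1_def)
    show "r \<longlonglongrightarrow> 0" using r(1) by (auto simp: ell2_pos_def intro: square_summable_on_imp_tendsto_0)
  qed simp
  then have r2: "r 2 = w * r 1" by (simp add: w_def numeral_2_eq_2)
  have "r 2 + r 1 - z * r 1 = 1"
    using fun_cong[OF r(2), of 1] by (simp add: L_def half_jacobi_op_def pert_b_def delta1_def)
  then have "r 1 * (1 - 1 / w) = 1"
    unfolding r2 w(1)[symmetric] by (simp add: algebra_simps)
  then have r1: "r 1 = w / (w - 1)" using w w1 by (simp add: field_simps)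
  have "half_jacobi_m (\<lambda>_. 1) pert_b z = (\<Sum>\<^sub>\<infinity>n\<in>{1..}. cnj (delta1 n) * r n)"
    by (simp add: half_jacobi_m_def ell2_inner_def r_def)
  also have "\<dots> = (\<Sum>\<^sub>\<infinity>n\<in>{1}. cnj (delta1 n) * r n)"
    by (rule infsum_cong_neutral) (auto simp: delta1_def)
  also have "\<dots> = r 1" by (simp add: delta1_def)
  finally show ?thesis using r1 by (simp add: w_def)
qed

section \<open>Solutions and Wronskians on the whole line\<close>

lemma jacobi_solution_lincomb:
  assumes "jacobi_solution a b z f" "jacobi_solution a b z g"
  shows "jacobi_solution a b z (\<lambda>n. c * f n + d * g n)"
  unfolding jacobi_solution_def
proof
  fix n
  define E where "E h = of_real (a n) * h (n + 1) + of_real (a (n - 1)) * h (n - 1) + of_real (b n) * h n - z * h n" for h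
  have "E f = 0" "E g = 0" using assms by (simp_all add: E_def jacobi_solution_def)
  moreover have "E (\<lambda>n. c * f n + d * g n) = c * E f + d * E g"
    by (simp add: E_def algebra_simps)
  ultimately show "of_real (a n) * (c * f (n + 1) + d * g (n + 1)) + of_real (a (n - 1)) * (c * f (n - 1) + d * g (n - 1))
      + of_real (b n) * (c * f n + d * g n) = z * (c * f n + d * g n)"
    by (simp add: E_def)
qed

lemma jacobi_solution_step:
  assumes "jacobi_solution a b z f"
  shows "of_real (a n) * f (n + 1) = z * f n - of_real (b n) * f n - of_real (a (n - 1)) * f (n - 1)"
  using assms unfolding jacobi_solution_def eq_diff_eq by blast

text \<open>The pair after \<open>k\<close> steps is \<open>(f k, f (k + 1))\<close> here and
  \<open>(f (- k), f (1 - k))\<close> in \<open>jacobi_bwd\<close>; both start from the sites 0 and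
  1.\<close>

primrec jacobi_fwd :: "(int \<Rightarrow> real) \<Rightarrow> (int \<Rightarrow> real) \<Rightarrow> complex \<Rightarrow> complex \<times> complex \<Rightarrow> nat \<Rightarrow> complex \<times> complex" where
  "jacobi_fwd a b z p 0 = p"
| "jacobi_fwd a b z p (Suc k) = (let (u, v) = jacobi_fwd a b z p k; n = int k + 1 in
      (v, ((z - of_real (b n)) * v - of_real (a (n - 1)) * u) / of_real (a n)))"

primrec jacobi_bwd :: "(int \<Rightarrow> real) \<Rightarrow> (int \<Rightarrow> real) \<Rightarrow> complex \<Rightarrow> complex \<times> complex \<Rightarrow> nat \<Rightarrow> complex \<times> complex" where
  "jacobi_bwd a b z p 0 = p"
| "jacobi_bwd a b z p (Suc k) = (let (u, v) = jacobi_bwd a b z p k; n = - int k in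
      (((z - of_real (b n)) * u - of_real (a n) * v) / of_real (a (n - 1)), u))"

lemma jacobi_solution_exists:
  assumes a: "\<And>n. a n > 0"
  obtains f where "jacobi_solution a b z f" "f 0 = c" "f 1 = d"
proof
  define P where "P = jacobi_fwd a b z (c, d)"
  define N where "N = jacobi_bwd a b z (c, d)"
  define f where "f n = (if n \<ge> 0 then fst (P (nat n)) else fst (N (nat (- n))))" for n :: int
  have an: "complex_of_real (a n) \<noteq> 0" for n using a[of n] by simp
  show f01: "f 0 = c" "f 1 = d" by (simp_all add: f_def P_def)
  show "jacobi_solution a b z f"
    unfolding jacobi_solution_def
  proof
    fix n :: int
    show "of_real (a n) * f (n + 1) + of_real (a (n - 1)) * f (n - 1) + of_real (b n) * f n = z * f n"
    proof (cases "n > 0")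
      case True
      then obtain k where k: "n = int k + 1" by (metis add.commute zero_less_imp_eq_int of_nat_Suc Suc_pred)
      have "f (n + 1) = fst (P (Suc (Suc k)))" "f n = fst (P (Suc k))" "f (n - 1) = fst (P k)"
        using k by (simp_all add: f_def nat_add_distrib)
      then show ?thesis using k an
        by (simp add: P_def Let_def split: prod.splits) (simp add: field_simps)
    next
      case False
      then obtain k where k: "n = - int k" by (metis minus_minus neg_0_le_iff_le not_le zero_le_imp_eq_int)
      have fN: "f (- int j) = fst (N j)" for j
        using f01 by (cases "j = 0") (auto simp: f_def N_def P_def)
      have "n - 1 = - int (Suc k)" using k by simp
      then have "f (n - 1) = fst (N (Suc k))" by (simp only: fN)
      moreover have "f n = fst (N k)" unfolding fN[symmetric] using k by simp
      moreover have "f (n + 1) = snd (N k)"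
      proof (cases k)
        case (Suc j)
        then have "f (n + 1) = fst (N j)" unfolding fN[symmetric] using k by simp
        then show ?thesis using Suc by (simp add: N_def Let_def split: prod.splits)
      qed (use k f01 in \<open>auto simp: N_def\<close>)
      ultimately show ?thesis using k an
        by (simp add: N_def Let_def split: prod.splits) (simp add: field_simps)
    qed
  qed
qed

lemma jacobi_solution_unique:
  assumes a: "\<And>n. a n > 0" and f: "jacobi_solution a b z f" and "f 0 = 0" "f 1 = 0"
  shows "f n = 0"
proof -
  have an: "complex_of_real (a n) \<noteq> 0" for n using a[of n] by simp
  have "f n = 0 \<and> f (n + 1) = 0"
  proof (induction n rule: int_induct[of _ 0])
    case (step1 i)
    have "of_real (a (i + 1)) * f (i + 1 + 1) = 0"
      using f step1 unfolding jacobi_solution_def by (metis add_diff_cancel_right' add_0_right mult_zero_right)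
    then show ?case using an step1 by simp
  next
    case (step2 i)
    have "of_real (a (i - 1)) * f (i - 1) = 0"
      using f step2 unfolding jacobi_solution_def by (metis add_0_left add_0_right mult_zero_right)
    then show ?case using an step2 by simp
  qed (use assms in auto)
  then show ?thesis by simp
qed

lemma summable_on_int_nonpos:
  "(\<lambda>n. F n) summable_on {..0::int} \<longleftrightarrow> (\<lambda>j. F (- int j)) summable_on UNIV"
proof -
  have "bij_betw (\<lambda>j. - int j) UNIV {..0}"
    by (rule bij_betwI[where g = "\<lambda>n. nat (- n)"]) auto
  from summable_on_reindex_bij_betw[OF this, of F] show ?thesis by simp
qed

lemma summable_on_int_nonneg:
  "(\<lambda>n. F n) summable_on {0::int..} \<longleftrightarrow> (\<lambda>j. F (int j)) summable_on UNIV"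
proof -
  have "bij_betw int UNIV {0..}"
    by (rule bij_betwI[where g = nat]) auto
  from summable_on_reindex_bij_betw[OF this, of F] show ?thesis by simp
qed

text \<open>The Wronskian is the same at all sites and tends to 0 at minus infinity because
  \<open>a\<close> is bounded. Square summable solutions are thus proportional, which makes the m
  function independent of the choice by \<open>SOME\<close>.\<close>

lemma jacobi_wronskian_minus:
  assumes J: "jacobi_matrix a b"
    and f: "jacobi_solution a b z f" "(\<lambda>n. (cmod (f n))\<^sup>2) summable_on {..0}"
    and g: "jacobi_solution a b z g" "(\<lambda>n. (cmod (g n))\<^sup>2) summable_on {..0}"
  shows "f 1 * g 0 = f 0 * g 1"
proof -
  define W where "W n = of_real (a n) * (f (n + 1) * g n - f n * g (n + 1))" for n
  have step: "W (n - 1) = W n" for n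
  proof -
    have "W n = (of_real (a n) * f (n + 1)) * g n - f n * (of_real (a n) * g (n + 1))"
      by (simp add: W_def algebra_simps)
    also have "\<dots> = (z * f n - of_real (b n) * f n - of_real (a (n - 1)) * f (n - 1)) * g n
        - f n * (z * g n - of_real (b n) * g n - of_real (a (n - 1)) * g (n - 1))"
      unfolding jacobi_solution_step[OF f(1)] jacobi_solution_step[OF g(1)] ..
    also have "\<dots> = W (n - 1)" by (simp add: W_def algebra_simps)
    finally show ?thesis by simp
  qed
  have const: "W (- int k) = W 0" for k
  proof (induction k)
    case (Suc k)
    have "- int (Suc k) = - int k - 1" by simp
    show ?case unfolding \<open>- int (Suc k) = _\<close> using Suc step[of "- int k"] by (rule trans[rotated])
  qed simp
  obtain C where C: "\<And>n. \<bar>a n\<bar> \<le> C"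
    using J by (auto simp: jacobi_matrix_def bounded_iff)
  have f0: "(\<lambda>k. f (- int k)) \<longlonglongrightarrow> 0" and g0: "(\<lambda>k. g (- int k)) \<longlonglongrightarrow> 0"
    using f(2) g(2) unfolding summable_on_int_nonpos
    by (auto intro!: square_summable_on_imp_tendsto_0[of _ 0])
  have W_le: "cmod (W (- int (Suc k))) \<le> C * (cmod (f (- int k) * g (- int (Suc k)) - f (- int (Suc k)) * g (- int k)))" for k
    unfolding W_def norm_mult using C[of "- int (Suc k)"] by (auto intro!: mult_mono simp: algebra_simps)
  have f1: "(\<lambda>k. f (- int (Suc k))) \<longlonglongrightarrow> 0" and g1: "(\<lambda>k. g (- int (Suc k))) \<longlonglongrightarrow> 0"
    using LIMSEQ_Suc[OF f0] LIMSEQ_Suc[OF g0] by auto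
  have W_ev: "eventually (\<lambda>k. cmod (W (- int (Suc k))) \<le> C * (cmod (f (- int k) * g (- int (Suc k)) - f (- int (Suc k)) * g (- int k)))) sequentially"
    by (intro always_eventually allI W_le)
  have "(\<lambda>k. C * cmod (f (- int k) * g (- int (Suc k)) - f (- int (Suc k)) * g (- int k))) \<longlonglongrightarrow> C * cmod (0 * 0 - 0 * 0)"
    by (intro tendsto_intros f0 g0 f1 g1)
  then have "(\<lambda>k. C * cmod (f (- int k) * g (- int (Suc k)) - f (- int (Suc k)) * g (- int k))) \<longlonglongrightarrow> 0"
    by simp
  then have "(\<lambda>k. W (- int (Suc k))) \<longlonglongrightarrow> 0"
    by (rule Lim_null_comparison[OF W_ev])
  then have "W 0 = 0" unfolding const by (simp add: LIMSEQ_const_iff)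
  moreover have "a 0 \<noteq> 0" using J by (metis jacobi_matrix_def less_irrefl)
  ultimately show ?thesis by (simp add: W_def)
qed

text \<open>Green's identity over the sites from \<open>1 - K\<close> to 0; taking imaginary parts
  removes the real coefficients.\<close>

lemma jacobi_Im_flux:
  assumes f: "jacobi_solution a b z f"
  shows "Im (cnj (f 0) * of_real (a 0) * f 1) =
    Im z * (\<Sum>j<K. (cmod (f (- int j)))\<^sup>2) + Im (cnj (f (- int K)) * of_real (a (- int K)) * f (1 - int K))"
proof (induction K)
  case (Suc K)
  define n where "n = - int K"
  have "cnj (f n) * of_real (a n) * f (n + 1)
      = z * (cnj (f n) * f n) - of_real (b n) * (cnj (f n) * f n) - of_real (a (n - 1)) * (cnj (f n) * f (n - 1))"
    unfolding mult.assoc jacobi_solution_step[OF f] by (simp add: algebra_simps)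
  also have "Im \<dots> = Im z * (cmod (f n))\<^sup>2 + Im (cnj (f (n - 1)) * of_real (a (n - 1)) * f n)"
    unfolding cmod_power2 by (simp add: power2_eq_square algebra_simps)
  finally have "Im (cnj (f n) * of_real (a n) * f (n + 1)) = \<dots>" .
  note step = this
  have idx: "- int (Suc K) = n - 1" "1 - int (Suc K) = n" "1 - int K = n + 1" "- int K = n" by (simp_all add: n_def)
  show ?case using Suc.IH unfolding sum.lessThan_Suc distrib_left idx step by linarith
qed simp

section \<open>Dirichlet truncations and the m function at minus infinity\<close>

text \<open>Index \<open>j\<close> stands for the site \<open>j - N - 1\<close>: this is the
  solution with value 0 at the site \<open>- N - 1\<close> and value 1 at \<open>- N\<close>.
  Counting up from the Dirichlet end makes it a polynomial in \<open>z\<close>.\<close>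

fun trunc_sol :: "(int \<Rightarrow> real) \<Rightarrow> (int \<Rightarrow> real) \<Rightarrow> nat \<Rightarrow> nat \<Rightarrow> complex \<Rightarrow> complex" where
  "trunc_sol a b N 0 z = 0"
| "trunc_sol a b N (Suc 0) z = 1"
| "trunc_sol a b N (Suc (Suc k)) z = ((z - of_real (b (int k - int N))) * trunc_sol a b N (Suc k) z
      - of_real (a (int k - int N - 1)) * trunc_sol a b N k z) / of_real (a (int k - int N))"

text \<open>The sites 0 and 1 have the indices \<open>N + 1\<close> and \<open>N + 2\<close>, so
  this is the \<open>m\<^sub>-\<close> of the matrix cut off by a Dirichlet condition at
  \<open>- N - 1\<close>.\<close>

definition trunc_m :: "(int \<Rightarrow> real) \<Rightarrow> (int \<Rightarrow> real) \<Rightarrow> nat \<Rightarrow> complex \<Rightarrow> complex" where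
  "trunc_m a b N z = trunc_sol a b N (N + 2) z / (of_real (a 0) * trunc_sol a b N (N + 1) z)"

lemma Im_cor_mult: "Im (of_real r * w) = r * Im w" by simp

lemma trunc_sol_holomorphic:
  assumes "\<And>n. a n > 0"
  shows "trunc_sol a b N k holomorphic_on S"
  using assms
proof (induction a b N k "0::complex" rule: trunc_sol.induct)
  case (3 a b N k)
  have "(\<lambda>z. ((z - of_real (b (int k - int N))) * trunc_sol a b N (Suc k) z
      - of_real (a (int k - int N - 1)) * trunc_sol a b N k z) / of_real (a (int k - int N))) holomorphic_on S"
    using 3 less_imp_neq[OF 3(3)] by (intro holomorphic_intros) auto
  also have "(\<lambda>z. ((z - of_real (b (int k - int N))) * trunc_sol a b N (Suc k) z
      - of_real (a (int k - int N - 1)) * trunc_sol a b N k z) / of_real (a (int k - int N))) = trunc_sol a b N (Suc (Suc k))"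
    by (rule ext) simp
  finally show ?case .
next
  case (1 a b N)
  have "trunc_sol a b N 0 = (\<lambda>_. 0)" by (rule ext) simp
  then show ?case by simp
next
  case (2 a b N)
  have "trunc_sol a b N (Suc 0) = (\<lambda>_. 1)" by (rule ext) simp
  then show ?case by simp
qed

text \<open>Green's identity from the Dirichlet end, where the boundary term vanishes. The flux is
  therefore positive, which yields both the absence of zeros and the Herglotz property of
  \<open>trunc_m\<close>.\<close>

lemma trunc_sol_flux:
  assumes a: "\<And>n. a n > 0"
  shows "Im (cnj (trunc_sol a b N k z) * of_real (a (int k - int N - 1)) * trunc_sol a b N (Suc k) z)
    = Im z * (\<Sum>j\<le>k. (cmod (trunc_sol a b N j z))\<^sup>2)"
proof (induction k)
  case (Suc k)
  define G where "G j = trunc_sol a b N j z" for j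
  define n where "n = int k - int N"
  have "of_real (a n) * G (Suc (Suc k)) = z * G (Suc k) - of_real (b n) * G (Suc k) - of_real (a (n - 1)) * G k"
    using less_imp_neq[OF a[of n]] by (simp add: G_def n_def[symmetric] left_diff_distrib)
  note G_step = this
  have "cnj (G (Suc k)) * of_real (a n) * G (Suc (Suc k))
      = z * (cnj (G (Suc k)) * G (Suc k)) - of_real (b n) * (cnj (G (Suc k)) * G (Suc k))
        - of_real (a (n - 1)) * (cnj (G (Suc k)) * G k)"
    unfolding mult.assoc G_step by (simp add: algebra_simps)
  also have "Im \<dots> = Im z * (cmod (G (Suc k)))\<^sup>2 + Im (cnj (G k) * of_real (a (n - 1)) * G (Suc k))"
    unfolding cmod_power2 by (simp add: power2_eq_square algebra_simps)
  finally have "Im (cnj (G (Suc k)) * of_real (a n) * G (Suc (Suc k))) = \<dots>" .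
  then show ?case using Suc.IH unfolding n_def G_def
    by (simp add: algebra_simps del: trunc_sol.simps(3))
qed simp

lemma trunc_sol_nonzero:
  assumes a: "\<And>n. a n > 0" and z: "Im z > 0"
  shows "trunc_sol a b N (Suc k) z \<noteq> 0"
    and "0 < Im (cnj (trunc_sol a b N (Suc k) z) * of_real (a (int (Suc k) - int N - 1)) * trunc_sol a b N (Suc (Suc k)) z)"
proof -
  have "(cmod (trunc_sol a b N 1 z))\<^sup>2 \<le> (\<Sum>j\<le>Suc k. (cmod (trunc_sol a b N j z))\<^sup>2)"
    by (intro member_le_sum) auto
  then have "(\<Sum>j\<le>Suc k. (cmod (trunc_sol a b N j z))\<^sup>2) > 0" by simp
  with z have "Im z * (\<Sum>j\<le>Suc k. (cmod (trunc_sol a b N j z))\<^sup>2) > 0" by (rule mult_pos_pos)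
  then show 1: "0 < Im (cnj (trunc_sol a b N (Suc k) z) * of_real (a (int (Suc k) - int N - 1)) * trunc_sol a b N (Suc (Suc k)) z)"
    by (simp only: trunc_sol_flux[where a = a, OF a])
  show "trunc_sol a b N (Suc k) z \<noteq> 0"
  proof
    assume "trunc_sol a b N (Suc k) z = 0"
    with 1 show False by (simp del: trunc_sol.simps(3))
  qed
qed

lemma trunc_m_Herglotz:
  assumes a: "\<And>n. a n > 0"
  shows "Herglotz (trunc_m a b N)"
proof (rule HerglotzI)
  show "trunc_m a b N holomorphic_on upper_half_plane"
    unfolding trunc_m_def using trunc_sol_nonzero(1)[where a = a, OF a] less_imp_neq[OF a[of 0]]
    by (intro holomorphic_intros trunc_sol_holomorphic a) (auto simp del: trunc_sol.simps(3))
  fix z assume z: "Im z > 0"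
  define u v where "u = trunc_sol a b N (N + 1) z" and "v = trunc_sol a b N (N + 2) z"
  have u: "u \<noteq> 0" using trunc_sol_nonzero(1)[where a = a, OF a z] by (simp add: u_def del: trunc_sol.simps(3))
  have "0 < Im (cnj u * of_real (a 0) * v)"
    using trunc_sol_nonzero(2)[where a = a, OF a z, where b = b and N = N and k = N] by (simp add: u_def v_def del: trunc_sol.simps(3))
  also have "cnj u * of_real (a 0) * v = of_real ((a 0)\<^sup>2 * (cmod u)\<^sup>2) * (v / (of_real (a 0) * u))"
    using u less_imp_neq[OF a[of 0]] unfolding of_real_mult complex_norm_square[of u]
    by (simp add: field_simps power2_eq_square)
  finally have "0 < (a 0)\<^sup>2 * (cmod u)\<^sup>2 * Im (v / (of_real (a 0) * u))" by (simp only: Im_cor_mult)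
  moreover have "(a 0)\<^sup>2 * (cmod u)\<^sup>2 > 0" using u less_imp_neq[OF a[of 0]] by simp
  ultimately have "Im (v / (of_real (a 0) * u)) > 0" by (rule zero_less_mult_pos)
  then show "Im (trunc_m a b N z) > 0"
    unfolding trunc_m_def u_def v_def .
qed

lemma trunc_sol_eq_solution:
  assumes a: "\<And>n. a n > 0" and z: "Im z > 0"
    and f: "jacobi_solution a b z f" "f 0 = 1" "f 1 = of_real (a 0) * trunc_m a b N z"
    and "j \<le> N + 1"
  shows "f (- int j) = trunc_sol a b N (N + 1 - j) z / trunc_sol a b N (N + 1) z \<and>
         f (1 - int j) = trunc_sol a b N (N + 2 - j) z / trunc_sol a b N (N + 1) z"
  using \<open>j \<le> N + 1\<close>
proof (induction j)
  case 0
  have "trunc_sol a b N (Suc N) z \<noteq> 0" "a 0 \<noteq> 0" using trunc_sol_nonzero(1)[where a = a, OF a z] a[of 0] by auto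
  then show ?case using f by (simp add: trunc_m_def)
next
  case (Suc j)
  define G where "G j = trunc_sol a b N j z" for j
  define n where "n = - int j"
  have an: "complex_of_real (a n) \<noteq> 0" "complex_of_real (a (n - 1)) \<noteq> 0" using a[of n] a[of "n - 1"] by simp_all
  have G1: "G (N + 1) \<noteq> 0" using trunc_sol_nonzero(1)[where a = a, OF a z] by (simp add: G_def)
  define k where "k = N - j"
  have k: "N + 1 - j = Suc k" "N + 2 - j = Suc (Suc k)" "N + 1 - Suc j = k" "int k - int N = n" "N + 2 - Suc j = Suc k"
    using Suc.prems by (auto simp: k_def n_def)
  have idx: "- int (Suc j) = n - 1" "1 - int (Suc j) = n" "1 - int j = n + 1" "- int j = n" by (simp_all add: n_def)
  have IH: "f n = G (Suc k) / G (N + 1)" "f (n + 1) = G (Suc (Suc k)) / G (N + 1)"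
    using Suc.IH Suc.prems unfolding k(1,2) idx G_def by auto
  have "of_real (a n) * f (n + 1) = z * f n - of_real (b n) * f n - of_real (a (n - 1)) * f (n - 1)"
    by (rule jacobi_solution_step[OF f(1)])
  then have "of_real (a (n - 1)) * f (n - 1) = (z - of_real (b n)) * f n - of_real (a n) * f (n + 1)"
    by (simp add: algebra_simps)
  also have "\<dots> = ((z - of_real (b n)) * G (Suc k) - of_real (a n) * G (Suc (Suc k))) / G (N + 1)"
    unfolding IH by (simp add: diff_divide_distrib)
  also have "of_real (a n) * G (Suc (Suc k)) = (z - of_real (b n)) * G (Suc k) - of_real (a (n - 1)) * G k"
    using an k(4) by (simp add: G_def)
  finally have "of_real (a (n - 1)) * f (n - 1) = of_real (a (n - 1)) * (G k / G (N + 1))" by simp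
  then have "f (n - 1) = G k / G (N + 1)" using an(2) by (rule mult_left_cancel[THEN iffD1, rotated])
  then show ?case unfolding idx k using IH by (simp add: G_def)
qed

text \<open>The flux that remains at the site \<open>- K\<close> is nonnegative, because up to a
  positive factor it is the flux of the truncated solution. For \<open>N\<close> tending to infinity
  the bound gives square summability at minus infinity.\<close>

lemma trunc_m_sum_le:
  assumes a: "\<And>n. a n > 0" and z: "Im z > 0"
    and f: "jacobi_solution a b z f" "f 0 = 1" "f 1 = of_real (a 0) * trunc_m a b N z"
    and K: "K \<le> N + 1"
  shows "Im z * (\<Sum>j<K. (cmod (f (- int j)))\<^sup>2) \<le> (a 0)\<^sup>2 * Im (trunc_m a b N z)"
proof -
  define G where "G j = trunc_sol a b N j z" for j
  define c where "c = G (N + 1)"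
  define k where "k = N + 1 - K"
  have k: "N + 2 - K = Suc k" "int k - int N - 1 = - int K" using K by (auto simp: k_def)
  have fK: "f (- int K) = G k / c" "f (1 - int K) = G (Suc k) / c"
    using trunc_sol_eq_solution[where a = a, OF a z f K] unfolding k(1) k_def[symmetric] G_def c_def by auto
  have "cnj (f (- int K)) * of_real (a (- int K)) * f (1 - int K)
      = (cnj (G k) * of_real (a (int k - int N - 1)) * G (Suc k)) / of_real ((cmod c)\<^sup>2)"
    unfolding fK k(2) complex_norm_square by (simp add: mult.commute)
  then have "Im (cnj (f (- int K)) * of_real (a (- int K)) * f (1 - int K))
      = Im (cnj (G k) * of_real (a (int k - int N - 1)) * G (Suc k)) / (cmod c)\<^sup>2"
    by (simp only: Im_divide_of_real)
  moreover have "Im (cnj (G k) * of_real (a (int k - int N - 1)) * G (Suc k)) \<ge> 0"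
    unfolding G_def trunc_sol_flux[where a = a, OF a] using z by (simp add: sum_nonneg)
  ultimately have "Im (cnj (f (- int K)) * of_real (a (- int K)) * f (1 - int K)) \<ge> 0" by simp
  moreover have "Im (cnj (f 0) * of_real (a 0) * f 1) = (a 0)\<^sup>2 * Im (trunc_m a b N z)"
    using f(2,3) by (simp add: power2_eq_square)
  ultimately show ?thesis using jacobi_Im_flux[OF f(1), of K] by linarith
qed

text \<open>Each limit point of \<open>trunc_m\<close> belongs to a solution that is square summable
  at minus infinity, and the Wronskian admits only one such value. The second claim is the single
  term of \<open>trunc_m_sum_le\<close> at the site 0, where the solution is 1; it is the growth
  condition that rules out the extension.\<close>

lemma jacobi_m_minus_limit:
  assumes J: "jacobi_matrix a b" and z: "Im z > 0"
  shows "(\<lambda>N. trunc_m a b N z) \<longlonglongrightarrow> jacobi_m_minus a b z"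
    and "Im z \<le> (a 0)\<^sup>2 * Im (jacobi_m_minus a b z)"
proof -
  have a: "\<And>n. a n > 0" using J by (simp add: jacobi_matrix_def)
  have a0: "a 0 > 0" "complex_of_real (a 0) \<noteq> 0" using a[of 0] by simp_all
  obtain \<theta> where \<theta>: "jacobi_solution a b z \<theta>" "\<theta> 0 = 1" "\<theta> 1 = 0"
    using jacobi_solution_exists[where a = a, OF a] by blast
  obtain \<phi> where \<phi>: "jacobi_solution a b z \<phi>" "\<phi> 0 = 0" "\<phi> 1 = 1"
    using jacobi_solution_exists[where a = a, OF a] by blast
  define S where "S \<mu> n = 1 * \<theta> n + of_real (a 0) * \<mu> * \<phi> n" for \<mu> n
  have S: "jacobi_solution a b z (S \<mu>)" "S \<mu> 0 = 1" "S \<mu> 1 = of_real (a 0) * \<mu>" for \<mu>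
    using jacobi_solution_lincomb[OF \<theta>(1) \<phi>(1), of 1 "of_real (a 0) * \<mu>"] \<theta> \<phi>
    unfolding S_def by simp_all
  define m where "m N = trunc_m a b N z" for N
  have le: "Im z * (\<Sum>j<K. (cmod (S (m N) (- int j)))\<^sup>2) \<le> (a 0)\<^sup>2 * Im (m N)" if "K \<le> N + 1" for K N
    unfolding m_def by (rule trunc_m_sum_le[where a = a, OF a z S(1) S(2) S(3) that])
  have lim: "(\<lambda>n. (cmod (S \<mu> n))\<^sup>2) summable_on {..0} \<and> Im z \<le> (a 0)\<^sup>2 * Im \<mu>"
    if r: "strict_mono (r :: nat \<Rightarrow> nat)" and l: "(m \<circ> r) \<longlonglongrightarrow> \<mu>" for r \<mu>
  proof -
    have le\<mu>: "Im z * (\<Sum>j<K. (cmod (S \<mu> (- int j)))\<^sup>2) \<le> (a 0)\<^sup>2 * Im \<mu>" for K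
    proof (rule LIMSEQ_le)
      have l': "(\<lambda>N. m (r N)) \<longlonglongrightarrow> \<mu>" using l by (simp add: o_def)
      show "(\<lambda>N. Im z * (\<Sum>j<K. (cmod (S (m (r N)) (- int j)))\<^sup>2)) \<longlonglongrightarrow> Im z * (\<Sum>j<K. (cmod (S \<mu> (- int j)))\<^sup>2)"
        unfolding S_def by (intro tendsto_intros l')
      show "(\<lambda>N. (a 0)\<^sup>2 * Im (m (r N))) \<longlonglongrightarrow> (a 0)\<^sup>2 * Im \<mu>" by (intro tendsto_intros l')
      show "\<exists>N. \<forall>n\<ge>N. Im z * (\<Sum>j<K. (cmod (S (m (r n)) (- int j)))\<^sup>2) \<le> (a 0)\<^sup>2 * Im (m (r n))"
      proof (intro exI allI impI le)
        fix n assume "n \<ge> K"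
        then show "K \<le> r n + 1" using seq_suble[OF r, of n] by linarith
      qed
    qed
    have "summable (\<lambda>j. (cmod (S \<mu> (- int j)))\<^sup>2)"
    proof (rule bounded_imp_summable)
      fix n
      have "(\<Sum>j\<le>n. (cmod (S \<mu> (- int j)))\<^sup>2) = (\<Sum>j<Suc n. (cmod (S \<mu> (- int j)))\<^sup>2)"
        by (simp only: lessThan_Suc_atMost)
      also have "\<dots> \<le> (a 0)\<^sup>2 * Im \<mu> / Im z" using le\<mu>[of "Suc n"] z by (simp only: pos_le_divide_eq mult.commute)
      finally show "(\<Sum>j\<le>n. (cmod (S \<mu> (- int j)))\<^sup>2) \<le> (a 0)\<^sup>2 * Im \<mu> / Im z" .
    qed auto
    then show ?thesis
      using le\<mu>[of 1] S(2)[of \<mu>] by (simp add: summable_on_int_nonpos summable_on_UNIV_nonneg_real_iff)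
  qed
  have wr: "g 1 = of_real (a 0) * \<mu> * g 0"
    if r: "strict_mono (r :: nat \<Rightarrow> nat)" and l: "(m \<circ> r) \<longlonglongrightarrow> \<mu>"
      and g: "jacobi_solution a b z g" "(\<lambda>n. (cmod (g n))\<^sup>2) summable_on {..0}" for r \<mu> g
    using jacobi_wronskian_minus[OF J g S(1) conjunct1[OF lim[OF r l]]] S[of \<mu>] by simp
  \<comment> \<open>The terms at the sites 0 and -1 suffice: the one at -1 is quadratic in
    \<open>m N\<close>, the right hand side is linear. Two terms require
    \<open>N \<ge> 1\<close>.\<close>
  have "bounded (range m)"
  proof -
    define w c where "w = z - of_real (b 0)" and "c = (a (-1))\<^sup>2 / Im z"
    have a1: "a (-1) > 0" by (rule a)
    have "c > 0" using z a1 by (simp add: c_def)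
    have bd: "cmod (m N) \<le> (2 * cmod w + c) / (a 0)\<^sup>2" if "N \<ge> 1" for N
    proof -
      define x where "x = of_real ((a 0)\<^sup>2) * m N"
      have "of_real (a (-1)) * S (m N) (-1) = w - x"
        using jacobi_solution_step[OF S(1)[of "m N"], of 0] S(2,3)[of "m N"]
        by (simp add: w_def x_def power2_eq_square algebra_simps)
      then have "S (m N) (-1) = (w - x) / of_real (a (-1))" using a1 by (simp add: field_simps)
      then have S1: "(cmod (S (m N) (-1)))\<^sup>2 = (cmod (x - w))\<^sup>2 / (a (-1))\<^sup>2"
        by (simp add: norm_divide power_divide norm_minus_commute)
      have Imx: "Im x = (a 0)\<^sup>2 * Im (m N)" by (simp only: x_def Im_cor_mult)
      have "(\<Sum>j<2. (cmod (S (m N) (- int j)))\<^sup>2) = (cmod (S (m N) 0))\<^sup>2 + (cmod (S (m N) (-1)))\<^sup>2"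
        by (simp add: numeral_2_eq_2)
      then have "Im z * ((cmod (S (m N) 0))\<^sup>2 + (cmod (x - w))\<^sup>2 / (a (-1))\<^sup>2) \<le> Im x"
        using le[of 2 N] that unfolding Imx S1 by simp
      moreover have "Im z * (cmod (S (m N) 0))\<^sup>2 \<ge> 0" using z by simp
      ultimately have "Im z * ((cmod (x - w))\<^sup>2 / (a (-1))\<^sup>2) \<le> Im x" unfolding distrib_left by linarith
      also have "Im x \<le> cmod x" using abs_Im_le_cmod[of x] by linarith
      also have "cmod x \<le> cmod w + cmod (x - w)" by (rule norm_triangle_sub)
      finally have "(cmod (x - w))\<^sup>2 \<le> c * (cmod w + cmod (x - w))"
        using z a1 by (simp add: c_def field_simps)
      moreover have "c * (cmod w + t) < t\<^sup>2" if "t > c + cmod w" for t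
      proof -
        define W where "W = cmod w"
        have W: "W \<ge> 0" "t > c + W" using that by (simp_all add: W_def)
        then have "t > 0" using \<open>c > 0\<close> by linarith
        have "t * (t - c - W) > 0" using W \<open>t > 0\<close> by (intro mult_pos_pos) linarith+
        moreover have "W * (t - c) \<ge> 0" using W by (intro mult_nonneg_nonneg) linarith+
        moreover have "t\<^sup>2 - c * (W + t) = t * (t - c - W) + W * (t - c)"
          by (simp add: power2_eq_square algebra_simps)
        ultimately show ?thesis unfolding W_def by linarith
      qed
      ultimately have "cmod (x - w) \<le> c + cmod w" using not_le by blast
      then have "cmod x \<le> 2 * cmod w + c" using norm_triangle_sub[of x w] by linarith
      moreover have "cmod x = (a 0)\<^sup>2 * cmod (m N)" unfolding x_def norm_mult norm_of_real by simp
      ultimately show ?thesis using a0 by (simp add: field_simps)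
    qed
    have "cmod (m N) \<le> max ((2 * cmod w + c) / (a 0)\<^sup>2) (cmod (m 0))" for N
      using bd[of N] by (cases "N = 0") auto
    then show ?thesis unfolding bounded_iff by blast
  qed
  have uniq: "\<mu> = \<mu>'"
    if "strict_mono (r :: nat \<Rightarrow> nat)" "(m \<circ> r) \<longlonglongrightarrow> \<mu>" "strict_mono (r' :: nat \<Rightarrow> nat)" "(m \<circ> r') \<longlonglongrightarrow> \<mu>'" for r r' \<mu> \<mu>'
    using wr[OF that(1,2) S(1) conjunct1[OF lim[OF that(3,4)]]] S[of \<mu>'] a0 by simp
  obtain r \<mu> where r: "strict_mono (r :: nat \<Rightarrow> nat)" "(m \<circ> r) \<longlonglongrightarrow> \<mu>"
    using bounded_imp_convergent_subsequence[OF \<open>bounded (range m)\<close>] by blast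
  have conv: "m \<longlonglongrightarrow> \<mu>"
    by (rule bounded_unique_limit_point_imp_tendsto[OF \<open>bounded (range m)\<close>]) (use uniq r in blast)
  define g where "g = jacobi_f_minus a b z"
  have g: "jacobi_solution a b z g" "\<exists>n. g n \<noteq> 0" "(\<lambda>n. (cmod (g n))\<^sup>2) summable_on {..0}"
  proof -
    have "S \<mu> 0 \<noteq> 0" using S(2) by simp
    then have "\<exists>f. jacobi_solution a b z f \<and> (\<exists>n. f n \<noteq> 0) \<and> (\<lambda>n. (cmod (f n))\<^sup>2) summable_on {..0}"
      using S(1) conjunct1[OF lim[OF r]] by blast
    from someI_ex[OF this, folded jacobi_f_minus_def g_def]
    show "jacobi_solution a b z g" "\<exists>n. g n \<noteq> 0" "(\<lambda>n. (cmod (g n))\<^sup>2) summable_on {..0}" by blast+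
  qed
  have g1: "g 1 = of_real (a 0) * \<mu> * g 0" by (rule wr[OF r g(1,3)])
  have "g 0 \<noteq> 0"
  proof
    assume "g 0 = 0"
    then have "g 1 = 0" unfolding g1 by simp
    have "g n = 0" for n by (rule jacobi_solution_unique[where a = a, OF a g(1) \<open>g 0 = 0\<close> \<open>g 1 = 0\<close>])
    with g(2) show False by blast
  qed
  then have "jacobi_m_minus a b z = \<mu>"
    unfolding jacobi_m_minus_def g_def[symmetric] g1 using a0(2) by simp
  then show "(\<lambda>N. trunc_m a b N z) \<longlonglongrightarrow> jacobi_m_minus a b z" "Im z \<le> (a 0)\<^sup>2 * Im (jacobi_m_minus a b z)"
    using conv conjunct2[OF lim[OF r]] unfolding m_def by simp_all
qed

lemma jacobi_m_minus_Herglotz: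
  assumes J: "jacobi_matrix a b"
  shows "Herglotz (jacobi_m_minus a b)"
proof (rule Herglotz_limit[OF trunc_m_Herglotz jacobi_m_minus_limit(1)[OF J]])
  show "a n > 0" for n using J by (simp add: jacobi_matrix_def)
  fix z :: complex assume "Im z > 0"
  with jacobi_m_minus_limit(2)[OF J this] have "0 < (a 0)\<^sup>2 * Im (jacobi_m_minus a b z)" by linarith
  then show "Im (jacobi_m_minus a b z) > 0" by (simp add: zero_less_mult_iff)
qed

section \<open>Whole line extensions of the perturbed matrix\<close>

lemma jouk_mult: "z * jouk z = (jouk z)\<^sup>2 + 1"
  using jouk_eq[of z] by (simp add: algebra_simps eq_diff_eq)

text \<open>The coefficient \<open>A 0\<close> is arbitrary, but it enters only through the product
  \<open>of_real (A 0) * f 0\<close>, which the row at the site 1 determines.\<close>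

lemma jacobi_m_plus_pert:
  assumes J: "jacobi_matrix A B" and R: "jacobi_restricts_to A B (\<lambda>_. 1) pert_b" and z: "Im z > 0"
  shows "jacobi_m_plus A B z = jouk z / (jouk z - 1)"
proof -
  have A: "\<And>n. A n > 0" using J by (simp add: jacobi_matrix_def)
  have A0: "complex_of_real (A 0) \<noteq> 0" using A[of 0] by simp
  define w where "w = jouk z"
  have zw: "z * w = w\<^sup>2 + 1" and w: "w \<noteq> 0" "cmod w < 1"
    using jouk_mult jouk_nonzero norm_jouk_less_1[OF z] by (auto simp: w_def)
  have w1: "w \<noteq> 1" using w by auto
  have AB: "A (int n) = 1" "B (int n) = pert_b n" if "n \<ge> 1" for n
    using R that by (auto simp: jacobi_restricts_to_def)
  have rec: "f (int (n + 1)) + f (int (n - 1)) = z * f (int n)" if "n \<ge> 2" "jacobi_solution A B z f" for n f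
  proof -
    have idx: "int (n + 1) = int n + 1" "int (n - 1) = int n - 1" using that by auto
    have "A (int n - 1) = 1" "A (int n) = 1" "B (int n) = 0"
      using AB[of "n - 1"] AB[of n] that by (auto simp: of_nat_diff pert_b_def)
    then have "f (int n + 1) = z * f (int n) - f (int n - 1)"
      using jacobi_solution_step[OF that(2), of "int n"] by simp
    then show ?thesis unfolding idx by simp
  qed
  have rec1: "f 2 = (z - 1) * f 1 - of_real (A 0) * f 0" if "jacobi_solution A B z f" for f
    using jacobi_solution_step[OF that, of 1] AB[of 1] by (simp add: pert_b_def algebra_simps)
  \<comment> \<open>The powers \<open>w ^ n\<close> with positive \<open>n\<close> solve the rows
    from 2 on; the row at 1 then requires
    \<open>of_real (A 0) * f 0 = (z - 1) * w - w\<^sup>2 = 1 - w\<close>.\<close>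
  obtain f where f: "jacobi_solution A B z f" "f 0 = (1 - w) / of_real (A 0)" "f 1 = w"
    using jacobi_solution_exists[where a = A, OF A] by blast
  have fpow: "f (int (Suc k)) = w ^ Suc k \<and> f (int (Suc (Suc k))) = w ^ Suc (Suc k)" for k
  proof (induction k)
    case 0
    have A0f: "of_real (A 0) * f 0 = 1 - w" using f(2) A0 by simp
    have "f 2 = z * w - 1" unfolding rec1[OF f(1)] A0f f(3) by (simp add: algebra_simps)
    then show ?case using f zw by (simp add: power2_eq_square)
  next
    case (Suc k)
    have "f (int (Suc (Suc (Suc k)))) = z * f (int (Suc (Suc k))) - f (int (Suc k))"
      using rec[OF _ f(1), of "Suc (Suc k)"] by (simp add: eq_diff_eq ac_simps)
    also have "\<dots> = (z * w) * w ^ Suc k - w ^ Suc k" using Suc by simp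
    finally show ?case using Suc unfolding zw by (simp add: power2_eq_square algebra_simps)
  qed
  have "(\<lambda>j. (cmod (f (int j)))\<^sup>2) summable_on UNIV"
  proof -
    have "(\<lambda>j. (cmod (1 * w ^ j))\<^sup>2) summable_on {1..}" by (rule summable_on_power[OF w(2)])
    then have "(\<lambda>j. (cmod (f (int j)))\<^sup>2) summable_on {1..}"
    proof (rule summable_on_cong[THEN iffD1, rotated])
      fix j :: nat assume "j \<in> {1..}"
      then obtain k where "j = Suc k" by (cases j) auto
      then show "(cmod (1 * w ^ j))\<^sup>2 = (cmod (f (int j)))\<^sup>2" using fpow[of k] by simp
    qed
    then have "(\<lambda>j. (cmod (f (int j)))\<^sup>2) summable_on ({1..} \<union> {0})"
      by (intro summable_on_union) auto
    also have "{1..} \<union> {0} = (UNIV :: nat set)" by auto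
    finally show ?thesis .
  qed
  then have "\<exists>f. jacobi_solution A B z f \<and> (\<exists>n. f n \<noteq> 0) \<and> (\<lambda>n. (cmod (f n))\<^sup>2) summable_on {0..}"
    unfolding summable_on_int_nonneg using f w by metis
  from someI_ex[OF this]
  have g: "jacobi_solution A B z (jacobi_f_plus A B z)" "\<exists>n. jacobi_f_plus A B z n \<noteq> 0"
    "(\<lambda>n. (cmod (jacobi_f_plus A B z n))\<^sup>2) summable_on {0..}"
    by (simp_all add: jacobi_f_plus_def)
  define g where "g = jacobi_f_plus A B z"
  note g = g[folded g_def]
  have "g (int (1 + 1)) = jouk z * g (int 1)"
  proof (rule free_recursion_decaying[OF _ _ z])
    show "g (int (n + 1)) + g (int (n - 1)) = z * g (int n)" if "n \<ge> 2" for n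
      by (rule rec[OF that g(1)])
    show "(\<lambda>n. g (int n)) \<longlonglongrightarrow> 0"
      using g(3) unfolding summable_on_int_nonneg by (intro square_summable_on_imp_tendsto_0[of _ 0]) simp
  qed simp
  then have "w * g 1 = (z - 1) * g 1 - of_real (A 0) * g 0"
    using rec1[OF g(1)] by (simp add: w_def)
  then have "of_real (A 0) * g 0 = (z - w - 1) * g 1" by (simp add: algebra_simps)
  also have "z - w - 1 = (1 - w) / w" using zw w by (simp add: field_simps power2_eq_square)
  finally have g0: "of_real (A 0) * g 0 = (1 - w) / w * g 1" .
  have "g 1 \<noteq> 0"
  proof
    assume "g 1 = 0"
    with g0 A0 have "g 0 = 0" by simp
    then have "g n = 0" for n by (rule jacobi_solution_unique[where a = A, OF A g(1) _ \<open>g 1 = 0\<close>])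
    with g(2) show False by blast
  qed
  then have "jacobi_m_plus A B z = - (1 / ((1 - w) / w))"
    unfolding jacobi_m_plus_def g_def[symmetric] g0 by simp
  also have "\<dots> = w / (w - 1)" using w w1 by (simp add: field_simps)
  finally show ?thesis by (simp add: w_def)
qed

lemma has_boundary_value_cong:
  assumes "\<And>z. Im z > 0 \<Longrightarrow> f z = g z"
  shows "has_boundary_value f x w \<longleftrightarrow> has_boundary_value g x w"
  unfolding has_boundary_value_def
  by (rule tendsto_cong) (use eventually_at_right_less[of 0] in eventually_elim, simp add: assms)

lemma has_boundary_value_unique:
  "has_boundary_value f x v \<Longrightarrow> has_boundary_value f x w \<Longrightarrow> v = w"
  unfolding has_boundary_value_def by (rule tendsto_unique) auto

text \<open>On the unit circle \<open>cnj w = 1 / w\<close>, which turns one quotient into minus the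
  conjugate of the other.\<close>

lemma pert_boundary_values:
  assumes "-2 < x" "x < 2"
  shows "\<exists>v. has_boundary_value (\<lambda>z. jouk z / (jouk z - 1)) x (- cnj v) \<and> has_boundary_value (\<lambda>z. 1 / (jouk z - 1)) x v"
proof -
  define w where "w = jouk (of_real x)"
  have lim: "((\<lambda>y. jouk (Complex x y)) \<longlongrightarrow> w) (at_right 0)" and w: "cmod w = 1" "w \<noteq> 1"
    using jouk_boundary[OF assms] by (auto simp: w_def)
  have "w * cnj w = 1" using complex_norm_square[of w] w(1) by simp
  moreover have "w \<noteq> 0" using w by auto
  ultimately have c: "cnj w = 1 / w" by (simp add: eq_divide_eq mult.commute)
  have "has_boundary_value (\<lambda>z. jouk z / (jouk z - 1)) x (w / (w - 1))"
    unfolding has_boundary_value_def using w by (intro tendsto_intros lim) auto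
  moreover have "has_boundary_value (\<lambda>z. 1 / (jouk z - 1)) x (1 / (w - 1))"
    unfolding has_boundary_value_def using w by (intro tendsto_intros lim) auto
  moreover have "w / (w - 1) = - cnj (1 / (w - 1))"
  proof -
    have "w \<noteq> 0" using w by auto
    then show ?thesis using w c by (simp add: field_simps)
  qed
  ultimately show ?thesis by metis
qed

lemma pert_Herglotz: "Herglotz (\<lambda>z. 1 / (jouk z - 1))"
proof (rule HerglotzI)
  show "(\<lambda>z. 1 / (jouk z - 1)) holomorphic_on upper_half_plane"
    using norm_jouk_less_1 by (intro holomorphic_intros jouk_holomorphic) force
  show "Im (1 / (jouk z - 1)) > 0" if "Im z > 0" for z
  proof -
    have "jouk z - 1 \<noteq> 0" using norm_jouk_less_1[OF that] by auto
    then have "(Re (jouk z - 1))\<^sup>2 + (Im (jouk z - 1))\<^sup>2 > 0"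
      by (simp only: complex_neq_0)
    then show ?thesis using Im_jouk_neg[OF that] by (simp add: Im_divide divide_neg_pos)
  qed
qed

text \<open>From \<open>1 / jouk z = z - jouk z\<close> it follows that \<open>jouk z\<close> has
  modulus at most 1/2, and so stays away from 1.\<close>

lemma norm_pert_m_minus_le:
  assumes "Im z \<ge> 3"
  shows "cmod (1 / (jouk z - 1)) \<le> 2"
proof -
  define w where "w = jouk z"
  have w: "cmod w < 1" "w \<noteq> 0" "w + 1 / w = z" using norm_jouk_less_1[of z] jouk_nonzero jouk_sum assms by (auto simp: w_def)
  have "3 \<le> cmod z" using abs_Im_le_cmod[of z] assms by linarith
  also have "cmod z \<le> cmod w + cmod (1 / w)" unfolding w(3)[symmetric] by (rule norm_triangle_ineq)
  finally have "2 \<le> 1 / cmod w" using w by (simp add: norm_divide)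
  then have "cmod w \<le> 1 / 2" using w by (simp add: field_simps)
  then have "1 / 2 \<le> cmod (w - 1)" using norm_triangle_ineq2[of 1 w] by (simp add: norm_minus_commute)
  moreover then have "cmod (w - 1) > 0" by linarith
  ultimately show ?thesis by (simp add: w_def norm_divide divide_le_eq)
qed

text \<open>Two reflectionless partners of the same \<open>m\<^sub>+\<close> share their boundary
  values almost everywhere and are therefore equal. Agreement of \<open>p\<close> and
  \<open>p'\<close> is asked on the upper half plane only, since it is there that the m functions
  are computed.\<close>

lemma reflectionless_pair_transfer:
  assumes "reflectionless_pair p m S" and "{a<..<b} \<subseteq> S"
    and "\<And>z. Im z > 0 \<Longrightarrow> p z = p' z"
    and bv: "\<And>x. x \<in> S \<Longrightarrow> \<exists>v. has_boundary_value p' x (- cnj v) \<and> has_boundary_value m' x v"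
    and "Herglotz m" "Herglotz m'" "a < b" "Im z > 0"
  shows "m z = m' z"
proof (rule Herglotz_unique[OF assms(5-7) _ assms(8)])
  have "AE x in lebesgue. x \<in> S \<longrightarrow>
        (\<exists>wp wm. has_boundary_value p x wp \<and> has_boundary_value m x wm \<and> wp = - cnj wm)"
    using assms(1) by (simp add: reflectionless_pair_def)
  then show "AE x in lebesgue. x \<in> {a<..<b} \<longrightarrow> (\<exists>w. has_boundary_value m x w \<and> has_boundary_value m' x w)"
  proof eventually_elim
    case (elim x)
    show ?case
    proof
      assume "x \<in> {a<..<b}"
      then have "x \<in> S" using assms(2) by auto
      then obtain wm where wm: "has_boundary_value p x (- cnj wm)" "has_boundary_value m x wm" using elim by auto
      obtain v where v: "has_boundary_value p' x (- cnj v)" "has_boundary_value m' x v" using bv[OF \<open>x \<in> S\<close>] by auto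
      have "has_boundary_value p' x (- cnj wm)"
        using wm(1) has_boundary_value_cong[of p p'] assms(3) by blast
      from has_boundary_value_unique[OF this v(1)] have "wm = v" by simp
      with wm v show "\<exists>w. has_boundary_value m x w \<and> has_boundary_value m' x w" by blast
    qed
  qed
qed

lemma reflectionless_pairI:
  assumes "S \<in> sets borel" "emeasure lborel S > 0"
    and "\<And>z. Im z > 0 \<Longrightarrow> p z = p' z"
    and bv: "\<And>x. x \<in> S \<Longrightarrow> \<exists>v. has_boundary_value p' x (- cnj v) \<and> has_boundary_value m' x v"
  shows "reflectionless_pair p m' S"
  unfolding reflectionless_pair_def
proof (intro conjI assms(1,2) AE_I2 impI)
  fix x assume "x \<in> S"
  from bv[OF this] show "\<exists>wp wm. has_boundary_value p x wp \<and> has_boundary_value m' x wm \<and> wp = - cnj wm"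
    using has_boundary_value_cong[of p p'] assms(3) by blast
qed

lemma jacobi_part:
  "\<exists>a b. half_jacobi_matrix a b \<and> half_jacobi_reflectionless a b {-2<..<2} \<and>
            \<not> (\<exists>A B. jacobi_matrix A B \<and> jacobi_reflectionless A B {-2<..<2} \<and>
                  jacobi_restricts_to A B a b)"
proof (intro exI conjI)
  show "half_jacobi_matrix (\<lambda>_. 1) pert_b"
    by (auto simp: half_jacobi_matrix_def pert_b_def bounded_iff intro!: exI[of _ 1])
  have bv: "\<exists>v. has_boundary_value (\<lambda>z. jouk z / (jouk z - 1)) x (- cnj v) \<and> has_boundary_value (\<lambda>z. 1 / (jouk z - 1)) x v"
    if "x \<in> {-2<..<2}" for x using pert_boundary_values[of x] that by simp
  have "reflectionless_pair (half_jacobi_m (\<lambda>_. 1) pert_b) (\<lambda>z. 1 / (jouk z - 1)) {-2<..<2}"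
    by (rule reflectionless_pairI[OF _ _ half_jacobi_m_pert bv]) simp_all
  then show "half_jacobi_reflectionless (\<lambda>_. 1) pert_b {-2<..<2}"
    unfolding half_jacobi_reflectionless_def using pert_Herglotz by blast
  show "\<not> (\<exists>A B. jacobi_matrix A B \<and> jacobi_reflectionless A B {-2<..<2} \<and> jacobi_restricts_to A B (\<lambda>_. 1) pert_b)"
  proof (intro notI, elim exE conjE)
    fix A B assume J: "jacobi_matrix A B" and refl: "jacobi_reflectionless A B {-2<..<2}"
      and R: "jacobi_restricts_to A B (\<lambda>_. 1) pert_b"
    \<comment> \<open>The bound 2 on the forced \<open>m\<^sub>-\<close> would give
      \<open>Im z \<le> 2 * (A 0)\<^sup>2\<close>; the summand 3 breaks this and meets the
      hypothesis of \<open>norm_pert_m_minus_le\<close>.\<close>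
    define z where "z = Complex 0 (3 + 2 * (A 0)\<^sup>2)"
    have z: "Im z > 0" "Im z \<ge> 3" by (simp_all add: z_def add_pos_nonneg)
    have "jacobi_m_minus A B z = 1 / (jouk z - 1)"
      by (rule reflectionless_pair_transfer[OF refl[unfolded jacobi_reflectionless_def], of "-2" 2
            "\<lambda>z. jouk z / (jouk z - 1)" "\<lambda>z. 1 / (jouk z - 1)"])
         (use jacobi_m_plus_pert[OF J R] bv jacobi_m_minus_Herglotz[OF J] pert_Herglotz z in auto)
    then have "Im (jacobi_m_minus A B z) \<le> 2"
      using norm_pert_m_minus_le[OF z(2)] abs_Im_le_cmod[of "jacobi_m_minus A B z"] by simp
    then have "(A 0)\<^sup>2 * Im (jacobi_m_minus A B z) \<le> (A 0)\<^sup>2 * 2" by (intro mult_left_mono) auto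
    with jacobi_m_minus_limit(2)[OF J z(1)] show False by (simp add: z_def)
  qed
qed

section \<open>Linear Volterra equations\<close>

text \<open>\<open>F\<close> is absolutely continuous with derivative \<open>f\<close> almost
  everywhere, expressed through the integral because the potentials are merely integrable.\<close>

definition primitive_on :: "real \<Rightarrow> real \<Rightarrow> (real \<Rightarrow> 'a::euclidean_space) \<Rightarrow> (real \<Rightarrow> 'a) \<Rightarrow> bool" where
  "primitive_on a b f F \<longleftrightarrow> f absolutely_integrable_on {a..b} \<and> (\<forall>x\<in>{a..b}. (f has_integral (F x - F a)) {a..x})"

lemma primitive_on_integral:
  assumes "primitive_on a b f F" "a \<le> x" "x \<le> y" "y \<le> b"
  shows "(f has_integral (F y - F x)) {x..y}"
proof -
  have fx: "(f has_integral (F x - F a)) {a..x}" and fy: "(f has_integral (F y - F a)) {a..y}"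
    using assms by (auto simp: primitive_on_def)
  have "f integrable_on {x..y}"
    by (rule integrable_subinterval_real[OF has_integral_integrable[OF fy]]) (use assms in auto)
  then have fxy: "(f has_integral integral {x..y} f) {x..y}" by (rule integrable_integral)
  have "F x - F a + integral {x..y} f = F y - F a"
    by (rule has_integral_unique[OF has_integral_combine[OF assms(2,3) fx fxy] fy])
  then have "integral {x..y} f = F y - F x" by (simp add: algebra_simps)
  with fxy show ?thesis by simp
qed

lemma primitive_on_continuous:
  assumes "primitive_on a b f F"
  shows "continuous_on {a..b} F"
proof -
  have "f integrable_on {a..b}"
    using assms by (simp add: primitive_on_def absolutely_integrable_on_def)
  then have "continuous_on {a..b} (\<lambda>x. F a + integral {a..x} f)"
    by (intro continuous_intros indefinite_integral_continuous_1)
  moreover have "F a + integral {a..x} f = F x" if "x \<in> {a..b}" for x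
  proof -
    have "(f has_integral (F x - F a)) {a..x}" using assms that by (simp add: primitive_on_def)
    then show ?thesis by (simp add: integral_unique)
  qed
  ultimately show ?thesis by (rule continuous_on_eq)
qed

lemma absolutely_integrable_continuous_mult:
  fixes f g :: "real \<Rightarrow> 'a::{real_normed_algebra,euclidean_space}"
  assumes "continuous_on {a..b} f" "g absolutely_integrable_on {a..b}"
  shows "(\<lambda>t. f t * g t) absolutely_integrable_on {a..b}" "(\<lambda>t. g t * f t) absolutely_integrable_on {a..b}"
proof -
  have b: "bilinear (\<lambda>x y::'a. x * y)" "bilinear (\<lambda>x y::'a. y * x)"
    unfolding bilinear_conv_bounded_bilinear
    by (rule bounded_bilinear_mult bounded_bilinear.flip[OF bounded_bilinear_mult])+
  have m: "f \<in> borel_measurable (lebesgue_on {a..b})"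
    by (rule continuous_imp_measurable_on_sets_lebesgue[OF assms(1)]) auto
  have bd: "bounded (f ` {a..b})"
    using compact_continuous_image[OF assms(1)] compact_imp_bounded by blast
  show "(\<lambda>t. f t * g t) absolutely_integrable_on {a..b}"
    by (rule absolutely_integrable_bounded_measurable_product[OF b(1) m _ bd assms(2)]) auto
  show "(\<lambda>t. g t * f t) absolutely_integrable_on {a..b}"
    by (rule absolutely_integrable_bounded_measurable_product[OF b(2) m _ bd assms(2)]) auto
qed

lemma primitive_on_cong:
  assumes "primitive_on a b f F" "\<And>x. x \<in> {a..b} \<Longrightarrow> F x = G x" "\<And>x. x \<in> {a..b} \<Longrightarrow> f x = g x"
  shows "primitive_on a b g G"
  unfolding primitive_on_def
proof (intro conjI ballI)
  have "f absolutely_integrable_on {a..b}" using assms(1) by (simp add: primitive_on_def)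
  then show "g absolutely_integrable_on {a..b}"
    by (rule absolutely_integrable_spike[OF _ negligible_empty]) (simp add: assms(3))
  fix x assume x: "x \<in> {a..b}"
  then have "(f has_integral (F x - F a)) {a..x}" using assms(1) by (simp add: primitive_on_def)
  then show "(g has_integral (G x - G a)) {a..x}"
    using x assms(2)[of x] assms(2)[of a] assms(3) has_integral_eq[of "{a..x}" f g "F x - F a"] by auto
qed

text \<open>The increments of the difference of both sides over a short interval are bounded by \<open>e\<close> times the
  increments of the integral of \<open>\<bar>f\<bar> + \<bar>g\<bar>\<close>, by continuity of \<open>F\<close> and \<open>G\<close>.\<close>

lemma primitive_on_mult:
  fixes f g F G :: "real \<Rightarrow> 'a::{real_normed_field,euclidean_space}"
  assumes F: "primitive_on a b f F" and G: "primitive_on a b g G"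
  shows "primitive_on a b (\<lambda>t. f t * G t + F t * g t) (\<lambda>x. F x * G x)"
  unfolding primitive_on_def
proof (intro conjI ballI)
  define h where "h t = f t * G t + F t * g t" for t
  have cF: "continuous_on {a..b} F" and cG: "continuous_on {a..b} G"
    using F G by (auto intro: primitive_on_continuous)
  have af: "f absolutely_integrable_on {a..b}" and ag: "g absolutely_integrable_on {a..b}"
    using F G by (auto simp: primitive_on_def)
  show ah: "(\<lambda>t. f t * G t + F t * g t) absolutely_integrable_on {a..b}"
    by (rule set_integral_add(1)[OF absolutely_integrable_continuous_mult(2)[OF cG af] absolutely_integrable_continuous_mult(1)[OF cF ag]])
  then have h: "h absolutely_integrable_on {a..b}" unfolding h_def .
  define nf where "nf t = norm (f t) + norm (g t)" for t
  have nf: "nf absolutely_integrable_on {a..b}"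
    unfolding nf_def
    by (rule set_integral_add(1)[OF absolutely_integrable_norm[OF af, unfolded o_def] absolutely_integrable_norm[OF ag, unfolded o_def]])
  fix y assume y: "y \<in> {a..b}"
  have int: "(h has_integral integral {u..v} h) {u..v}" "(nf has_integral integral {u..v} nf) {u..v}"
    if "a \<le> u" "u \<le> v" "v \<le> b" for u v
  proof -
    have "{u..v} \<subseteq> {a..b}" using that by auto
    from absolutely_integrable_on_subinterval[OF h this] absolutely_integrable_on_subinterval[OF nf this]
    show "(h has_integral integral {u..v} h) {u..v}" "(nf has_integral integral {u..v} nf) {u..v}"
      unfolding absolutely_integrable_on_def by (blast intro: integrable_integral)+
  qed
  define D where "D x = F x * G x - integral {a..x} h" for x
  define H where "H x = integral {a..x} nf" for x
  have D: "D v - D u = F v * G v - F u * G u - integral {u..v} h"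
    and Hd: "H v - H u = integral {u..v} nf" if "a \<le> u" "u \<le> v" "v \<le> b" for u v
  proof -
    have "integral {a..v} h = integral {a..u} h + integral {u..v} h"
         "integral {a..v} nf = integral {a..u} nf + integral {u..v} nf"
      using has_integral_combine[OF that(1,2) int(1)[of a u] int(1)[of u v]]
            has_integral_combine[OF that(1,2) int(2)[of a u] int(2)[of u v]] that
      by (auto intro!: integral_unique)
    then show "D v - D u = F v * G v - F u * G u - integral {u..v} h" "H v - H u = integral {u..v} nf"
      by (simp_all add: D_def H_def)
  qed
  have key: "norm (D y - D a) \<le> e * (H y - H a)" if e: "e > 0" for e
  proof -
    define P where "P u v \<longleftrightarrow> (a \<le> u \<and> v \<le> y \<longrightarrow> norm (D v - D u) \<le> e * (H v - H u))" for u v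
    have "P a y"
    \<comment> \<open>The estimate \<open>P\<close> adds up over adjacent intervals, so bisection
      reduces it to short intervals around each point.\<close>
    proof (rule Bolzano[of a y P])
      show "a \<le> y" using y by simp
      show "P u w" if "P u v" "P v w" "u \<le> v" "v \<le> w" for u v w
        unfolding P_def
      proof
        assume "a \<le> u \<and> w \<le> y"
        then have "norm (D v - D u) \<le> e * (H v - H u)" "norm (D w - D v) \<le> e * (H w - H v)"
          using that by (auto simp: P_def)
        moreover have "norm (D w - D u) \<le> norm (D w - D v) + norm (D v - D u)"
          using norm_triangle_ineq[of "D w - D v" "D v - D u"] by simp
        ultimately show "norm (D w - D u) \<le> e * (H w - H u)" by (simp add: algebra_simps)
      qed
      fix x assume x: "a \<le> x" "x \<le> y"
      have "continuous (at x within {a..b}) F" "continuous (at x within {a..b}) G"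
        using cF cG x y by (auto simp: continuous_on_eq_continuous_within)
      then have ex: "\<exists>d>0. \<forall>t\<in>{a..b}. dist t x < d \<longrightarrow> dist (F t) (F x) < e / 2"
        "\<exists>d>0. \<forall>t\<in>{a..b}. dist t x < d \<longrightarrow> dist (G t) (G x) < e / 2"
        using half_gt_zero[OF e] unfolding continuous_within_eps_delta by blast+
      obtain d1 where d1: "d1 > 0" "\<And>t. t \<in> {a..b} \<Longrightarrow> dist t x < d1 \<Longrightarrow> dist (F t) (F x) < e / 2"
        using ex(1) by blast
      obtain d2 where d2: "d2 > 0" "\<And>t. t \<in> {a..b} \<Longrightarrow> dist t x < d2 \<Longrightarrow> dist (G t) (G x) < e / 2"
        using ex(2) by blast
      note d = d1(1) d2(1) d1(2) d2(2)
      show "\<exists>d>0. \<forall>u v. u \<le> x \<and> x \<le> v \<and> v - u < d \<longrightarrow> P u v"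
      proof (intro exI[of _ "min d1 d2"] conjI allI impI)
        show "min d1 d2 > 0" using d by simp
        fix u v assume uv: "u \<le> x \<and> x \<le> v \<and> v - u < min d1 d2"
        show "P u v" unfolding P_def
        proof
          assume uvab: "a \<le> u \<and> v \<le> y"
          then have uv': "a \<le> u" "u \<le> v" "v \<le> b" using uv y by auto
          have close: "norm (G v - G t) \<le> e" "norm (F u - F t) \<le> e" if t: "t \<in> {u..v}" for t
          proof -
            have mem: "t \<in> {a..b}" "u \<in> {a..b}" "v \<in> {a..b}" using uv' t by auto
            have ds: "dist t x < d1" "dist t x < d2" "dist u x < d1" "dist v x < d2"
              using uv t unfolding dist_real_def by auto
            have "dist (F t) (F x) < e / 2" "dist (F u) (F x) < e / 2"
              by (rule d(3)[OF mem(1) ds(1)], rule d(3)[OF mem(2) ds(3)])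
            moreover have "dist (G t) (G x) < e / 2" "dist (G v) (G x) < e / 2"
              by (rule d(4)[OF mem(1) ds(2)], rule d(4)[OF mem(3) ds(4)])
            ultimately show "norm (G v - G t) \<le> e" "norm (F u - F t) \<le> e"
              using dist_triangle2[of "G v" "G t" "G x"] dist_triangle2[of "F u" "F t" "F x"]
              unfolding dist_norm by linarith+
          qed
          define r where "r t = f t * G v + F u * g t - h t" for t
          have hr: "(r has_integral ((F v - F u) * G v + F u * (G v - G u) - integral {u..v} h)) {u..v}"
            unfolding r_def
            by (intro has_integral_diff has_integral_add has_integral_mult_left has_integral_mult_right
                primitive_on_integral[OF F] primitive_on_integral[OF G] int uv')
          have "norm (D v - D u) = norm (integral {u..v} r)"
            unfolding D[OF uv'] integral_unique[OF hr] by (simp add: algebra_simps)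
          also have "\<dots> \<le> integral {u..v} (\<lambda>t. e * nf t)"
          proof (rule integral_norm_bound_integral)
            show "r integrable_on {u..v}" using hr by (auto simp: integrable_on_def)
            show "(\<lambda>t. e * nf t) integrable_on {u..v}"
              by (rule integrable_on_mult_right[OF has_integral_integrable[OF int(2)[OF uv']]])
            fix t assume t: "t \<in> {u..v}"
            have "r t = f t * (G v - G t) + (F u - F t) * g t" by (simp add: r_def h_def algebra_simps)
            also have "norm \<dots> \<le> norm (f t) * norm (G v - G t) + norm (F u - F t) * norm (g t)"
              by (metis norm_mult norm_triangle_ineq)
            also have "\<dots> \<le> norm (f t) * e + e * norm (g t)"
              using close[OF t] e by (intro add_mono mult_mono) auto
            finally show "norm (r t) \<le> e * nf t" by (simp add: nf_def algebra_simps)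
          qed
          also have "\<dots> = e * (H v - H u)" unfolding Hd[OF uv'] by simp
          finally show "norm (D v - D u) \<le> e * (H v - H u)" .
        qed
      qed
    qed
    then show ?thesis by (simp add: P_def)
  qed
  have "norm (D y - D a) \<le> 0"
  proof (rule field_le_epsilon)
    fix e :: real assume "e > 0"
    have ay: "a \<le> a" "a \<le> y" "y \<le> b" using y by auto
    have "0 \<le> integral {a..y} nf"
      by (rule has_integral_nonneg[OF int(2)[OF ay]]) (simp add: nf_def)
    then have "H y - H a \<ge> 0" unfolding Hd[OF ay] .
    then have "norm (D y - D a) \<le> e / (H y - H a + 1) * (H y - H a)" using key[of "e / (H y - H a + 1)"] \<open>e > 0\<close> by simp
    also have "\<dots> \<le> e" using \<open>H y - H a \<ge> 0\<close> \<open>e > 0\<close> by (simp add: field_simps)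
    finally show "norm (D y - D a) \<le> 0 + e" by simp
  qed
  then have "integral {a..y} h = F y * G y - F a * G a"
    using D[of a y] y by (simp add: algebra_simps)
  moreover have "h = (\<lambda>t. f t * G t + F t * g t)" by (rule ext) (rule h_def)
  ultimately show "((\<lambda>t. f t * G t + F t * g t) has_integral (F y * G y - F a * G a)) {a..y}"
    using int(1)[of a y] y by simp
qed

section \<open>Picard iteration for the system u' = v, v' = k u\<close>

text \<open>A common bound for the two coefficients 1 and \<open>k\<close> of the system; its
  integral \<open>vol_int\<close> takes the place of the length of the interval in the factorial
  estimates.\<close>

definition vol_wt :: "(real \<Rightarrow> complex) \<Rightarrow> real \<Rightarrow> real" where
  "vol_wt k t = 1 + cmod (k t)"

definition vol_int :: "(real \<Rightarrow> complex) \<Rightarrow> real \<Rightarrow> real" where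
  "vol_int k x = integral {0..x} (vol_wt k)"

lemma vol_int_primitive:
  assumes "k absolutely_integrable_on {0..b}"
  shows "primitive_on 0 b (vol_wt k) (vol_int k)"
proof -
  have ai: "vol_wt k absolutely_integrable_on {0..b}"
    unfolding vol_wt_def
    by (rule set_integral_add(1)[OF _ absolutely_integrable_norm[OF assms, unfolded o_def]])
       (rule absolutely_integrable_continuous_real, rule continuous_on_const)
  show ?thesis
    unfolding primitive_on_def
  proof (intro conjI ballI ai)
    fix x assume "x \<in> {0..b}"
    then have "vol_wt k integrable_on {0..x}"
      using absolutely_integrable_on_subinterval[OF ai, of 0 x] by (auto simp: absolutely_integrable_on_def)
    then show "(vol_wt k has_integral (vol_int k x - vol_int k 0)) {0..x}"
      by (simp add: vol_int_def integrable_integral)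
  qed
qed

lemma vol_int_nonneg: "0 \<le> vol_int k x"
  unfolding vol_int_def by (cases "vol_wt k integrable_on {0..x}") (auto intro!: integral_nonneg simp: vol_wt_def not_integrable_integral)

lemma vol_int_0 [simp]: "vol_int k 0 = 0"
  by (simp add: vol_int_def)

lemma vol_int_mono:
  assumes "k absolutely_integrable_on {0..b}" "0 \<le> x" "x \<le> y" "y \<le> b"
  shows "vol_int k x \<le> vol_int k y"
proof -
  have "(vol_wt k has_integral (vol_int k y - vol_int k x)) {x..y}"
    by (rule primitive_on_integral[OF vol_int_primitive[OF assms(1)] assms(2-4)])
  then have "0 \<le> vol_int k y - vol_int k x"
    by (rule has_integral_nonneg) (simp add: vol_wt_def)
  then show ?thesis by simp
qed

lemma vol_int_power:
  assumes "k absolutely_integrable_on {0..b}"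
  shows "primitive_on 0 b (\<lambda>t. of_nat (Suc n) * (vol_int k t ^ n * vol_wt k t)) (\<lambda>x. vol_int k x ^ Suc n)"
proof (induction n)
  case 0
  then show ?case using vol_int_primitive[OF assms] by simp
next
  case (Suc n)
  show ?case
    by (rule primitive_on_cong[OF primitive_on_mult[OF vol_int_primitive[OF assms] Suc]])
       (simp_all add: algebra_simps)
qed

text \<open>One Picard step: by \<open>vol_int_power\<close>, the weight times the
  \<open>n\<close>-th power of its own integral integrates to the next power, with the next
  factorial.\<close>

lemma vol_step:
  fixes f :: "real \<Rightarrow> complex"
  assumes k: "k absolutely_integrable_on {0..x}" and "0 \<le> x"
    and f: "(f has_integral y) {0..x}"
    and le: "\<And>t. t \<in> {0..x} \<Longrightarrow> cmod (f t) \<le> vol_wt k t * (C * vol_int k t ^ n / fact n)"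
  shows "cmod y \<le> C * vol_int k x ^ Suc n / fact (Suc n)"
proof -
  have "((\<lambda>t. of_nat (Suc n) * (vol_int k t ^ n * vol_wt k t)) has_integral (vol_int k x ^ Suc n - vol_int k 0 ^ Suc n)) {0..x}"
    by (rule primitive_on_integral[OF vol_int_power[OF k]]) (use \<open>0 \<le> x\<close> in auto)
  from has_integral_mult_right[OF this, of "C / fact (Suc n)"]
  have g: "((\<lambda>t. vol_wt k t * (C * vol_int k t ^ n / fact n)) has_integral (C * vol_int k x ^ Suc n / fact (Suc n))) {0..x}"
    by (rule has_integral_eq_rhs[OF has_integral_eq[rotated]]) (simp_all add: fact_Suc del: of_nat_Suc)
  have "cmod (integral {0..x} f) \<le> integral {0..x} (\<lambda>t. vol_wt k t * (C * vol_int k t ^ n / fact n))"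
    by (rule integral_norm_bound_integral[OF has_integral_integrable[OF f] has_integral_integrable[OF g] le])
  then show ?thesis unfolding integral_unique[OF f] integral_unique[OF g] .
qed

text \<open>These are the terms of the Picard series, not its partial sums; the solution is their
  sum over \<open>n\<close>.\<close>

primrec volterra :: "(real \<Rightarrow> complex) \<Rightarrow> complex \<Rightarrow> complex \<Rightarrow> nat \<Rightarrow> (real \<Rightarrow> complex) \<times> (real \<Rightarrow> complex)" where
  "volterra k c d 0 = (\<lambda>_. c, \<lambda>_. d)"
| "volterra k c d (Suc n) = (\<lambda>x. integral {0..x} (snd (volterra k c d n)),
      \<lambda>x. integral {0..x} (\<lambda>t. k t * fst (volterra k c d n) t))"

lemma volterra_primitive:
  assumes k: "\<And>b. k absolutely_integrable_on {0..b}"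
  shows "primitive_on 0 b (snd (volterra k c d n)) (fst (volterra k c d (Suc n)))"
    and "primitive_on 0 b (\<lambda>t. k t * fst (volterra k c d n) t) (snd (volterra k c d (Suc n)))"
    and "continuous_on {0..b} (fst (volterra k c d n))" "continuous_on {0..b} (snd (volterra k c d n))"
proof -
  have prim: "primitive_on 0 b f (\<lambda>x. integral {0..x} f)" if "f absolutely_integrable_on {0..b}" for f :: "real \<Rightarrow> complex"
    unfolding primitive_on_def
  proof (intro conjI ballI that)
    fix x assume "x \<in> {0..b}"
    then have "f integrable_on {0..x}"
      using absolutely_integrable_on_subinterval[OF that, of 0 x] by (auto simp: absolutely_integrable_on_def)
    then show "(f has_integral (integral {0..x} f - integral {0..0} f)) {0..x}" by (simp add: integrable_integral)
  qed
  have step: "primitive_on 0 b (snd (volterra k c d n)) (fst (volterra k c d (Suc n))) \<and>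
     primitive_on 0 b (\<lambda>t. k t * fst (volterra k c d n) t) (snd (volterra k c d (Suc n)))"
    if "continuous_on {0..b} (fst (volterra k c d n)) \<and> continuous_on {0..b} (snd (volterra k c d n))" for n
    using that prim[OF absolutely_integrable_continuous_real]
      prim[OF absolutely_integrable_continuous_mult(2)[OF _ k[of b]]] by simp
  have cont: "continuous_on {0..b} (fst (volterra k c d n)) \<and> continuous_on {0..b} (snd (volterra k c d n))" for n
  proof (induction n)
    case (Suc n)
    then show ?case using step[OF Suc] by (blast intro: primitive_on_continuous)
  qed simp
  show "primitive_on 0 b (snd (volterra k c d n)) (fst (volterra k c d (Suc n)))"
    "primitive_on 0 b (\<lambda>t. k t * fst (volterra k c d n) t) (snd (volterra k c d (Suc n)))"
    "continuous_on {0..b} (fst (volterra k c d n))" "continuous_on {0..b} (snd (volterra k c d n))"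
    using step[OF cont] cont by auto
qed

lemma volterra_bound:
  assumes k: "\<And>b. k absolutely_integrable_on {0..b}" and "0 \<le> x"
  shows "cmod (fst (volterra k c d n) x) \<le> (cmod c + cmod d) * vol_int k x ^ n / fact n \<and>
         cmod (snd (volterra k c d n) x) \<le> (cmod c + cmod d) * vol_int k x ^ n / fact n"
  using \<open>0 \<le> x\<close>
proof (induction n arbitrary: x)
  case (Suc n)
  define C where "C = cmod c + cmod d"
  have pos: "0 \<le> C * vol_int k t ^ n / fact n" for t
    by (simp add: C_def vol_int_nonneg)
  have 1: "(snd (volterra k c d n) has_integral (fst (volterra k c d (Suc n)) x - fst (volterra k c d (Suc n)) 0)) {0..x}"
    by (rule primitive_on_integral[OF volterra_primitive(1)[OF k]]) (use Suc.prems in auto)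
  have 2: "((\<lambda>t. k t * fst (volterra k c d n) t) has_integral (snd (volterra k c d (Suc n)) x - snd (volterra k c d (Suc n)) 0)) {0..x}"
    by (rule primitive_on_integral[OF volterra_primitive(2)[OF k]]) (use Suc.prems in auto)
  have "cmod (fst (volterra k c d (Suc n)) x - fst (volterra k c d (Suc n)) 0) \<le> C * vol_int k x ^ Suc n / fact (Suc n)"
  proof (rule vol_step[OF k Suc.prems 1])
    fix t assume "t \<in> {0..x}"
    then have "cmod (snd (volterra k c d n) t) \<le> 1 * (C * vol_int k t ^ n / fact n)" using Suc.IH[of t] by (simp add: C_def)
    also have "\<dots> \<le> vol_wt k t * (C * vol_int k t ^ n / fact n)"
      by (rule mult_right_mono[OF _ pos]) (simp add: vol_wt_def)
    finally show "cmod (snd (volterra k c d n) t) \<le> vol_wt k t * (C * vol_int k t ^ n / fact n)" .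
  qed
  moreover have "cmod (snd (volterra k c d (Suc n)) x - snd (volterra k c d (Suc n)) 0) \<le> C * vol_int k x ^ Suc n / fact (Suc n)"
  proof (rule vol_step[OF k Suc.prems 2])
    fix t assume "t \<in> {0..x}"
    then have "cmod (k t * fst (volterra k c d n) t) \<le> cmod (k t) * (C * vol_int k t ^ n / fact n)"
      using Suc.IH[of t] unfolding norm_mult by (intro mult_left_mono) (simp_all add: C_def)
    also have "\<dots> \<le> vol_wt k t * (C * vol_int k t ^ n / fact n)"
      by (rule mult_right_mono[OF _ pos]) (simp add: vol_wt_def)
    finally show "cmod (k t * fst (volterra k c d n) t) \<le> vol_wt k t * (C * vol_int k t ^ n / fact n)" .
  qed
  ultimately show ?case by (simp add: C_def)
qed simp

lemma absolutely_integrable_on_absint: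
  fixes k :: "real \<Rightarrow> complex"
  assumes "k absolutely_integrable_on {0..b}" "0 \<le> x" "x \<le> b"
  shows "k absolutely_integrable_on {0..x}"
  by (rule absolutely_integrable_on_subinterval[OF assms(1)]) (use assms in auto)

text \<open>The factorial bounds make the series converge with partial sums bounded on compact
  intervals. As \<open>k\<close> is only integrable, the integral equations pass to the limit by
  dominated convergence.\<close>

lemma volterra_exists:
  fixes k :: "real \<Rightarrow> complex" and c d :: complex
  assumes k: "\<And>b. k absolutely_integrable_on {0..b}"
  obtains u v where "u 0 = c" "v 0 = d" "\<And>b. primitive_on 0 b v u" "\<And>b. primitive_on 0 b (\<lambda>t. k t * u t) v"
proof -
  define C where "C = cmod c + cmod d"
  define A B where "A n = fst (volterra k c d n)" and "B n = snd (volterra k c d n)" for n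
  define u v where "u x = (\<Sum>n. A n x)" and "v x = (\<Sum>n. B n x)" for x
  have bd: "cmod (A n x) \<le> C * vol_int k b ^ n / fact n" "cmod (B n x) \<le> C * vol_int k b ^ n / fact n"
    if "0 \<le> x" "x \<le> b" for n x b
  proof -
    have "vol_int k x ^ n \<le> vol_int k b ^ n"
      by (rule power_mono[OF vol_int_mono[OF k that order_refl] vol_int_nonneg])
    then have le: "C * vol_int k x ^ n / fact n \<le> C * vol_int k b ^ n / fact n"
      by (intro divide_right_mono mult_left_mono) (simp_all add: C_def)
    show "cmod (A n x) \<le> C * vol_int k b ^ n / fact n" "cmod (B n x) \<le> C * vol_int k b ^ n / fact n"
      using volterra_bound[OF k that(1), of c d n] le unfolding A_def B_def C_def by linarith+
  qed
  have se: "(\<lambda>n. C * vol_int k b ^ n / fact n) sums (C * exp (vol_int k b))" for b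
    using sums_mult[OF exp_converges[of "vol_int k b"], of C] by (simp add: divide_inverse ac_simps)
  have sA: "summable (\<lambda>n. A n x)" and sB: "summable (\<lambda>n. B n x)" if "0 \<le> x" for x
    by (rule summable_comparison_test'[OF sums_summable[OF se[of x]], of 0], rule bd[OF that order_refl])+
  have psum: "cmod (\<Sum>n<N. f n) \<le> C * exp (vol_int k b)"
    if "\<And>n. cmod (f n) \<le> C * vol_int k b ^ n / fact n" for f :: "nat \<Rightarrow> complex" and N b
  proof -
    have "cmod (\<Sum>n<N. f n) \<le> (\<Sum>n<N. C * vol_int k b ^ n / fact n)" by (rule sum_norm_le) (rule that)
    also have "\<dots> \<le> (\<Sum>n. C * vol_int k b ^ n / fact n)"
      by (rule sum_le_suminf[OF sums_summable[OF se]]) (auto simp: C_def vol_int_nonneg)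
    finally show ?thesis using sums_unique[OF se[of b]] by simp
  qed
  have A0: "A (Suc n) 0 = 0" and B0: "B (Suc n) 0 = 0" for n by (simp_all add: A_def B_def)
  have Aint: "(B n has_integral A (Suc n) x) {0..x}" and Bint: "((\<lambda>t. k t * A n t) has_integral B (Suc n) x) {0..x}"
    if "0 \<le> x" for n x
  proof -
    have "(B n has_integral A (Suc n) x - A (Suc n) 0) {0..x}"
      unfolding A_def B_def by (rule primitive_on_integral[OF volterra_primitive(1)[OF k] order_refl that order_refl])
    then show "(B n has_integral A (Suc n) x) {0..x}" unfolding A0 by simp
    have "((\<lambda>t. k t * A n t) has_integral B (Suc n) x - B (Suc n) 0) {0..x}"
      unfolding A_def B_def by (rule primitive_on_integral[OF volterra_primitive(2)[OF k] order_refl that order_refl])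
    then show "((\<lambda>t. k t * A n t) has_integral B (Suc n) x) {0..x}" unfolding B0 by simp
  qed
  have uv_eq: "u x - c = (\<Sum>n. A (Suc n) x)" "v x - d = (\<Sum>n. B (Suc n) x)" if "0 \<le> x" for x
    using suminf_split_head[OF sA[OF that]] suminf_split_head[OF sB[OF that]]
    unfolding u_def v_def by (simp_all add: A_def B_def)
  have U: "(v has_integral (u x - c)) {0..x}" if x: "0 \<le> x" for x
  proof (rule has_integral_dominated_convergence)
    show "((\<lambda>t. \<Sum>n<N. B n t) has_integral (\<Sum>n<N. A (Suc n) x)) {0..x}" for N
      by (rule has_integral_sum) (auto intro: Aint[OF x])
    show "(\<lambda>t::real. C * exp (vol_int k x)) integrable_on {0..x}" by (rule integrable_const_ivl)
    show "\<forall>t\<in>{0..x}. cmod (\<Sum>n<N. B n t) \<le> C * exp (vol_int k x)" for N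
      by (intro ballI psum bd(2)) auto
    show "\<forall>t\<in>{0..x}. (\<lambda>N. \<Sum>n<N. B n t) \<longlonglongrightarrow> v t"
      unfolding v_def by (intro ballI summable_LIMSEQ sB) auto
    show "(\<lambda>N. \<Sum>n<N. A (Suc n) x) \<longlonglongrightarrow> u x - c"
      unfolding uv_eq(1)[OF x] by (rule summable_LIMSEQ[OF summable_Suc_iff[of "\<lambda>n. A n x", THEN iffD2, OF sA[OF x]]])
  qed
  have V: "((\<lambda>t. k t * u t) has_integral (v x - d)) {0..x}" if x: "0 \<le> x" for x
  proof (rule has_integral_dominated_convergence)
    show "((\<lambda>t. \<Sum>n<N. k t * A n t) has_integral (\<Sum>n<N. B (Suc n) x)) {0..x}" for N
      by (rule has_integral_sum) (auto intro: Bint[OF x])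
    have "(\<lambda>t. cmod (k t)) integrable_on {0..x}" using k[of x] by (simp add: absolutely_integrable_on_def)
    then show "(\<lambda>t. cmod (k t) * (C * exp (vol_int k x))) integrable_on {0..x}" by (rule integrable_on_mult_left)
    show "\<forall>t\<in>{0..x}. cmod (\<Sum>n<N. k t * A n t) \<le> cmod (k t) * (C * exp (vol_int k x))" for N
      unfolding sum_distrib_left[symmetric] norm_mult
      by (intro ballI mult_left_mono psum bd(1) norm_ge_zero) auto
    show "\<forall>t\<in>{0..x}. (\<lambda>N. \<Sum>n<N. k t * A n t) \<longlonglongrightarrow> k t * u t"
      unfolding u_def sum_distrib_left[symmetric] by (intro ballI tendsto_mult_left summable_LIMSEQ sA) auto
    show "(\<lambda>N. \<Sum>n<N. B (Suc n) x) \<longlonglongrightarrow> v x - d"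
      unfolding uv_eq(2)[OF x] by (rule summable_LIMSEQ[OF summable_Suc_iff[of "\<lambda>n. B n x", THEN iffD2, OF sB[OF x]]])
  qed
  have u0: "u 0 = c" and v0: "v 0 = d"
    using integral_unique[OF U[OF order_refl]] integral_unique[OF V[OF order_refl]] by simp_all
  have cont: "continuous_on {0..b} (\<lambda>x. e + integral {0..x} f)" if "\<And>x. 0 \<le> x \<Longrightarrow> (f has_integral g x) {0..x}" for f g :: "real \<Rightarrow> complex" and b e
  proof (cases "0 \<le> b")
    case True
    show ?thesis
      by (rule continuous_on_add[OF continuous_on_const indefinite_integral_continuous_1[OF has_integral_integrable[OF that[OF True]]]])
  qed simp
  have cu: "continuous_on {0..b} u" for b
    by (rule continuous_on_eq[OF cont[of v _ b c, OF U]]) (use integral_unique[OF U] in auto)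
  have cv: "continuous_on {0..b} v" for b
    by (rule continuous_on_eq[OF cont[of _ _ b d, OF V]]) (use integral_unique[OF V] in auto)
  show ?thesis
  proof
    show "u 0 = c" "v 0 = d" by fact+
    show "primitive_on 0 b v u" for b
      unfolding primitive_on_def u0 using U absolutely_integrable_continuous_real[OF cv[of b]] by simp
    show "primitive_on 0 b (\<lambda>t. k t * u t) v" for b
      unfolding primitive_on_def v0 using V absolutely_integrable_continuous_mult(2)[OF cu[of b] k[of b]] by simp
  qed
qed

text \<open>A solution with zero data is bounded and obeys the \<open>n\<close>-th Picard bound for
  every \<open>n\<close>; these bounds tend to 0.\<close>

lemma volterra_unique:
  fixes k u v :: "real \<Rightarrow> complex"
  assumes k: "k absolutely_integrable_on {0..b}"
    and u: "primitive_on 0 b v u" and v: "primitive_on 0 b (\<lambda>t. k t * u t) v"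
    and 0: "u 0 = 0" "v 0 = 0" and x: "x \<in> {0..b}"
  shows "u x = 0" "v x = 0"
proof -
  have "compact (u ` {0..b} \<union> v ` {0..b})"
    by (rule compact_Un[OF compact_continuous_image[OF primitive_on_continuous[OF u] compact_Icc]
          compact_continuous_image[OF primitive_on_continuous[OF v] compact_Icc]])
  then obtain M where M0: "\<And>y. y \<in> u ` {0..b} \<union> v ` {0..b} \<Longrightarrow> cmod y \<le> M"
    using compact_imp_bounded bounded_iff by meson
  have M: "cmod (u t) \<le> M" "cmod (v t) \<le> M" if "t \<in> {0..b}" for t
    using that by (auto intro!: M0)
  have "M \<ge> 0" using M(1)[OF x] norm_ge_zero order_trans by blast
  have bd: "cmod (u t) \<le> M * vol_int k t ^ n / fact n \<and> cmod (v t) \<le> M * vol_int k t ^ n / fact n" if "t \<in> {0..b}" for n t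
    using that
  proof (induction n arbitrary: t)
    case 0
    then show ?case using M by simp
  next
    case (Suc n)
    have t: "0 \<le> t" "t \<le> b" using Suc.prems by auto
    have kt: "k absolutely_integrable_on {0..t}" by (rule absolutely_integrable_on_absint[OF k t])
    have pos: "0 \<le> M * vol_int k s ^ n / fact n" for s
      using \<open>M \<ge> 0\<close> by (simp add: vol_int_nonneg)
    have iu: "(v has_integral u t) {0..t}" using primitive_on_integral[OF u order_refl t] 0 by simp
    have iv: "((\<lambda>t. k t * u t) has_integral v t) {0..t}" using primitive_on_integral[OF v order_refl t] 0 by simp
    have "cmod (u t) \<le> M * vol_int k t ^ Suc n / fact (Suc n)"
    proof (rule vol_step[OF kt t(1) iu])
      fix s assume "s \<in> {0..t}"
      then have "cmod (v s) \<le> 1 * (M * vol_int k s ^ n / fact n)" using Suc.IH[of s] t by simp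
      also have "\<dots> \<le> vol_wt k s * (M * vol_int k s ^ n / fact n)"
        by (rule mult_right_mono[OF _ pos]) (simp add: vol_wt_def)
      finally show "cmod (v s) \<le> vol_wt k s * (M * vol_int k s ^ n / fact n)" .
    qed
    moreover have "cmod (v t) \<le> M * vol_int k t ^ Suc n / fact (Suc n)"
    proof (rule vol_step[OF kt t(1) iv])
      fix s assume "s \<in> {0..t}"
      then have "cmod (u s) \<le> M * vol_int k s ^ n / fact n" using Suc.IH[of s] t by simp
      then have "cmod (k s * u s) \<le> cmod (k s) * (M * vol_int k s ^ n / fact n)"
        unfolding norm_mult by (rule mult_left_mono[OF _ norm_ge_zero])
      also have "\<dots> \<le> vol_wt k s * (M * vol_int k s ^ n / fact n)"
        by (rule mult_right_mono[OF _ pos]) (simp add: vol_wt_def)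
      finally show "cmod (k s * u s) \<le> vol_wt k s * (M * vol_int k s ^ n / fact n)" .
    qed
    ultimately show ?case ..
  qed
  have "(\<lambda>n. M * (inverse (fact n) * vol_int k x ^ n)) \<longlonglongrightarrow> 0"
    by (rule tendsto_mult_right_zero[OF summable_LIMSEQ_zero[OF summable_exp]])
  then have lim: "(\<lambda>n. M * vol_int k x ^ n / fact n) \<longlonglongrightarrow> 0" by (simp add: divide_inverse ac_simps)
  have "cmod (u x) \<le> 0" "cmod (v x) \<le> 0"
    using LIMSEQ_le_const[OF lim, of "cmod (u x)"] LIMSEQ_le_const[OF lim, of "cmod (v x)"] bd[OF x] by blast+
  then show "u x = 0" "v x = 0" by simp_all
qed

section \<open>Half line solutions, Green's identity and mass\<close>

definition sol :: "(real \<Rightarrow> real) \<Rightarrow> complex \<Rightarrow> (real \<Rightarrow> complex) \<Rightarrow> (real \<Rightarrow> complex) \<Rightarrow> bool" where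
  "sol q z u v \<longleftrightarrow> (\<forall>b. primitive_on 0 b v u \<and> primitive_on 0 b (\<lambda>t. (of_real (q t) - z) * u t) v)"

lemma solD: "sol q z u v \<Longrightarrow> primitive_on 0 b v u" "sol q z u v \<Longrightarrow> primitive_on 0 b (\<lambda>t. (of_real (q t) - z) * u t) v"
  by (simp_all add: sol_def)

lemma sol_continuous: "sol q z u v \<Longrightarrow> continuous_on {0..b} u" "sol q z u v \<Longrightarrow> continuous_on {0..b} v"
  by (blast intro: primitive_on_continuous solD)+

lemma potential_absint:
  assumes "locally_integrable {0..} q"
  shows "(\<lambda>t. of_real (q t) - z :: complex) absolutely_integrable_on {0..b}"
proof -
  have "q absolutely_integrable_on {0..b}"
    using assms by (auto simp: locally_integrable_def)
  then have "(\<lambda>t. complex_of_real (q t)) absolutely_integrable_on {0..b}"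
    using absolutely_integrable_linear[OF _ bounded_linear_of_real] by (simp add: o_def)
  then show ?thesis
    by (rule set_integral_diff(1)[OF _ absolutely_integrable_continuous_real[OF continuous_on_const]])
qed

lemma sol_exists:
  assumes "locally_integrable {0..} q"
  obtains u v where "sol q z u v" "u 0 = c" "v 0 = d"
  using volterra_exists[OF potential_absint[OF assms, where z = z], of c d] unfolding sol_def by metis

lemma sol_zero:
  assumes "locally_integrable {0..} q" "sol q z u v" "u 0 = 0" "v 0 = 0" "x \<ge> 0"
  shows "u x = 0" "v x = 0"
  using volterra_unique[OF potential_absint[OF assms(1), where z = z] solD(1)[OF assms(2)] solD(2)[OF assms(2)] assms(3,4), of x x] assms(5)
  by auto

lemma primitive_on_lincomb:
  fixes f g :: "real \<Rightarrow> complex"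
  assumes "primitive_on a b f F" "primitive_on a b g G"
  shows "primitive_on a b (\<lambda>t. c * f t + d * g t) (\<lambda>x. c * F x + d * G x)"
  unfolding primitive_on_def
proof (intro conjI ballI)
  have ai: "f absolutely_integrable_on {a..b}" "g absolutely_integrable_on {a..b}"
    using assms by (simp_all add: primitive_on_def)
  show "(\<lambda>t. c * f t + d * g t) absolutely_integrable_on {a..b}"
    by (rule set_integral_add(1)[OF absolutely_integrable_continuous_mult(1)[OF continuous_on_const ai(1)]
          absolutely_integrable_continuous_mult(1)[OF continuous_on_const ai(2)]])
  fix x assume "x \<in> {a..b}"
  then have h: "(f has_integral (F x - F a)) {a..x}" "(g has_integral (G x - G a)) {a..x}"
    using assms by (simp_all add: primitive_on_def)
  have "((\<lambda>t. c * f t + d * g t) has_integral (c * (F x - F a) + d * (G x - G a))) {a..x}"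
    by (rule has_integral_add[OF has_integral_mult_right[OF h(1)] has_integral_mult_right[OF h(2)]])
  then show "((\<lambda>t. c * f t + d * g t) has_integral (c * F x + d * G x - (c * F a + d * G a))) {a..x}"
    by (simp add: algebra_simps)
qed

lemma primitive_on_cnj:
  assumes "primitive_on a b f F"
  shows "primitive_on a b (\<lambda>t. cnj (f t)) (\<lambda>x. cnj (F x))"
  unfolding primitive_on_def
proof (intro conjI ballI)
  have "f absolutely_integrable_on {a..b}" using assms by (simp add: primitive_on_def)
  from absolutely_integrable_linear[OF this bounded_linear_cnj]
  show "(\<lambda>t. cnj (f t)) absolutely_integrable_on {a..b}" by (simp add: o_def)
  fix x assume "x \<in> {a..b}"
  then have "(f has_integral (F x - F a)) {a..x}" using assms by (simp add: primitive_on_def)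
  from has_integral_linear[OF this bounded_linear_cnj]
  show "((\<lambda>t. cnj (f t)) has_integral (cnj (F x) - cnj (F a))) {a..x}" by (simp add: o_def)
qed

lemma sol_lincomb:
  assumes "sol q z u v" "sol q z f g"
  shows "sol q z (\<lambda>x. c * u x + d * f x) (\<lambda>x. c * v x + d * g x)"
  unfolding sol_def
proof (intro allI conjI)
  fix b
  show "primitive_on 0 b (\<lambda>x. c * v x + d * g x) (\<lambda>x. c * u x + d * f x)"
    by (rule primitive_on_lincomb[OF solD(1)[OF assms(1)] solD(1)[OF assms(2)]])
  show "primitive_on 0 b (\<lambda>t. (of_real (q t) - z) * (c * u t + d * f t)) (\<lambda>x. c * v x + d * g x)"
    by (rule primitive_on_cong[OF primitive_on_lincomb[OF solD(2)[OF assms(1)] solD(2)[OF assms(2)], of b c d]])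
       (simp_all add: algebra_simps)
qed

lemma sol_cnj:
  assumes "sol q z u v"
  shows "sol q (cnj z) (\<lambda>x. cnj (u x)) (\<lambda>x. cnj (v x))"
  unfolding sol_def
proof (intro allI conjI)
  fix b
  show "primitive_on 0 b (\<lambda>x. cnj (v x)) (\<lambda>x. cnj (u x))"
    by (rule primitive_on_cnj[OF solD(1)[OF assms]])
  show "primitive_on 0 b (\<lambda>t. (of_real (q t) - cnj z) * cnj (u t)) (\<lambda>x. cnj (v x))"
    by (rule primitive_on_cong[OF primitive_on_cnj[OF solD(2)[OF assms], of b]]) simp_all
qed

lemma sol_unique:
  assumes q: "locally_integrable {0..} q" and "sol q z u v" "sol q z f g" "u 0 = f 0" "v 0 = g 0" "x \<ge> 0"
  shows "u x = f x" "v x = g x"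
proof -
  have "sol q z (\<lambda>x. 1 * u x + (-1) * f x) (\<lambda>x. 1 * v x + (-1) * g x)" by (rule sol_lincomb[OF assms(2,3)])
  from sol_zero[OF q this, of x] assms(4-) show "u x = f x" "v x = g x" by simp_all
qed

text \<open>Green's identity for two spectral parameters, by the product rule. The parameters
  \<open>cnj z\<close> and \<open>z\<close> give the mass identity \<open>sol_flux\<close>, equal
  parameters the constancy of the Wronskian.\<close>

lemma sol_wronskian:
  assumes "sol q z u v" "sol q w f g" "0 \<le> b"
  shows "((\<lambda>t. (w - z) * (u t * f t)) has_integral ((v b * f b - u b * g b) - (v 0 * f 0 - u 0 * g 0))) {0..b}"
proof -
  have 1: "primitive_on 0 b (\<lambda>t. ((of_real (q t) - z) * u t) * f t + v t * g t) (\<lambda>x. v x * f x)"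
    by (rule primitive_on_mult[OF solD(2)[OF assms(1)] solD(1)[OF assms(2)]])
  have 2: "primitive_on 0 b (\<lambda>t. v t * g t + u t * ((of_real (q t) - w) * f t)) (\<lambda>x. u x * g x)"
    by (rule primitive_on_mult[OF solD(1)[OF assms(1)] solD(2)[OF assms(2)]])
  have "primitive_on 0 b (\<lambda>t. (w - z) * (u t * f t)) (\<lambda>x. v x * f x - u x * g x)"
    by (rule primitive_on_cong[OF primitive_on_lincomb[OF 1 2, of 1 "-1"]]) (simp_all add: algebra_simps)
  from primitive_on_integral[OF this order_refl assms(3) order_refl] show ?thesis .
qed

lemma sol_wronskian_const:
  assumes "sol q z u v" "sol q z f g" "0 \<le> b"
  shows "v b * f b - u b * g b = v 0 * f 0 - u 0 * g 0"
proof -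
  have "((\<lambda>t. 0) has_integral ((v b * f b - u b * g b) - (v 0 * f 0 - u 0 * g 0))) {0..b}"
    using sol_wronskian[OF assms] by simp
  then have "(v b * f b - u b * g b) - (v 0 * f 0 - u 0 * g 0) = 0"
    by (rule has_integral_unique[OF _ has_integral_0])
  then show ?thesis by simp
qed

definition mass :: "(real \<Rightarrow> complex) \<Rightarrow> real \<Rightarrow> real" where
  "mass u b = integral {0..b} (\<lambda>t. (cmod (u t))\<^sup>2)"

lemma mass_has_integral:
  assumes "continuous_on {0..b} u"
  shows "((\<lambda>t. (cmod (u t))\<^sup>2) has_integral mass u b) {0..b}"
  unfolding mass_def
  by (rule integrable_integral[OF integrable_continuous_real]) (intro continuous_intros assms)

lemma mass_nonneg: "continuous_on {0..b} u \<Longrightarrow> 0 \<le> mass u b"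
  by (rule has_integral_nonneg[OF mass_has_integral]) simp_all

lemma mass_mono:
  assumes "continuous_on {0..c} u" "0 \<le> b" "b \<le> c"
  shows "mass u b \<le> mass u c"
  unfolding mass_def
proof (rule integral_subset_le)
  show "(\<lambda>t. (cmod (u t))\<^sup>2) integrable_on {0..c}"
    using mass_has_integral[OF assms(1)] by (rule has_integral_integrable)
  show "(\<lambda>t. (cmod (u t))\<^sup>2) integrable_on {0..b}"
    by (rule has_integral_integrable[OF mass_has_integral[OF continuous_on_subset[OF assms(1)]]]) (use assms in auto)
qed (use assms in auto)

lemma mass_pos:
  assumes "continuous_on {0..b} u" "x \<in> {0..b}" "u x \<noteq> 0" "0 < b"
  shows "0 < mass u b"
proof (rule ccontr)
  assume "\<not> 0 < mass u b"
  then have m0: "mass u b = 0" using mass_nonneg[OF assms(1)] by simp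
  have "(cmod (u x))\<^sup>2 = 0"
    by (rule has_integral_0_cbox_imp_0[of 0 b "\<lambda>t. (cmod (u t))\<^sup>2" x])
       (use assms mass_has_integral[OF assms(1)] m0 in \<open>auto intro!: continuous_intros\<close>)
  with assms(3) show False by simp
qed

lemma sol_flux:
  assumes "sol q z u v" "0 \<le> b"
  shows "Im (cnj (u b) * v b) = Im (cnj (u 0) * v 0) - Im z * mass u b"
proof -
  have "((\<lambda>t. (z - cnj z) * (cnj (u t) * u t)) has_integral
      ((cnj (v b) * u b - cnj (u b) * v b) - (cnj (v 0) * u 0 - cnj (u 0) * v 0))) {0..b}"
    by (rule sol_wronskian[OF sol_cnj[OF assms(1)] assms])
  then have "((\<lambda>t. Im ((z - cnj z) * (cnj (u t) * u t))) has_integral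
      Im ((cnj (v b) * u b - cnj (u b) * v b) - (cnj (v 0) * u 0 - cnj (u 0) * v 0))) {0..b}"
    by (rule has_integral_Im)
  moreover have "Im ((z - cnj z) * (cnj (u t) * u t)) = 2 * Im z * (cmod (u t))\<^sup>2" for t
    unfolding cmod_power2 by (simp add: power2_eq_square algebra_simps)
  ultimately have "((\<lambda>t. 2 * Im z * (cmod (u t))\<^sup>2) has_integral
      Im ((cnj (v b) * u b - cnj (u b) * v b) - (cnj (v 0) * u 0 - cnj (u 0) * v 0))) {0..b}" by (simp only:)
  moreover have "((\<lambda>t. 2 * Im z * (cmod (u t))\<^sup>2) has_integral (2 * Im z * mass u b)) {0..b}"
    by (rule has_integral_mult_right[OF mass_has_integral[OF sol_continuous(1)[OF assms(1)]]])
  ultimately have "Im ((cnj (v b) * u b - cnj (u b) * v b) - (cnj (v 0) * u 0 - cnj (u 0) * v 0)) = 2 * Im z * mass u b"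
    by (rule has_integral_unique)
  then show ?thesis by (simp add: algebra_simps)
qed

section \<open>Weyl's m function\<close>

lemma mass_add:
  assumes u: "continuous_on {0..b} u" and v: "continuous_on {0..b} v"
  shows "mass (\<lambda>x. u x + c * v x) b = mass u b + (cmod c)\<^sup>2 * mass v b + 2 * Re (c * integral {0..b} (\<lambda>t. cnj (u t) * v t))"
proof -
  have iv: "((\<lambda>t. cnj (u t) * v t) has_integral integral {0..b} (\<lambda>t. cnj (u t) * v t)) {0..b}"
    by (rule integrable_integral[OF integrable_continuous_real]) (intro continuous_intros u v)
  have "((\<lambda>t. Re (c * (cnj (u t) * v t))) has_integral Re (c * integral {0..b} (\<lambda>t. cnj (u t) * v t))) {0..b}"
    by (rule has_integral_Re[OF has_integral_mult_right[OF iv]])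
  note has_integral_add[OF has_integral_add[OF mass_has_integral[OF u] has_integral_mult_right[OF mass_has_integral[OF v], of "(cmod c)\<^sup>2"]]
      has_integral_mult_right[OF this, of 2]]
  moreover have "(cmod (u t))\<^sup>2 + (cmod c)\<^sup>2 * (cmod (v t))\<^sup>2 + 2 * Re (c * (cnj (u t) * v t)) = (cmod (u t + c * v t))\<^sup>2" for t
    unfolding cmod_power2 by (simp add: power2_eq_square algebra_simps)
  ultimately show ?thesis unfolding mass_def by (simp add: integral_unique)
qed

lemma mass_lincomb_le:
  assumes u: "continuous_on {0..b} u" and v: "continuous_on {0..b} v"
  shows "mass (\<lambda>x. c * u x + d * v x) b \<le> 2 * (cmod c)\<^sup>2 * mass u b + 2 * (cmod d)\<^sup>2 * mass v b"
proof -
  have "((\<lambda>t. 2 * (cmod c)\<^sup>2 * (cmod (u t))\<^sup>2 + 2 * (cmod d)\<^sup>2 * (cmod (v t))\<^sup>2) has_integral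
      (2 * (cmod c)\<^sup>2 * mass u b + 2 * (cmod d)\<^sup>2 * mass v b)) {0..b}"
    by (rule has_integral_add[OF has_integral_mult_right[OF mass_has_integral[OF u]] has_integral_mult_right[OF mass_has_integral[OF v]]])
  moreover have "continuous_on {0..b} (\<lambda>x. c * u x + d * v x)" by (intro continuous_intros u v)
  moreover have "(cmod (c * u t + d * v t))\<^sup>2 \<le> 2 * (cmod c)\<^sup>2 * (cmod (u t))\<^sup>2 + 2 * (cmod d)\<^sup>2 * (cmod (v t))\<^sup>2" for t
  proof -
    define p q where "p = cmod c * cmod (u t)" and "q = cmod d * cmod (v t)"
    have "cmod (c * u t + d * v t) \<le> p + q"
      unfolding p_def q_def by (metis norm_mult norm_triangle_ineq)
    then have "(cmod (c * u t + d * v t))\<^sup>2 \<le> (p + q)\<^sup>2" by (rule power_mono) simp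
    also have "(p + q)\<^sup>2 \<le> 2 * p\<^sup>2 + 2 * q\<^sup>2"
      using zero_le_power2[of "p - q"] by (simp add: power2_eq_square algebra_simps)
    finally show ?thesis by (simp add: p_def q_def power_mult_distrib)
  qed
  ultimately show ?thesis
    by (intro has_integral_le[OF mass_has_integral]) auto
qed

lemma sq_integrable_at_top_iff_mass_bounded:
  assumes u: "\<And>b. continuous_on {0..b} u"
  shows "sq_integrable_at_top u \<longleftrightarrow> (\<exists>C. \<forall>b\<ge>0. mass u b \<le> C)"
proof
  define g where "g = (\<lambda>t. (cmod (u t))\<^sup>2)"
  assume "sq_integrable_at_top u"
  then have "g integrable_on {0..}" by (simp add: sq_integrable_at_top_def absolutely_integrable_on_def g_def)
  then have "mass u b \<le> integral {0..} g" for b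
    unfolding mass_def g_def[symmetric]
    by (intro integral_subset_le) (auto simp: g_def intro!: has_integral_integrable[OF mass_has_integral[OF u]])
  then show "\<exists>C. \<forall>b\<ge>0. mass u b \<le> C" by blast
next
  define g where "g = (\<lambda>t. (cmod (u t))\<^sup>2)"
  assume "\<exists>C. \<forall>b\<ge>0. mass u b \<le> C"
  then obtain C where C: "\<And>b. b \<ge> 0 \<Longrightarrow> mass u b \<le> C" by blast
  define f where "f k t = (if t \<in> {0..real k} then g t else 0)" for k t
  have fi: "(f k has_integral mass u (real k)) {0..}" for k
    unfolding f_def
    by (rule has_integral_restrict[THEN iffD2]) (auto simp: g_def intro: mass_has_integral[OF u])
  have "g integrable_on {0..}"
  proof (rule conjunct1[OF monotone_convergence_increasing[of f]])
    show "f k integrable_on {0..}" for k using fi by (rule has_integral_integrable)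
    show "f k x \<le> f (Suc k) x" for k x by (auto simp: f_def g_def)
    show "(\<lambda>k. f k x) \<longlonglongrightarrow> g x" if "x \<in> {0..}" for x
    proof (rule tendsto_eventually, rule eventually_sequentiallyI[of "nat \<lceil>x\<rceil>"])
      fix k assume "nat \<lceil>x\<rceil> \<le> k"
      then have "x \<le> real k" by linarith
      then show "f k x = g x" using that by (simp add: f_def)
    qed
    have "integral {0..} (f k) = mass u (real k)" for k using fi by (rule integral_unique)
    then show "bounded (range (\<lambda>k. integral {0..} (f k)))"
      unfolding bounded_iff using C mass_nonneg[OF u] by (intro exI[of _ C]) auto
  qed
  then show "sq_integrable_at_top u"
    unfolding sq_integrable_at_top_def g_def by (intro nonnegative_absolutely_integrable_1) auto
qed

text \<open>The Gram matrix of the functions \<open>f\<^sub>z\<close> is the Pick kernel of \<open>m\<close>. Hence \<open>z \<mapsto> f\<^sub>z\<close> is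
  continuous in mean square, and the difference quotients of \<open>m\<close> converge.\<close>

lemma Herglotz_Pick_kernel:
  fixes f :: "complex \<Rightarrow> real \<Rightarrow> complex" and m :: "complex \<Rightarrow> complex"
  assumes cont: "\<And>z. Im z > 0 \<Longrightarrow> continuous_on {0..b} (f z)"
    and K1: "\<And>z w. Im z > 0 \<Longrightarrow> Im w > 0 \<Longrightarrow> m z - m w = (z - w) * integral {0..b} (\<lambda>t. f z t * f w t)"
    and K2: "\<And>z w. Im z > 0 \<Longrightarrow> Im w > 0 \<Longrightarrow> cnj (m z) - m w = (cnj z - w) * integral {0..b} (\<lambda>t. cnj (f z t) * f w t)"
    and pos: "\<And>z. Im z > 0 \<Longrightarrow> Im (m z) > 0"
  shows "Herglotz m"
proof (rule HerglotzI)
  have mass: "Im (m z) = Im z * mass (f z) b" if "Im z > 0" for z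
  proof -
    have "((\<lambda>t. complex_of_real ((cmod (f z t))\<^sup>2)) has_integral of_real (mass (f z) b)) {0..b}"
      by (rule has_integral_of_real[OF mass_has_integral[OF cont[OF that]]])
    then have "integral {0..b} (\<lambda>t. cnj (f z t) * f z t) = of_real (mass (f z) b)"
      unfolding complex_norm_square by (simp add: integral_unique mult.commute)
    then have "cnj (m z) - m z = (cnj z - z) * of_real (mass (f z) b)" using K2[OF that that] by simp
    then show ?thesis by (simp add: complex_eq_iff)
  qed
  \<comment> \<open>The weight \<open>e\<close> is free: 1 serves for the a priori bound, a small
    value for the difference quotients.\<close>
  have young: "cmod (integral {0..b} (\<lambda>t. g t * h t)) \<le> (e * mass g b + mass h b / e) / 2"
    if g: "continuous_on {0..b} g" and h: "continuous_on {0..b} h" and e: "e > 0" for g h e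
  proof -
    have i: "((\<lambda>t. (e * (cmod (g t))\<^sup>2 + (cmod (h t))\<^sup>2 / e) / 2) has_integral (e * mass g b + mass h b / e) / 2) {0..b}"
      by (intro has_integral_divide has_integral_add has_integral_mult_right mass_has_integral g h)
    have "cmod (integral {0..b} (\<lambda>t. g t * h t)) \<le> integral {0..b} (\<lambda>t. (e * (cmod (g t))\<^sup>2 + (cmod (h t))\<^sup>2 / e) / 2)"
    proof (rule integral_norm_bound_integral)
      show "(\<lambda>t. g t * h t) integrable_on {0..b}" by (rule integrable_continuous_real) (intro continuous_intros g h)
      show "(\<lambda>t. (e * (cmod (g t))\<^sup>2 + (cmod (h t))\<^sup>2 / e) / 2) integrable_on {0..b}" using i by (rule has_integral_integrable)
      fix t
      have "0 \<le> (e * cmod (g t) - cmod (h t))\<^sup>2" by simp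
      then have "2 * e * (cmod (g t) * cmod (h t)) \<le> e * (e * (cmod (g t))\<^sup>2) + (cmod (h t))\<^sup>2"
        by (simp add: power2_eq_square algebra_simps)
      then have "2 * (cmod (g t) * cmod (h t)) \<le> (e * (e * (cmod (g t))\<^sup>2) + (cmod (h t))\<^sup>2) / e"
        using e by (simp add: pos_le_divide_eq mult.commute mult.left_commute)
      also have "\<dots> = e * (cmod (g t))\<^sup>2 + (cmod (h t))\<^sup>2 / e" using e by (simp add: add_divide_distrib)
      finally show "cmod (g t * h t) \<le> (e * (cmod (g t))\<^sup>2 + (cmod (h t))\<^sup>2 / e) / 2" by (simp add: norm_mult)
    qed
    then show ?thesis unfolding integral_unique[OF i] .
  qed
  show "Im (m z) > 0" if "Im z > 0" for z by (rule pos[OF that])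
  have "(m has_field_derivative integral {0..b} (\<lambda>t. f z t * f z t)) (at z)" if z: "Im z > 0" for z
  proof -
    define M where "M = mass (f z) b"
    have M0: "M \<ge> 0" unfolding M_def by (rule mass_nonneg[OF cont[OF z]])
    have evz: "eventually (\<lambda>w. Im w > 0) (at z)"
      using eventually_at_in_open'[OF open_upper_half_plane, of z] z by simp
    have ev2: "eventually (\<lambda>w. w \<in> ball z (Im z / 2)) (at z)"
      by (rule eventually_at_in_open') (use z in auto)
    \<comment> \<open>The mass of \<open>f w\<close> is \<open>Im (m w) / Im w\<close>, so the
      increment \<delta> is bounded in terms of itself; as \<open>cmod (w - z) < Im z / 2\<close>,
      it can be absorbed on the left. The outcome is continuity of \<open>m\<close> at
      \<open>z\<close>.\<close>
    have bound: "cmod (m w - m z) \<le> cmod (w - z) * (2 * (2 * cmod (m z) + 1) / Im z)"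
      if w: "w \<in> ball z (Im z / 2)" "w \<in> ball z (Im z / 2)" for w
    proof -
      have wz: "cmod (w - z) < Im z / 2" using w by (simp add: dist_norm norm_minus_commute)
      then have Iw: "Im w > Im z / 2" using abs_Im_le_cmod[of "w - z"] by simp
      then have w0: "Im w > 0" using z by linarith
      define \<delta> where "\<delta> = cmod (m w - m z)"
      have "mass (f w) b = Im (m w) / Im w" using mass[OF w0] w0 by (simp add: field_simps)
      also have "\<dots> \<le> (\<delta> + cmod (m z)) / (Im z / 2)"
      proof (rule frac_le)
        have "Im (m w) \<le> cmod (m w)" using abs_Im_le_cmod[of "m w"] by linarith
        also have "\<dots> \<le> \<delta> + cmod (m z)" unfolding \<delta>_def using norm_triangle_sub[of "m w" "m z"] by linarith
        finally show "Im (m w) \<le> \<delta> + cmod (m z)" .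
      qed (use Iw z in \<open>auto simp: \<delta>_def\<close>)
      finally have A: "mass (f w) b \<le> (\<delta> + cmod (m z)) / (Im z / 2)" .
      have "M = Im (m z) / Im z" using mass[OF z] z by (simp add: M_def)
      also have "\<dots> \<le> cmod (m z) / (Im z / 2)"
      proof (rule frac_le)
        show "Im (m z) \<le> cmod (m z)" using abs_Im_le_cmod[of "m z"] by linarith
      qed (use z in auto)
      finally have B: "M \<le> cmod (m z) / (Im z / 2)" .
      have "\<delta> = cmod (w - z) * cmod (integral {0..b} (\<lambda>t. f w t * f z t))"
        unfolding \<delta>_def K1[OF w0 z] norm_mult ..
      also have "\<dots> \<le> cmod (w - z) * ((mass (f w) b + M) / 2)"
        using young[OF cont[OF w0] cont[OF z], of 1] by (intro mult_left_mono) (simp_all add: M_def)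
      also have "\<dots> \<le> cmod (w - z) * (((\<delta> + cmod (m z)) / (Im z / 2) + cmod (m z) / (Im z / 2)) / 2)"
        using A B by (intro mult_left_mono divide_right_mono add_mono) auto
      also have "\<dots> = cmod (w - z) * (\<delta> + 2 * cmod (m z)) / Im z" using z by (simp add: field_simps)
      finally have 1: "\<delta> * Im z \<le> cmod (w - z) * (\<delta> + 2 * cmod (m z))" using z by (simp add: pos_le_divide_eq)
      have "cmod (w - z) * \<delta> \<le> Im z / 2 * \<delta>" using wz by (intro mult_right_mono) (auto simp: \<delta>_def)
      then have "\<delta> * Im z \<le> 4 * (cmod (w - z) * cmod (m z))" using 1 by (simp add: algebra_simps)
      also have "\<dots> \<le> cmod (w - z) * (2 * (2 * cmod (m z) + 1))" by (simp add: algebra_simps)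
      finally show ?thesis using z by (simp add: \<delta>_def pos_le_divide_eq)
    qed
    have "((\<lambda>w. cmod (w - z) * (2 * (2 * cmod (m z) + 1) / Im z)) \<longlongrightarrow> cmod (z - z) * (2 * (2 * cmod (m z) + 1) / Im z)) (at z)"
      by (intro tendsto_intros)
    then have "((\<lambda>w. m w - m z) \<longlongrightarrow> 0) (at z)"
      by (intro Lim_null_comparison[OF eventually_mono[OF ev2 bound]]) auto
    then have mlim: "(m \<longlongrightarrow> m z) (at z)" by (rule LIM_zero_cancel)
    \<comment> \<open>The squared mean distance of \<open>f w\<close> and \<open>f z\<close> is
      expressed by values of \<open>m\<close> alone, so continuity of \<open>m\<close> makes it tend
      to 0.\<close>
    define E where "E w = mass (\<lambda>t. f w t + (-1) * f z t) b" for w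
    have E_eq: "E w = Im (m w) / Im w + Im (m z) / Im z - 2 * Re ((cnj (m w) - m z) / (cnj w - z))" if w: "Im w > 0" for w
    proof -
      have "cnj w - z \<noteq> 0" using w z by (auto simp: complex_eq_iff)
      then have Q: "integral {0..b} (\<lambda>t. cnj (f w t) * f z t) = (cnj (m w) - m z) / (cnj w - z)"
        using K2[OF w z] by simp
      have neg: "Re (- 1 * x) = - Re x" for x :: complex by simp
      have "mass (f w) b = Im (m w) / Im w" "mass (f z) b = Im (m z) / Im z"
        using mass[OF w] mass[OF z] w z by simp_all
      then show ?thesis
        unfolding E_def mass_add[OF cont[OF w] cont[OF z]] Q neg by simp
    qed
    have zz: "cnj z - z \<noteq> 0" using z by (auto simp: complex_eq_iff)
    have "((\<lambda>w. Im (m w) / Im w + Im (m z) / Im z - 2 * Re ((cnj (m w) - m z) / (cnj w - z))) \<longlongrightarrow>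
        Im (m z) / Im z + Im (m z) / Im z - 2 * Re ((cnj (m z) - m z) / (cnj z - z))) (at z)"
      using z zz by (intro tendsto_intros mlim) auto
    moreover have "(cnj (m z) - m z) / (cnj z - z) = of_real (Im (m z) / Im z)"
      using zz z by (simp add: complex_eq_iff field_simps Re_divide Im_divide power2_eq_square)
    ultimately have "((\<lambda>w. Im (m w) / Im w + Im (m z) / Im z - 2 * Re ((cnj (m w) - m z) / (cnj w - z))) \<longlongrightarrow> 0) (at z)"
      by simp
    then have Elim: "(E \<longlongrightarrow> 0) (at z)"
      by (rule Lim_transform_eventually) (use evz E_eq in \<open>auto elim: eventually_mono\<close>)
    have quot: "eventually (\<lambda>w. cmod ((m w - m z) / (w - z) - integral {0..b} (\<lambda>t. f z t * f z t)) \<le> (e * M + E w / e) / 2) (at z)"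
      if e: "e > 0" for e
      using evz eventually_neq_at_within[of z]
    proof eventually_elim
      case (elim w)
      have c: "continuous_on {0..b} (\<lambda>t. f w t + (-1) * f z t)" by (intro continuous_intros cont elim z)
      have "(m w - m z) / (w - z) = integral {0..b} (\<lambda>t. f w t * f z t)" using K1[OF elim(1) z] elim by simp
      then have "(m w - m z) / (w - z) - integral {0..b} (\<lambda>t. f z t * f z t)
          = integral {0..b} (\<lambda>t. f w t * f z t - f z t * f z t)"
        by (subst integral_diff) (auto intro!: integrable_continuous_real continuous_intros cont elim z)
      also have "(\<lambda>t. f w t * f z t - f z t * f z t) = (\<lambda>t. f z t * (f w t + (-1) * f z t))"
        by (auto simp: algebra_simps)
      finally show ?case using young[OF cont[OF z] c e] by (simp add: E_def M_def)
    qed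
    have "((\<lambda>w. (m w - m z) / (w - z) - integral {0..b} (\<lambda>t. f z t * f z t)) \<longlongrightarrow> 0) (at z)"
    proof (rule tendstoI)
      fix r :: real assume r: "r > 0"
      define e where "e = r / (M + 1)"
      have e: "e > 0" using r M0 by (simp add: e_def)
      have eM: "e * M \<le> r" using r M0 by (simp add: e_def field_simps)
      have "eventually (\<lambda>w. dist (E w) 0 < r * e) (at z)"
        using tendstoD[OF Elim, of "r * e"] r e by simp
      with quot[OF e] show "eventually (\<lambda>w. dist ((m w - m z) / (w - z) - integral {0..b} (\<lambda>t. f z t * f z t)) 0 < r) (at z)"
      proof eventually_elim
        case (elim w)
        have "E w / e < r" using elim(2) e by (simp add: pos_divide_less_eq)
        with elim(1) eM show ?case by simp
      qed
    qed
    then show ?thesis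
      unfolding has_field_derivative_iff by (rule LIM_zero_cancel)
  qed
  then show "m holomorphic_on upper_half_plane"
    by (intro holomorphic_onI) (auto simp: field_differentiable_def intro: has_field_derivative_at_within)
qed

section \<open>Dirichlet problems on finite intervals\<close>

definition vsol :: "(real \<Rightarrow> real) \<Rightarrow> complex \<Rightarrow> complex \<Rightarrow> complex \<Rightarrow> (real \<Rightarrow> complex) \<times> (real \<Rightarrow> complex)" where
  "vsol q z c d = (SOME p. sol q z (fst p) (snd p) \<and> fst p 0 = c \<and> snd p 0 = d)"

lemma vsol:
  assumes "locally_integrable {0..} q"
  shows "sol q z (fst (vsol q z c d)) (snd (vsol q z c d))" "fst (vsol q z c d) 0 = c" "snd (vsol q z c d) 0 = d"
proof -
  obtain u v where "sol q z u v" "u 0 = c" "v 0 = d" using sol_exists[OF assms] by blast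
  then have "\<exists>p. sol q z (fst p) (snd p) \<and> fst p 0 = c \<and> snd p 0 = d" by (intro exI[of _ "(u, v)"]) simp
  from someI_ex[OF this]
  show "sol q z (fst (vsol q z c d)) (snd (vsol q z c d))" "fst (vsol q z c d) 0 = c" "snd (vsol q z c d) 0 = d"
    unfolding vsol_def by blast+
qed

abbreviation "theta q z \<equiv> fst (vsol q z 1 0)"
abbreviation "phi q z \<equiv> fst (vsol q z 0 1)"

definition weyl :: "(real \<Rightarrow> real) \<Rightarrow> complex \<Rightarrow> complex \<Rightarrow> real \<Rightarrow> complex" where
  "weyl q z m x = theta q z x + m * phi q z x"

definition weyl' :: "(real \<Rightarrow> real) \<Rightarrow> complex \<Rightarrow> complex \<Rightarrow> real \<Rightarrow> complex" where
  "weyl' q z m x = snd (vsol q z 1 0) x + m * snd (vsol q z 0 1) x"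

lemma weyl_sol:
  assumes "locally_integrable {0..} q"
  shows "sol q z (weyl q z m) (weyl' q z m)" "weyl q z m 0 = 1" "weyl' q z m 0 = m"
proof -
  have "sol q z (\<lambda>x. 1 * theta q z x + m * phi q z x) (\<lambda>x. 1 * snd (vsol q z 1 0) x + m * snd (vsol q z 0 1) x)"
    by (rule sol_lincomb[OF vsol(1)[OF assms] vsol(1)[OF assms]])
  then show "sol q z (weyl q z m) (weyl' q z m)"
    unfolding weyl_def weyl'_def by simp
  show "weyl q z m 0 = 1" "weyl' q z m 0 = m"
    unfolding weyl_def weyl'_def vsol[OF assms] by simp_all
qed

lemma sol_eq_vsol:
  assumes q: "locally_integrable {0..} q" and s: "sol q z u v" and "x \<ge> 0"
  shows "u x = u 0 * theta q z x + v 0 * phi q z x"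
proof -
  have "sol q z (\<lambda>x. u 0 * theta q z x + v 0 * phi q z x) (\<lambda>x. u 0 * snd (vsol q z 1 0) x + v 0 * snd (vsol q z 0 1) x)"
    by (rule sol_lincomb[OF vsol(1)[OF q] vsol(1)[OF q]])
  then show ?thesis
    by (rule sol_unique(1)[OF q s _ _ _ \<open>x \<ge> 0\<close>]) (simp_all add: vsol[OF q])
qed

text \<open>If \<open>phi\<close> vanished on the whole interval, its derivative at 0 would be 0 and
  not 1.\<close>

lemma phi_mass_pos:
  assumes q: "locally_integrable {0..} q" and b: "b > 0"
  shows "mass (phi q z) b > 0"
proof -
  have s: "sol q z (phi q z) (snd (vsol q z 0 1))" by (rule vsol(1)[OF q])
  have c: "continuous_on {0..b} (phi q z)" by (rule sol_continuous(1)[OF s])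
  have "\<exists>x\<in>{0..b}. phi q z x \<noteq> 0"
  proof (rule ccontr)
    assume "\<not> (\<exists>x\<in>{0..b}. phi q z x \<noteq> 0)"
    then have 0: "phi q z x = 0" if "x \<in> {0..b}" for x using that by blast
    have cv: "continuous_on {0..b} (snd (vsol q z 0 1))" by (rule sol_continuous(2)[OF s])
    have D: "((\<lambda>x. integral {0..x} (snd (vsol q z 0 1))) has_vector_derivative (snd (vsol q z 0 1) 0)) (at 0 within {0..b})"
      by (rule integral_has_vector_derivative[OF cv]) (use b in auto)
    have I0: "0 = integral {0..x} (snd (vsol q z 0 1))" if "x \<in> {0..b}" for x
    proof -
      have "(snd (vsol q z 0 1) has_integral (phi q z x - phi q z 0)) {0..x}"
        by (rule primitive_on_integral[OF solD(1)[OF s]]) (use that in auto)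
      then show ?thesis using 0[OF that] vsol(2)[OF q] by (simp add: integral_unique)
    qed
    have "((\<lambda>x. 0) has_vector_derivative (snd (vsol q z 0 1) 0)) (at 0 within {0..b})"
      by (rule has_vector_derivative_transform[OF _ I0 D]) (use b in auto)
    moreover have "((\<lambda>x. 0::complex) has_vector_derivative 0) (at 0 within {0..b})" by simp
    ultimately have "snd (vsol q z 0 1) 0 = 0"
      by (rule vector_derivative_unique_within[rotated]) (use b in \<open>simp add: trivial_limit_within islimpt_Icc\<close>)
    then show False using vsol(3)[OF q] by simp
  qed
  then show ?thesis using mass_pos[OF c _ _ b] by blast
qed

text \<open>A zero at \<open>b\<close> would make \<open>z\<close> an eigenvalue of the Dirichlet
  problem on \<open>[0, b]\<close>, and these are real: the flux would vanish at both ends while the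
  mass is positive.\<close>

lemma phi_nonzero:
  assumes q: "locally_integrable {0..} q" and b: "b > 0" and z: "Im z > 0"
  shows "phi q z b \<noteq> 0"
proof
  assume "phi q z b = 0"
  then have "0 = - (Im z * mass (phi q z) b)"
    using sol_flux[OF vsol(1)[OF q] less_imp_le[OF b], of z 0 1] vsol(2,3)[OF q] by simp
  then show False using z phi_mass_pos[OF q b, of z] by simp
qed

definition dirichlet_m :: "(real \<Rightarrow> real) \<Rightarrow> real \<Rightarrow> complex \<Rightarrow> complex" where
  "dirichlet_m q b z = - (theta q z b / phi q z b)"

lemma weyl_dirichlet_m:
  assumes "locally_integrable {0..} q" "b > 0" "Im z > 0"
  shows "weyl q z (dirichlet_m q b z) b = 0"
  using phi_nonzero[OF assms] by (simp add: weyl_def dirichlet_m_def)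

lemma dirichlet_m_mass:
  assumes q: "locally_integrable {0..} q" and b: "b > 0" and z: "Im z > 0"
  shows "Im (dirichlet_m q b z) = Im z * mass (weyl q z (dirichlet_m q b z)) b"
  using sol_flux[OF weyl_sol(1)[OF q] less_imp_le[OF b], of z "dirichlet_m q b z"]
    weyl_dirichlet_m[OF assms] weyl_sol(2,3)[OF q] by simp

text \<open>The boundary terms of Green's identity at \<open>b\<close> vanish with the solutions,
  which leaves exactly the kernel of \<open>Herglotz_Pick_kernel\<close>. Analytic dependence of
  \<open>theta\<close> and \<open>phi\<close> on \<open>z\<close> is thereby avoided.\<close>

lemma dirichlet_m_Herglotz:
  assumes q: "locally_integrable {0..} q" and b: "b > 0"
  shows "Herglotz (dirichlet_m q b)"
proof (rule Herglotz_Pick_kernel[of b "\<lambda>z. weyl q z (dirichlet_m q b z)"])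
  note S = weyl_sol[OF q]
  have bb: "0 \<le> b" using b by simp
  show "continuous_on {0..b} (weyl q z (dirichlet_m q b z))" for z
    by (rule sol_continuous(1)[OF S(1)])
  fix z w assume z: "Im z > 0" and w: "Im w > 0"
  note sw = sol_wronskian[OF S(1)[where z = z and m = "dirichlet_m q b z"] S(1)[where z = w and m = "dirichlet_m q b w"] bb]
  have "(w - z) * integral {0..b} (\<lambda>t. weyl q z (dirichlet_m q b z) t * weyl q w (dirichlet_m q b w) t) = - (dirichlet_m q b z - dirichlet_m q b w)"
    using integral_unique[OF sw] by (simp add: weyl_dirichlet_m[OF q b z] weyl_dirichlet_m[OF q b w] S(2,3))
  then show "dirichlet_m q b z - dirichlet_m q b w = (z - w) * integral {0..b} (\<lambda>t. weyl q z (dirichlet_m q b z) t * weyl q w (dirichlet_m q b w) t)"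
    by (metis minus_diff_eq minus_mult_left minus_minus)
  note sw = sol_wronskian[OF sol_cnj[OF S(1)[where z = z and m = "dirichlet_m q b z"]] S(1)[where z = w and m = "dirichlet_m q b w"] bb]
  have "(w - cnj z) * integral {0..b} (\<lambda>t. cnj (weyl q z (dirichlet_m q b z) t) * weyl q w (dirichlet_m q b w) t) = - (cnj (dirichlet_m q b z) - dirichlet_m q b w)"
    using integral_unique[OF sw] by (simp add: weyl_dirichlet_m[OF q b z] weyl_dirichlet_m[OF q b w] S(2,3))
  then show "cnj (dirichlet_m q b z) - dirichlet_m q b w = (cnj z - w) * integral {0..b} (\<lambda>t. cnj (weyl q z (dirichlet_m q b z) t) * weyl q w (dirichlet_m q b w) t)"
    by (metis minus_diff_eq minus_mult_left minus_minus)
next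
  fix z :: complex assume z: "Im z > 0"
  have "mass (weyl q z (dirichlet_m q b z)) b > 0"
    by (rule mass_pos[OF sol_continuous(1)[OF weyl_sol(1)[OF q]], of 0]) (use b weyl_sol(2)[OF q] in auto)
  then show "Im (dirichlet_m q b z) > 0" unfolding dirichlet_m_mass[OF q b z] using z by simp
qed

section \<open>The limit point case and the half line m function\<close>

text \<open>In one direction, \<open>v\<close> is continuous as an indefinite integral and the
  fundamental theorem recovers \<open>u\<close> from it; in the other, continuity of
  \<open>v\<close> makes its integral differentiable everywhere.\<close>

lemma schroedinger_solution_half_iff:
  assumes q: "locally_integrable {0..} q"
  shows "schroedinger_solution {0..} q z (u, v) \<longleftrightarrow> sol q z u v"
proof
  assume s: "schroedinger_solution {0..} q z (u, v)"
  then have du: "\<And>x. x \<ge> 0 \<Longrightarrow> (u has_vector_derivative v x) (at x within {0..})"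
    and iv: "\<And>x y. 0 \<le> x \<Longrightarrow> x \<le> y \<Longrightarrow> ((\<lambda>t. (of_real (q t) - z) * u t) has_integral (v y - v x)) {x..y}"
    by (auto simp: schroedinger_solution_def)
  have cu: "continuous_on {0..b} u" for b
    unfolding continuous_on_eq_continuous_within
  proof
    fix x assume "x \<in> {0..b}"
    then have "continuous (at x within {0..}) u"
      using du[of x] has_vector_derivative_continuous by simp
    then show "continuous (at x within {0..b}) u" by (rule continuous_within_subset) auto
  qed
  have v: "primitive_on 0 b (\<lambda>t. (of_real (q t) - z) * u t) v" for b
    unfolding primitive_on_def
    using absolutely_integrable_continuous_mult(2)[OF cu[of b] potential_absint[OF q, where z = z and b = b]] iv[OF order_refl] by simp
  have u: "primitive_on 0 b v u" for b
    unfolding primitive_on_def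
  proof (intro conjI ballI absolutely_integrable_continuous_real[OF primitive_on_continuous[OF v]])
    fix x assume x: "x \<in> {0..b}"
    show "(v has_integral (u x - u 0)) {0..x}"
    proof (rule fundamental_theorem_of_calculus)
      fix t assume "t \<in> {0..x}"
      then show "(u has_vector_derivative v t) (at t within {0..x})"
        by (intro has_vector_derivative_within_subset[OF du]) auto
    qed (use x in simp)
  qed
  show "sol q z u v" using u v by (simp add: sol_def)
next
  assume s: "sol q z u v"
  have iv: "((\<lambda>t. (of_real (q t) - z) * u t) has_integral (v y - v x)) {x..y}" if "0 \<le> x" "x \<le> y" for x y
    by (rule primitive_on_integral[OF solD(2)[OF s] that order_refl])
  have du: "(u has_vector_derivative v x) (at x within {0..})" if x: "x \<ge> 0" for x
  proof -
    have "((\<lambda>y. u 0 + integral {0..y} v) has_vector_derivative (0 + v x)) (at x within {0..x + 1})"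
      by (intro has_vector_derivative_add has_vector_derivative_const
          integral_has_vector_derivative[OF sol_continuous(2)[OF s]]) (use x in auto)
    then have "((\<lambda>y. u 0 + integral {0..y} v) has_vector_derivative v x) (at x within {0..x + 1})" by simp
    note D = this
    have "(u has_vector_derivative v x) (at x within {0..x + 1})"
    proof (rule has_vector_derivative_transform[OF _ _ D])
      fix y assume y: "y \<in> {0..x + 1}"
      have "(v has_integral (u y - u 0)) {0..y}"
        by (rule primitive_on_integral[OF solD(1)[OF s]]) (use y in auto)
      then show "u y = u 0 + integral {0..y} v" by (simp add: integral_unique)
    qed (use x in auto)
    moreover have "at x within {0..x + 1} = at x within {0..}"
      by (rule at_within_nhd[of _ "{..<x + 1}"]) auto
    ultimately show ?thesis by simp
  qed
  show "schroedinger_solution {0..} q z (u, v)"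
    using du iv by (simp add: schroedinger_solution_def)
qed

lemma limit_point_not_all_square_integrable:
  assumes q: "locally_integrable {0..} q" and lp: "limit_point_at_top {0..} q"
  shows "\<not> (sq_integrable_at_top (theta q z) \<and> sq_integrable_at_top (phi q z))"
proof
  assume sq: "sq_integrable_at_top (theta q z) \<and> sq_integrable_at_top (phi q z)"
  have ct: "continuous_on {0..b} (theta q z)" and cp: "continuous_on {0..b} (phi q z)" for b
    by (rule sol_continuous(1)[OF vsol(1)[OF q]])+
  obtain C1 where C1: "\<And>b. b \<ge> 0 \<Longrightarrow> mass (theta q z) b \<le> C1"
    using sq unfolding sq_integrable_at_top_iff_mass_bounded[OF ct] by blast
  obtain C2 where C2: "\<And>b. b \<ge> 0 \<Longrightarrow> mass (phi q z) b \<le> C2"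
    using sq unfolding sq_integrable_at_top_iff_mass_bounded[OF cp] by blast
  have "sq_integrable_at_top u" if "schroedinger_solution {0..} q z (u, v)" for u v
  proof -
    have s: "sol q z u v" using that schroedinger_solution_half_iff[OF q] by blast
    have "mass u b \<le> 2 * (cmod (u 0))\<^sup>2 * C1 + 2 * (cmod (v 0))\<^sup>2 * C2" if "b \<ge> 0" for b
    proof -
      have "mass u b = mass (\<lambda>x. u 0 * theta q z x + v 0 * phi q z x) b"
        unfolding mass_def
      proof (rule integral_cong)
        fix x assume "x \<in> {0..b}"
        then have "u x = u 0 * theta q z x + v 0 * phi q z x" by (intro sol_eq_vsol[OF q s]) simp
        then show "(cmod (u x))\<^sup>2 = (cmod (u 0 * theta q z x + v 0 * phi q z x))\<^sup>2"
          by (rule arg_cong)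
      qed
      also have "\<dots> \<le> 2 * (cmod (u 0))\<^sup>2 * mass (theta q z) b + 2 * (cmod (v 0))\<^sup>2 * mass (phi q z) b"
        by (rule mass_lincomb_le[OF ct cp])
      also have "\<dots> \<le> 2 * (cmod (u 0))\<^sup>2 * C1 + 2 * (cmod (v 0))\<^sup>2 * C2"
        by (intro add_mono mult_left_mono C1 C2 that) auto
      finally show ?thesis .
    qed
    then show ?thesis unfolding sq_integrable_at_top_iff_mass_bounded[OF sol_continuous(1)[OF s]] by blast
  qed
  with lp show False unfolding limit_point_at_top_def by blast
qed

text \<open>Two square integrable solutions that are linearly independent span all solutions.\<close>

lemma limit_point_wronskian:
  assumes q: "locally_integrable {0..} q" and lp: "limit_point_at_top {0..} q"
    and u: "sol q z u v" "sq_integrable_at_top u" and f: "sol q z f g" "sq_integrable_at_top f"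
  shows "v 0 * f 0 = u 0 * g 0"
proof (rule ccontr)
  assume ne: "v 0 * f 0 \<noteq> u 0 * g 0"
  define D where "D = u 0 * g 0 - v 0 * f 0"
  have D: "D \<noteq> 0" using ne by (simp add: D_def)
  have lin: "sq_integrable_at_top h"
    if h: "sol q z h k" and h0: "h 0 = c * u 0 + d * f 0" "k 0 = c * v 0 + d * g 0" for h k c d
  proof -
    obtain C1 where C1: "\<And>b. b \<ge> 0 \<Longrightarrow> mass u b \<le> C1"
      using u(2) sq_integrable_at_top_iff_mass_bounded[OF sol_continuous(1)[OF u(1)]] by blast
    obtain C2 where C2: "\<And>b. b \<ge> 0 \<Longrightarrow> mass f b \<le> C2"
      using f(2) sq_integrable_at_top_iff_mass_bounded[OF sol_continuous(1)[OF f(1)]] by blast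
    have "mass h b \<le> 2 * (cmod c)\<^sup>2 * C1 + 2 * (cmod d)\<^sup>2 * C2" if b: "b \<ge> 0" for b
    proof -
      have "h x = c * u x + d * f x" if "x \<ge> 0" for x
        by (rule sol_unique(1)[OF q h sol_lincomb[OF u(1) f(1)] h0 that])
      then have "mass h b = mass (\<lambda>x. c * u x + d * f x) b"
        unfolding mass_def by (intro integral_cong) auto
      also have "\<dots> \<le> 2 * (cmod c)\<^sup>2 * mass u b + 2 * (cmod d)\<^sup>2 * mass f b"
        by (rule mass_lincomb_le[OF sol_continuous(1)[OF u(1)] sol_continuous(1)[OF f(1)]])
      also have "\<dots> \<le> 2 * (cmod c)\<^sup>2 * C1 + 2 * (cmod d)\<^sup>2 * C2"
        by (intro add_mono mult_left_mono C1 C2 b) auto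
      finally show ?thesis .
    qed
    then show ?thesis unfolding sq_integrable_at_top_iff_mass_bounded[OF sol_continuous(1)[OF h]] by blast
  qed
  \<comment> \<open>Cramer's rule: the coefficients that express the data of \<open>theta\<close>
    and \<open>phi\<close> at 0 by those of the two given solutions.\<close>
  have "g 0 / D * u 0 + - v 0 / D * f 0 = 1" "g 0 / D * v 0 + - v 0 / D * g 0 = 0"
       "- f 0 / D * u 0 + u 0 / D * f 0 = 0" "- f 0 / D * v 0 + u 0 / D * g 0 = 1"
  proof -
    have e: "x / D * y + - p / D * r = (x * y - p * r) / D" "- p / D * r + x / D * y = (x * y - p * r) / D" for x y p r
      by (simp_all add: diff_divide_distrib)
    have "g 0 * u 0 - v 0 * f 0 = D" "u 0 * g 0 - f 0 * v 0 = D" by (simp_all add: D_def)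
    with D show "g 0 / D * u 0 + - v 0 / D * f 0 = 1" "g 0 / D * v 0 + - v 0 / D * g 0 = 0"
       "- f 0 / D * u 0 + u 0 / D * f 0 = 0" "- f 0 / D * v 0 + u 0 / D * g 0 = 1"
      unfolding e by simp_all
  qed
  then have "sq_integrable_at_top (theta q z)" "sq_integrable_at_top (phi q z)"
    using lin[OF vsol(1)[OF q], of 1 0 "g 0 / D" "- v 0 / D"] lin[OF vsol(1)[OF q], of 0 1 "- f 0 / D" "u 0 / D"]
      vsol(2,3)[OF q] by simp_all
  then show False using limit_point_not_all_square_integrable[OF q lp] by blast
qed

text \<open>The Dirichlet m functions for \<open>[0, n + 1]\<close> are bounded at each
  \<open>z\<close>. A limit point inherits the mass inequality and so belongs to a square integrable
  solution, of which the limit point case allows only one; hence the sequence converges.\<close>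

lemma weyl_m_function:
  assumes q: "locally_integrable {0..} q" and lp: "limit_point_at_top {0..} q"
  obtains m where "Herglotz m"
    and "\<And>z. Im z > 0 \<Longrightarrow> sq_integrable_at_top (weyl q z (m z))"
    and "\<And>z b. Im z > 0 \<Longrightarrow> b \<ge> 0 \<Longrightarrow> Im z * mass (weyl q z (m z)) b \<le> Im (m z)"
proof -
  define M where "M n z = dirichlet_m q (real (Suc n)) z" for n z
  have MH: "Herglotz (M n)" for n
    unfolding M_def by (rule dirichlet_m_Herglotz[OF q]) simp
  have Mle: "Im z * mass (weyl q z (M n z)) b \<le> Im (M n z)" if "Im z > 0" "0 \<le> b" "b \<le> real (Suc n)" for n z b
  proof -
    have "mass (weyl q z (M n z)) b \<le> mass (weyl q z (M n z)) (real (Suc n))"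
      by (rule mass_mono[OF sol_continuous(1)[OF weyl_sol(1)[OF q]] that(2,3)])
    then have "Im z * mass (weyl q z (M n z)) b \<le> Im z * mass (weyl q z (M n z)) (real (Suc n))"
      using that(1) by simp
    also have "\<dots> = Im (M n z)"
      unfolding M_def by (rule dirichlet_m_mass[OF q _ that(1), symmetric]) simp
    finally show ?thesis .
  qed
  have ct: "continuous_on {0..b} (theta q z)" and cp: "continuous_on {0..b} (phi q z)" for b z
    by (rule sol_continuous(1)[OF vsol(1)[OF q]])+
  have lim: "Im z * mass (weyl q z \<mu>) b \<le> Im \<mu>"
    if z: "Im z > 0" and r: "strict_mono (r :: nat \<Rightarrow> nat)" and l: "((\<lambda>n. M n z) \<circ> r) \<longlonglongrightarrow> \<mu>" and b: "b \<ge> 0" for z r \<mu> b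
  proof (rule LIMSEQ_le)
    have l': "(\<lambda>n. M (r n) z) \<longlonglongrightarrow> \<mu>" using l by (simp add: o_def)
    show "(\<lambda>n. Im z * mass (weyl q z (M (r n) z)) b) \<longlonglongrightarrow> Im z * mass (weyl q z \<mu>) b"
      unfolding weyl_def mass_add[OF ct cp] by (intro tendsto_intros l')
    show "(\<lambda>n. Im (M (r n) z)) \<longlonglongrightarrow> Im \<mu>" by (intro tendsto_intros l')
    show "\<exists>N. \<forall>n\<ge>N. Im z * mass (weyl q z (M (r n) z)) b \<le> Im (M (r n) z)"
    proof (intro exI allI impI)
      fix n assume n: "n \<ge> nat \<lceil>b\<rceil>"
      have "b \<le> real n" using n by linarith
      also have "real n \<le> real (r n)" using seq_suble[OF r, of n] by simp
      finally show "Im z * mass (weyl q z (M (r n) z)) b \<le> Im (M (r n) z)"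
        by (intro Mle[OF z b]) simp
    qed
  qed
  have sq: "sq_integrable_at_top (weyl q z \<mu>)"
    if "Im z > 0" "strict_mono (r :: nat \<Rightarrow> nat)" "((\<lambda>n. M n z) \<circ> r) \<longlonglongrightarrow> \<mu>" for z r \<mu>
  proof -
    have "mass (weyl q z \<mu>) b \<le> Im \<mu> / Im z" if "b \<ge> 0" for b
      using lim[OF \<open>Im z > 0\<close> \<open>strict_mono r\<close> \<open>((\<lambda>n. M n z) \<circ> r) \<longlonglongrightarrow> \<mu>\<close> that] \<open>Im z > 0\<close>
      by (simp add: pos_le_divide_eq mult.commute)
    then show ?thesis unfolding sq_integrable_at_top_iff_mass_bounded[OF sol_continuous(1)[OF weyl_sol(1)[OF q]]] by blast
  qed
  have bdd: "bounded (range (\<lambda>n. M n z))" if z: "Im z > 0" for z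
  proof -
    define P T where "P = mass (phi q z) 1" and "T = mass (theta q z) 1"
    have P: "P > 0" unfolding P_def by (rule phi_mass_pos[OF q]) simp
    have T: "T \<ge> 0" unfolding T_def by (rule mass_nonneg[OF ct])
    \<comment> \<open>\<open>M n z * phi\<close> is the Weyl solution minus \<open>theta\<close>.
      Its mass on \<open>[0, 1]\<close> is quadratic in \<open>cmod (M n z)\<close>, that of the
      Weyl solution at most linear.\<close>
    have "cmod (M n z) \<le> 1 + (2 / Im z + 2 * T) / P" for n
    proof (cases "cmod (M n z) \<le> 1")
      case True
      then show ?thesis using P T z by (simp add: add_increasing2)
    next
      case False
      define c where "c = cmod (M n z)"
      have c: "c > 1" using False by (simp add: c_def)
      have "mass (weyl q z (M n z)) 1 \<le> Im (M n z) / Im z"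
        using Mle[OF z, of 1 n] z by (simp add: pos_le_divide_eq mult.commute)
      also have "\<dots> \<le> c / Im z"
        using z abs_Im_le_cmod[of "M n z"] by (intro divide_right_mono) (auto simp: c_def)
      finally have W: "mass (weyl q z (M n z)) 1 \<le> c / Im z" .
      have "mass (\<lambda>x. 1 * weyl q z (M n z) x + (-1) * theta q z x) 1
          \<le> 2 * (cmod 1)\<^sup>2 * mass (weyl q z (M n z)) 1 + 2 * (cmod (-1))\<^sup>2 * mass (theta q z) 1"
        by (rule mass_lincomb_le[OF sol_continuous(1)[OF weyl_sol(1)[OF q]] ct])
      also have "mass (\<lambda>x. 1 * weyl q z (M n z) x + (-1) * theta q z x) 1 = c\<^sup>2 * P"
        unfolding mass_def P_def weyl_def c_def by (simp add: norm_mult power_mult_distrib)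
      finally have "c * (c * P) \<le> 2 * (c / Im z) + 2 * T" using W by (simp add: T_def power2_eq_square mult.assoc)
      also have "\<dots> \<le> c * (2 / Im z + 2 * T)" using c T mult_right_mono[of 1 c T] by (simp add: algebra_simps)
      finally have "c * P \<le> 2 / Im z + 2 * T" using c by simp
      then have "c \<le> (2 / Im z + 2 * T) / P" using P by (simp add: pos_le_divide_eq)
      then show ?thesis by (simp add: c_def)
    qed
    then show ?thesis unfolding bounded_iff by blast
  qed
  have ex: "\<exists>\<mu>. (\<lambda>n. M n z) \<longlonglongrightarrow> \<mu>" if z: "Im z > 0" for z
  proof -
    obtain \<mu> r where r: "strict_mono (r :: nat \<Rightarrow> nat)" "((\<lambda>n. M n z) \<circ> r) \<longlonglongrightarrow> \<mu>"
      using bounded_imp_convergent_subsequence[OF bdd[OF z]] by blast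
    have "(\<lambda>n. M n z) \<longlonglongrightarrow> \<mu>"
    proof (rule bounded_unique_limit_point_imp_tendsto[OF bdd[OF z]])
      fix r' \<mu>' assume r': "strict_mono (r' :: nat \<Rightarrow> nat)" "((\<lambda>n. M n z) \<circ> r') \<longlonglongrightarrow> \<mu>'"
      show "\<mu>' = \<mu>"
        using limit_point_wronskian[OF q lp weyl_sol(1)[OF q] sq[OF z r'] weyl_sol(1)[OF q] sq[OF z r]]
        unfolding weyl_sol(2,3)[OF q] by simp
    qed
    then show ?thesis by blast
  qed
  define m where "m z = lim (\<lambda>n. M n z)" for z
  have conv: "(\<lambda>n. M n z) \<longlonglongrightarrow> m z" if "Im z > 0" for z
    using ex[OF that] limI unfolding m_def by blast
  have conv': "((\<lambda>n. M n z) \<circ> id) \<longlonglongrightarrow> m z" if "Im z > 0" for z using conv[OF that] by simp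
  have idm: "strict_mono (id :: nat \<Rightarrow> nat)" by (simp add: strict_mono_def)
  have 3: "Im z * mass (weyl q z (m z)) b \<le> Im (m z)" if "Im z > 0" "b \<ge> 0" for z b
    by (rule lim[OF that(1) idm conv'[OF that(1)] that(2)])
  have "Herglotz m"
  proof (rule Herglotz_limit[OF MH conv])
    fix z :: complex assume z: "Im z > 0"
    have "mass (weyl q z (m z)) 1 > 0"
      by (rule mass_pos[OF sol_continuous(1)[OF weyl_sol(1)[OF q]], of 0]) (use weyl_sol(2)[OF q] in auto)
    then have "Im z * mass (weyl q z (m z)) 1 > 0" using z by simp
    with 3[OF z, of 1] show "Im (m z) > 0" by simp
  qed
  with that[of m] sq[OF _ idm conv'] 3 show ?thesis by blast
qed

section \<open>The Poeschl-Teller potential\<close>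

text \<open>The coefficients of \<open>2F1(1/2, k + 1/2; k + 1; q)\<close>. They have poles at
  negative integers \<open>k\<close>, and so \<open>k\<close> is kept off the real axis.\<close>

primrec cf :: "complex \<Rightarrow> nat \<Rightarrow> complex" where
  "cf k 0 = 1"
| "cf k (Suc j) = cf k j * ((of_nat j + 1/2) * (k + of_nat j + 1/2) / ((of_nat j + 1) * (k + of_nat j + 1)))"

text \<open>The operator \<open>q * d/dq\<close>, applied \<open>p\<close> times to the series; in
  terms of it the coefficient recursion becomes the differential equation without division by
  \<open>q\<close>.\<close>

definition ser :: "nat \<Rightarrow> complex \<Rightarrow> complex \<Rightarrow> complex" where
  "ser p k q = (\<Sum>j. of_nat j ^ p * cf k j * q ^ j)"

lemma nonreal_add_nonzero: "Im k \<noteq> 0 \<Longrightarrow> k + of_nat j + 1 \<noteq> 0"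
  by (auto simp: complex_eq_iff)

lemma cf_Suc_eq:
  assumes "Im k \<noteq> 0"
  shows "(of_nat j + 1) * (k + of_nat j + 1) * cf k (Suc j) = (of_nat j + 1/2) * (k + of_nat j + 1/2) * cf k j"
proof -
  have "complex_of_nat j + 1 \<noteq> 0" by (metis of_nat_Suc of_nat_neq_0 add.commute)
  then show ?thesis using nonreal_add_nonzero[OF assms, of j] by simp
qed

lemma norm_cf_Suc:
  "cmod (cf k (Suc j)) = cmod (cf k j) * ((real j + 1/2) / (real j + 1)) * (cmod (k + of_nat j + 1/2) / cmod (k + of_nat j + 1))"
proof -
  have "cmod (of_nat j + 1/2) = real j + 1/2"
    using norm_of_real[of "real j + 1/2", where 'a = complex] by simp
  moreover have "cmod (of_nat j + 1) = real j + 1"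
    using norm_of_real[of "real j + 1", where 'a = complex] by simp
  ultimately show ?thesis by (simp add: norm_mult norm_divide)
qed

lemma norm_cf_Suc_le:
  assumes "cmod (k + of_nat j + 1/2) \<le> L * cmod (k + of_nat j + 1)" "0 \<le> L" "k + of_nat j + 1 \<noteq> 0"
  shows "cmod (cf k (Suc j)) \<le> cmod (cf k j) * L"
proof -
  have "cmod (k + of_nat j + 1/2) / cmod (k + of_nat j + 1) \<le> L"
    using assms by (simp add: divide_le_eq)
  then have "cmod (cf k (Suc j)) \<le> cmod (cf k j) * ((real j + 1/2) / (real j + 1)) * L"
    unfolding norm_cf_Suc by (intro mult_left_mono) auto
  also have "\<dots> \<le> cmod (cf k j) * 1 * L"
    using assms by (intro mult_right_mono mult_left_mono) auto
  finally show ?thesis by simp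
qed

text \<open>For the first \<open>N\<close> indices the distance \<open>d\<close> from the real axis
  controls the denominators; afterwards \<open>k + j + 1\<close> has modulus at least 1, so each
  ratio is at most 3/2. This crude rate is good enough because \<open>q\<close> never exceeds
  1/16.\<close>

lemma norm_cf_le:
  assumes d: "d > 0" "\<bar>Im k\<bar> \<ge> d" and N: "cmod k \<le> real N"
  shows "cmod (cf k j) \<le> (1 + 1 / d) ^ N * (3/2) ^ j"
proof -
  have L: "1 + 1 / d \<ge> 1" using d by simp
  have tri: "cmod (k + of_nat j + 1/2) \<le> cmod (k + of_nat j + 1) + 1/2" for j
    using norm_triangle_ineq4[of "k + of_nat j + 1" "1/2"] by (simp add: algebra_simps)
  have Im: "k + of_nat j + 1 \<noteq> 0" for j using d by (intro nonreal_add_nonzero) auto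
  have "cmod (cf k j) \<le> (1 + 1 / d) ^ min j N * (3/2) ^ j"
  proof (induction j)
    case (Suc j)
    show ?case
    proof (cases "j < N")
      case True
      have "d \<le> cmod (k + of_nat j + 1)"
        using abs_Im_le_cmod[of "k + of_nat j + 1"] d by simp
      then have "1 \<le> 1 / d * cmod (k + of_nat j + 1)" using d by (simp add: field_simps)
      then have "cmod (k + of_nat j + 1/2) \<le> (1 + 1 / d) * cmod (k + of_nat j + 1)"
        using tri[of j] unfolding distrib_right by linarith
      then have "cmod (cf k (Suc j)) \<le> cmod (cf k j) * (1 + 1 / d)"
        by (rule norm_cf_Suc_le) (use L Im in auto)
      also have "\<dots> \<le> ((1 + 1 / d) ^ min j N * (3/2) ^ j) * (1 + 1 / d)"
        using L by (intro mult_right_mono Suc) auto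
      also have "\<dots> = ((1 + 1 / d) ^ Suc j * (3/2) ^ j) * 1" using True by (simp add: min_def mult_ac)
      also have "\<dots> \<le> ((1 + 1 / d) ^ Suc j * (3/2) ^ j) * (3/2)"
        using L by (intro mult_left_mono) auto
      also have "\<dots> = (1 + 1 / d) ^ min (Suc j) N * (3/2) ^ Suc j"
        using True by (simp add: min_def mult_ac)
      finally show ?thesis .
    next
      case False
      have "1 \<le> cmod (of_nat j + 1 :: complex) - cmod k"
        using False N norm_of_real[of "real j + 1", where 'a = complex] by simp
      also have "\<dots> \<le> cmod (k + of_nat j + 1)"
        using norm_diff_ineq[of "of_nat j + 1" k] by (simp add: algebra_simps)
      finally have "cmod (k + of_nat j + 1/2) \<le> (3/2) * cmod (k + of_nat j + 1)"
        using tri[of j] by linarith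
      then have "cmod (cf k (Suc j)) \<le> cmod (cf k j) * (3/2)"
        by (rule norm_cf_Suc_le) (use Im in auto)
      also have "\<dots> \<le> ((1 + 1 / d) ^ min j N * (3/2) ^ j) * (3/2)"
        by (intro mult_right_mono Suc) auto
      also have "\<dots> = (1 + 1 / d) ^ min (Suc j) N * (3/2) ^ Suc j"
      proof -
        have "min j N = N" "min (Suc j) N = N" using False by auto
        then show ?thesis by simp
      qed
      finally show ?thesis .
    qed
  qed simp
  also have "\<dots> \<le> (1 + 1 / d) ^ N * (3/2) ^ j"
    using L by (intro mult_right_mono power_increasing) auto
  finally show ?thesis .
qed

lemma power_le_two_power:
  assumes "p \<le> 2"
  shows "real j ^ p \<le> 4 * 2 ^ j"
proof -
  have a: "real j \<le> 2 ^ j" using of_nat_less_two_power[of j, where 'a = real] by simp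
  have "real j ^ 2 \<le> 4 * 2 ^ j \<and> real j \<le> 2 ^ j"
  proof (induction j)
    case (Suc j)
    have e: "(1::real) \<le> 2 ^ j" by simp
    have j: "real j ^ 2 \<le> 4 * 2 ^ j" "real j \<le> 2 ^ j" using Suc by auto
    have "real (Suc j) \<le> 2 ^ Suc j" unfolding of_nat_Suc power_Suc using j e by linarith
    moreover have "real (Suc j) ^ 2 = real j ^ 2 + 2 * real j + 1" by (simp add: power2_eq_square algebra_simps)
    then have "real (Suc j) ^ 2 \<le> 4 * 2 ^ Suc j" unfolding power_Suc[of 2 j] using j e by linarith
    ultimately show ?case by simp
  qed simp
  moreover have "p = 0 \<or> p = 1 \<or> p = 2" using assms by auto
  moreover have e: "(1::real) \<le> 2 ^ j" by simp
  moreover have "real j ^ 0 \<le> 4 * 2 ^ j" unfolding power_0 using e by linarith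
  moreover have "real j ^ 1 \<le> 4 * 2 ^ j" unfolding power_one_right using a e by linarith
  ultimately show ?thesis by metis
qed

text \<open>The factor 3 is 3/2 from \<open>norm_cf_le\<close> times 2 from the powers of
  \<open>j\<close>, whence the condition \<open>cmod q < 1/3\<close> later on. The bound is locally
  uniform in \<open>k\<close>, as the M-test in \<open>ser_holomorphic\<close> requires.\<close>

lemma norm_ser_term_le:
  assumes d: "d > 0" "\<bar>Im k\<bar> \<ge> d" and N: "cmod k \<le> real N" and p: "p \<le> 2"
  shows "cmod (of_nat j ^ p * cf k j * q ^ j) \<le> 4 * (1 + 1 / d) ^ N * (3 * cmod q) ^ j"
proof -
  have "cmod (of_nat j ^ p * cf k j * q ^ j) = real j ^ p * cmod (cf k j) * cmod q ^ j"
    by (simp add: norm_mult norm_power)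
  also have "\<dots> \<le> (4 * 2 ^ j) * ((1 + 1 / d) ^ N * (3/2) ^ j) * cmod q ^ j"
    using d by (intro mult_right_mono mult_mono power_le_two_power p norm_cf_le N) auto
  also have "\<dots> = 4 * (1 + 1 / d) ^ N * ((2 * (3/2)) * cmod q) ^ j"
    by (simp only: power_mult_distrib mult.assoc mult.left_commute)
  finally show ?thesis by simp
qed

lemma summable_ser:
  assumes k: "Im k \<noteq> 0" and p: "p \<le> 2" and q: "cmod q < 1/3"
  shows "summable (\<lambda>j. of_nat j ^ p * cf k j * q ^ j)"
proof -
  obtain N where N: "cmod k \<le> real N" using real_arch_simple by blast
  have "summable (\<lambda>j. 4 * (1 + 1 / \<bar>Im k\<bar>) ^ N * (3 * cmod q) ^ j)"
    using q by (intro summable_mult summable_geometric) simp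
  then show ?thesis
    by (rule summable_comparison_test'[where N = 0]) (use k N p in \<open>intro norm_ser_term_le, auto\<close>)
qed

lemma ser_has_field_derivative:
  assumes k: "Im k \<noteq> 0" and p: "p \<le> 1" and q: "cmod q < 1/3"
  obtains D where "(ser p k has_field_derivative D) (at q)" "q * D = ser (Suc p) k q"
proof -
  define c where "c j = of_nat j ^ p * cf k j" for j
  have sm: "summable (\<lambda>j. c j * w ^ j)" if "cmod w < 1/3" for w
    unfolding c_def by (rule summable_ser[OF k _ that]) (use p in simp)
  have der: "((\<lambda>w. \<Sum>j. c j * w ^ j) has_field_derivative (\<Sum>j. diffs c j * q ^ j)) (at q)"
    by (rule termdiffs_strong'[OF sm q])
  have "summable (\<lambda>j. diffs c j * q ^ j)"
    by (rule termdiff_converges[OF q sm])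
  from sums_mult[OF diffs_equiv[OF this], of q]
  have "(\<lambda>j. q * (of_nat j * c j * q ^ (j - Suc 0))) sums (q * (\<Sum>j. diffs c j * q ^ j))" .
  also have "(\<lambda>j. q * (of_nat j * c j * q ^ (j - Suc 0))) = (\<lambda>j. of_nat j ^ Suc p * cf k j * q ^ j)"
  proof
    fix j
    show "q * (of_nat j * c j * q ^ (j - Suc 0)) = of_nat j ^ Suc p * cf k j * q ^ j"
      by (cases j) (simp_all add: c_def)
  qed
  finally have "q * (\<Sum>j. diffs c j * q ^ j) = ser (Suc p) k q"
    unfolding ser_def by (rule sums_unique)
  moreover have "ser p k = (\<lambda>w. \<Sum>j. c j * w ^ j)" by (rule ext) (simp add: ser_def c_def)
  ultimately show ?thesis using that[of "\<Sum>j. diffs c j * q ^ j"] der by metis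
qed

text \<open>With \<theta> for \<open>q * d/dq\<close>, the recursion \<open>cf_Suc_eq\<close> says
  \<open>\<theta> (\<theta> + k) F = q (\<theta> + 1/2) (\<theta> + k + 1/2) F\<close>. The claim is
  four times this, with the second order terms collected on the left.\<close>

lemma ser_hypergeometric:
  assumes k: "Im k \<noteq> 0" and q: "cmod q < 1/3"
  shows "4 * (1 - q) * (ser 2 k q + k * ser 1 k q) = 4 * q * ser 1 k q + (2 * k + 1) * q * ser 0 k q"
proof -
  have s: "(\<lambda>j. of_nat j ^ p * cf k j * q ^ j) sums ser p k q" if "p \<le> 2" for p
    unfolding ser_def by (rule summable_sums[OF summable_ser[OF k that q]])
  define t where "t j = of_nat j ^ 2 * cf k j * q ^ j + k * (of_nat j ^ 1 * cf k j * q ^ j)" for j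
  have t: "t sums (ser 2 k q + k * ser 1 k q)"
    unfolding t_def by (intro sums_add sums_mult s) simp_all
  have "t (Suc j) = q * (t j + of_nat j ^ 1 * cf k j * q ^ j + (1/4 + k/2) * (of_nat j ^ 0 * cf k j * q ^ j))" for j
  proof -
    have "t (Suc j) = ((of_nat j + 1) * (k + of_nat j + 1) * cf k (Suc j)) * q ^ Suc j"
      unfolding t_def by (simp del: cf.simps add: power2_eq_square algebra_simps)
    also have "\<dots> = q * (((of_nat j + 1/2) * (k + of_nat j + 1/2) * cf k j) * q ^ j)"
      unfolding cf_Suc_eq[OF k] by simp
    also have "\<dots> = q * (t j + of_nat j ^ 1 * cf k j * q ^ j + (1/4 + k/2) * (of_nat j ^ 0 * cf k j * q ^ j))"
      unfolding t_def by (simp add: power2_eq_square algebra_simps)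
    finally show ?thesis .
  qed
  then have "(\<lambda>j. t (Suc j)) sums (q * ((ser 2 k q + k * ser 1 k q) + ser 1 k q + (1/4 + k/2) * ser 0 k q))"
    by (simp only:) (intro sums_mult sums_add t s, simp_all)
  moreover have "(\<lambda>j. t (Suc j)) sums (ser 2 k q + k * ser 1 k q)"
    using t by (subst sums_Suc_iff) (simp add: t_def)
  ultimately have e: "ser 2 k q + k * ser 1 k q = q * ((ser 2 k q + k * ser 1 k q) + ser 1 k q + (1/4 + k/2) * ser 0 k q)"
    using sums_unique2 by blast
  define X where "X = ser 2 k q + k * ser 1 k q"
  define Y where "Y = q * (X + ser 1 k q + (1/4 + k/2) * ser 0 k q)"
  have "X = Y" using e unfolding X_def Y_def .
  then have "4 * X - 4 * q * X = 4 * Y - 4 * q * X" by simp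
  also have "\<dots> = 4 * q * ser 1 k q + (2 * k + 1) * q * ser 0 k q" by (simp add: Y_def algebra_simps)
  finally have "4 * X - 4 * q * X = 4 * q * ser 1 k q + (2 * k + 1) * q * ser 0 k q" .
  then show ?thesis unfolding X_def[symmetric] by (simp add: algebra_simps)
qed

section \<open>The potential and its Jost solutions\<close>

text \<open>The factor 1/16 is the translation by \<open>ln 4\<close>: it moves the singularity of
  the potential to \<open>x = - ln 4\<close> and keeps \<open>qf\<close> well inside the disc of
  convergence on the half line.\<close>

definition qf :: "real \<Rightarrow> real" where "qf x = exp (- 2 * x) / 16"
definition Vp :: "real \<Rightarrow> real" where "Vp x = - qf x / (1 - qf x)\<^sup>2"
definition rf :: "real \<Rightarrow> real" where "rf x = sqrt (1 - qf x)"

lemma qf_bounds: "0 < qf x" "x \<ge> 0 \<Longrightarrow> qf x \<le> 1/16"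
  by (simp_all add: qf_def)

lemma rf_square: "x \<ge> 0 \<Longrightarrow> rf x ^ 2 = 1 - qf x" and rf_pos: "x \<ge> 0 \<Longrightarrow> rf x > 0"
  using qf_bounds[of x] by (simp_all add: rf_def)

lemma qf_deriv: "(qf has_real_derivative - 2 * qf x) (at x)"
  unfolding qf_def by (auto intro!: derivative_eq_intros)

lemma rf_deriv:
  assumes "x \<ge> 0"
  shows "(rf has_real_derivative qf x / rf x) (at x)"
  unfolding rf_def using qf_bounds[of x] assms
  by (auto intro!: derivative_eq_intros qf_deriv simp: field_simps)

text \<open>Splitting off \<open>exp (- k * x)\<close> and \<open>sqrt (1 - q)\<close> turns the
  Schroedinger equation into the hypergeometric one. The exponent 1/2 is the one that the
  singularity \<open>-1/(4 y\<^sup>2)\<close> of the potential prescribes.\<close>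

definition jost :: "complex \<Rightarrow> real \<Rightarrow> complex" where
  "jost k x = exp (- k * of_real x) * (of_real (rf x) * ser 0 k (of_real (qf x)))"

definition jost' :: "complex \<Rightarrow> real \<Rightarrow> complex" where
  "jost' k x = exp (- k * of_real x) * (- k * of_real (rf x) * ser 0 k (of_real (qf x))
     + of_real (qf x / rf x) * ser 0 k (of_real (qf x)) - 2 * of_real (rf x) * ser 1 k (of_real (qf x)))"

lemma ser_qf_deriv:
  assumes "Im k \<noteq> 0" "p \<le> 1" "x \<ge> 0"
  shows "((\<lambda>x. ser p k (of_real (qf x))) has_vector_derivative (- 2 * ser (Suc p) k (of_real (qf x)))) (at x)"
proof -
  have q: "cmod (of_real (qf x)) < 1/3" using qf_bounds[of x] assms(3) by simp
  obtain D where D: "(ser p k has_field_derivative D) (at (of_real (qf x)))" "of_real (qf x) * D = ser (Suc p) k (of_real (qf x))"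
    using ser_has_field_derivative[OF assms(1,2) q] by blast
  have "((\<lambda>x. complex_of_real (qf x)) has_vector_derivative of_real (- 2 * qf x)) (at x)"
    by (rule has_vector_derivative_of_real[OF qf_deriv])
  from field_vector_diff_chain_at[OF this D(1)]
  have "((\<lambda>x. ser p k (of_real (qf x))) has_vector_derivative (of_real (- 2 * qf x) * D)) (at x)" by (simp add: o_def)
  also have "of_real (- 2 * qf x) * D = - 2 * (of_real (qf x) * D)" by simp
  finally show ?thesis unfolding D(2) .
qed

lemma exp_lin_deriv: "((\<lambda>x. exp (- k * complex_of_real x)) has_vector_derivative (- k * exp (- k * of_real x))) (at x)"
proof -
  have "((\<lambda>x. - k * complex_of_real x) has_vector_derivative (- k * of_real 1)) (at x)"
    by (intro has_vector_derivative_mult_right has_vector_derivative_of_real) simp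
  from field_vector_diff_chain_at[OF this DERIV_exp] show ?thesis by (simp add: o_def mult.commute)
qed

lemma jost_deriv:
  assumes k: "Im k \<noteq> 0" and x: "x \<ge> 0"
  shows "(jost k has_vector_derivative jost' k x) (at x)"
proof -
  note E = exp_lin_deriv[of k x]
  note R = has_vector_derivative_of_real[OF rf_deriv[OF x], where 'a = complex]
  note F = ser_qf_deriv[OF k _ x, of 0]
  from has_vector_derivative_mult[OF E has_vector_derivative_mult[OF R F]]
  show ?thesis unfolding jost_def[abs_def] jost'_def
    by (rule has_vector_derivative_eq_rhs) (simp_all add: algebra_simps)
qed

lemma jost'_deriv:
  assumes k: "Im k \<noteq> 0" and x: "x \<ge> 0"
  shows "(jost' k has_vector_derivative ((of_real (Vp x) + k\<^sup>2) * jost k x)) (at x)"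
proof -
  define F G H where "F = ser 0 k (of_real (qf x))" and "G = ser 1 k (of_real (qf x))" and "H = ser 2 k (of_real (qf x))"
  define q r where "q = complex_of_real (qf x)" and "r = complex_of_real (rf x)"
  have r2: "r * r = 1 - q" and r0: "r \<noteq> 0"
    using rf_square[OF x] rf_pos[OF x] unfolding q_def r_def of_real_mult[symmetric] by (simp_all add: power2_eq_square)
  have q1: "1 - q \<noteq> 0" using r2 r0 by auto
  note E = exp_lin_deriv[of k x]
  note R = has_vector_derivative_of_real[OF rf_deriv[OF x], where 'a = complex]
  have "((\<lambda>x. qf x / rf x) has_real_derivative (- 2 * qf x * rf x - qf x * (qf x / rf x)) / (rf x * rf x)) (at x)"
    by (rule DERIV_divide[OF qf_deriv rf_deriv[OF x]]) (use rf_pos[OF x] in simp)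
  note QR0 = has_vector_derivative_of_real[OF this, where 'a = complex]
  define c where "c = complex_of_real ((- 2 * qf x * rf x - qf x * (qf x / rf x)) / (rf x * rf x))"
  have QR: "((\<lambda>x. complex_of_real (qf x / rf x)) has_vector_derivative c) (at x)"
    using QR0 unfolding c_def .
  have c: "c = (- 2 * q * r - q * (q / r)) / (r * r)" by (simp add: c_def q_def r_def)
  have dF: "((\<lambda>x. ser 0 k (of_real (qf x))) has_vector_derivative (- 2 * ser 1 k (of_real (qf x)))) (at x)"
    using ser_qf_deriv[OF k _ x, of 0] by simp
  have dG: "((\<lambda>x. ser 1 k (of_real (qf x))) has_vector_derivative (- 2 * ser 2 k (of_real (qf x)))) (at x)"
    using ser_qf_deriv[OF k _ x, of 1] by (simp add: numeral_2_eq_2)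
  have kR: "((\<lambda>x. - k * complex_of_real (rf x)) has_vector_derivative (- k * of_real (qf x / rf x))) (at x)"
    by (rule has_vector_derivative_mult_right[OF R])
  have R2: "((\<lambda>x. 2 * complex_of_real (rf x)) has_vector_derivative (2 * of_real (qf x / rf x))) (at x)"
    by (rule has_vector_derivative_mult_right[OF R])
  note D = has_vector_derivative_mult[OF E
      has_vector_derivative_diff[OF has_vector_derivative_add[OF has_vector_derivative_mult[OF kR dF]
        has_vector_derivative_mult[OF QR dF]] has_vector_derivative_mult[OF R2 dG]]]
  have hyp: "4 * (1 - q) * (H + k * G) = 4 * q * G + (2 * k + 1) * q * F"
    unfolding q_def F_def G_def H_def by (rule ser_hypergeometric[OF k]) (use qf_bounds[of x] x in simp)
  have V: "of_real (Vp x) = - q / ((1 - q) * (1 - q))"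
    by (simp add: Vp_def q_def power2_eq_square)
  define e where "e = exp (- k * of_real x)"
  have "e * ((- k * r) * (- 2 * G) + (- k * (q / r)) * F + ((q / r) * (- 2 * G) + c * F)
      - ((2 * r) * (- 2 * H) + (2 * (q / r)) * G)) + (- k * e) * (- k * r * F + q / r * F - 2 * r * G)
      = (- q / ((1 - q) * (1 - q)) + k\<^sup>2) * (e * (r * F))"
  proof -
    define L where "L = (- k * r) * (- 2 * G) + (- k * (q / r)) * F + ((q / r) * (- 2 * G) + c * F)
      - ((2 * r) * (- 2 * H) + (2 * (q / r)) * G) + (- k) * (- k * r * F + q / r * F - 2 * r * G)"
    have "r * (q / r) = q" "r * c = - 2 * q - q * q / (r * r)"
      using r0 unfolding c by (simp_all add: field_simps)
    note rr = this
    \<comment> \<open>After multiplication by \<open>r\<close> only \<open>r * r = 1 - q\<close>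
      occurs, and what remains is rational in \<open>q\<close> and follows from
      \<open>hyp\<close>.\<close>
    have "r * L = (- k * (r * r)) * (- 2 * G) + (- k * (r * (q / r))) * F + ((r * (q / r)) * (- 2 * G) + (r * c) * F)
      - ((2 * (r * r)) * (- 2 * H) + (2 * (r * (q / r))) * G) + (- k) * (- k * (r * r) * F + (r * (q / r)) * F - 2 * (r * r) * G)"
      unfolding L_def by (simp only: algebra_simps)
    also have "\<dots> = 4 * (1 - q) * (H + k * G) - 4 * q * G - 2 * k * q * F - (2 * q + q * q / (1 - q)) * F + k\<^sup>2 * (1 - q) * F"
      unfolding rr r2 by (simp add: power2_eq_square algebra_simps)
    also have "\<dots> = - (q + q * q / (1 - q)) * F + k\<^sup>2 * (1 - q) * F"
      unfolding hyp by (simp add: algebra_simps)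
    also have "q + q * q / (1 - q) = q / (1 - q)" using q1 by (simp add: field_simps)
    also have "- (q / (1 - q)) * F + k\<^sup>2 * (1 - q) * F = (- q / ((1 - q) * (1 - q)) + k\<^sup>2) * ((r * r) * F)"
    proof -
      have "- (q / p) * F + k\<^sup>2 * p * F = (- q / (p * p) + k\<^sup>2) * (p * F)" if "p \<noteq> 0" for p
        using that by (simp add: field_simps)
      from this[OF q1] show ?thesis unfolding r2 .
    qed
    finally have "r * L = r * ((- q / ((1 - q) * (1 - q)) + k\<^sup>2) * (r * F))" by (simp add: mult_ac)
    then have L: "L = (- q / ((1 - q) * (1 - q)) + k\<^sup>2) * (r * F)" using r0 by simp
    have "e * ((- k * r) * (- 2 * G) + (- k * (q / r)) * F + ((q / r) * (- 2 * G) + c * F)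
      - ((2 * r) * (- 2 * H) + (2 * (q / r)) * G)) + (- k * e) * (- k * r * F + q / r * F - 2 * r * G) = e * L"
      unfolding L_def by (simp only: algebra_simps)
    then show ?thesis unfolding L by (simp add: mult_ac)
  qed
  then show ?thesis
    unfolding jost'_def[abs_def] jost_def
    by (intro has_vector_derivative_eq_rhs[OF D])
       (simp add: V F_def G_def H_def q_def r_def e_def)
qed

section \<open>The sign of the imaginary part of M\<close>

text \<open>\<open>cf\<close> is split into the positive factors \<open>cr\<close> and the product
  \<open>cg\<close> (see \<open>cf_eq_cr_cg\<close>), which carries all arguments.\<close>

primrec cr :: "nat \<Rightarrow> real" where
  "cr 0 = 1"
| "cr (Suc j) = cr j * ((real j + 1/2) / (real j + 1))"

primrec cg :: "complex \<Rightarrow> nat \<Rightarrow> complex" where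
  "cg k 0 = 1"
| "cg k (Suc j) = cg k j * ((k + of_nat j + 1/2) / (k + of_nat j + 1))"

lemma cr_pos: "cr j > 0"
  by (induction j) auto

lemma cf_eq_cr_cg: "cf k j = of_real (cr j) * cg k j"
  by (induction j) (simp_all add: add.commute)

text \<open>Seen from \<open>-k\<close>, the segments \<open>[j + 1/2, j + 1]\<close> of the real line are disjoint,
  so the arguments of the factors of \<open>cg k j\<close> add up to more than \<open>-pi\<close>.\<close>

definition ang :: "complex \<Rightarrow> real \<Rightarrow> real" where
  "ang k t = Im (Ln (k + of_real t))"

lemma ang_bounds:
  assumes "Im k < 0"
  shows "- pi < ang k t" "ang k t < 0"
proof -
  have n0: "k + of_real t \<noteq> 0" using assms by (auto simp: complex_eq_iff)
  show "- pi < ang k t" unfolding ang_def by (rule mpi_less_Im_Ln[OF n0])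
  show "ang k t < 0" unfolding ang_def using Im_Ln_pos_le[OF n0] Im_Ln_le_pi[OF n0] assms by force
qed

lemma exp_ang:
  assumes "Im k < 0"
  shows "k + of_real t = of_real (cmod (k + of_real t)) * cis (ang k t)"
proof -
  have n0: "k + of_real t \<noteq> 0" using assms by (auto simp: complex_eq_iff)
  have "k + of_real t = exp (Ln (k + of_real t))" using n0 by simp
  also have "Ln (k + of_real t) = of_real (ln (cmod (k + of_real t))) + \<i> * of_real (ang k t)"
    using n0 by (simp add: complex_eq_iff ang_def)
  also have "exp \<dots> = of_real (exp (ln (cmod (k + of_real t)))) * cis (ang k t)"
    by (simp only: exp_add exp_of_real cis_conv_exp)
  also have "exp (ln (cmod (k + of_real t))) = cmod (k + of_real t)" using n0 by simp
  finally show ?thesis .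
qed

text \<open>Moving to the right in the lower half plane turns the argument towards 0. If it did not,
  \<open>Im ((k + s) * cnj (k + t))\<close>, which is \<open>Im k * (t - s)\<close> and thus not
  positive, would be a positive multiple of the sine of an angle in \<open>(0, pi)\<close>.\<close>

lemma ang_mono:
  assumes k: "Im k < 0" and st: "s \<le> t"
  shows "ang k s \<le> ang k t"
proof (rule ccontr)
  assume "\<not> ang k s \<le> ang k t"
  then have lt: "0 < ang k s - ang k t" "ang k s - ang k t < pi" using ang_bounds[OF k, of s] ang_bounds[OF k, of t] by auto
  define \<rho> \<sigma> where "\<rho> = cmod (k + of_real s)" and "\<sigma> = cmod (k + of_real t)"
  have pos: "\<rho> > 0" "\<sigma> > 0" using k by (auto simp: \<rho>_def \<sigma>_def complex_eq_iff)
  have "(k + of_real s) * cnj (k + of_real t) = of_real (\<rho> * \<sigma>) * cis (ang k s - ang k t)"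
    unfolding exp_ang[OF k, of s, folded \<rho>_def] exp_ang[OF k, of t, folded \<sigma>_def]
    by (simp add: cis_cnj cis_mult mult_ac)
  from arg_cong[OF this, of Im]
  have "Im k * (t - s) = \<rho> * \<sigma> * sin (ang k s - ang k t)"
    by (simp add: algebra_simps)
  moreover have "\<rho> * \<sigma> * sin (ang k s - ang k t) > 0" using pos sin_gt_zero[OF lt] by simp
  moreover have "Im k * (t - s) \<le> 0" using k st by (simp add: mult_nonpos_nonneg)
  ultimately show False by linarith
qed

text \<open>An argument of \<open>cg k j\<close>, summed up without reduction modulo
  \<open>2 * pi\<close>, so that its total variation can be compared with \<open>pi\<close>.\<close>

primrec om :: "complex \<Rightarrow> nat \<Rightarrow> real" where
  "om k 0 = 0"
| "om k (Suc j) = om k j + (ang k (real j + 1/2) - ang k (real j + 1))"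

lemma cg_polar:
  assumes k: "Im k < 0"
  shows "\<exists>\<rho>\<ge>0. cg k j = of_real \<rho> * cis (om k j)"
proof (induction j)
  case 0
  show ?case by (intro exI[of _ 1]) simp
next
  case (Suc j)
  then obtain \<rho> where \<rho>: "\<rho> \<ge> 0" "cg k j = of_real \<rho> * cis (om k j)" by blast
  define x y where "x = cmod (k + of_real (real j + 1/2))" and "y = cmod (k + of_real (real j + 1))"
  have a: "k + of_nat j + 1/2 = of_real x * cis (ang k (real j + 1/2))"
    using exp_ang[OF k, of "real j + 1/2", folded x_def] by (simp add: add.assoc)
  have b: "k + of_nat j + 1 = of_real y * cis (ang k (real j + 1))"
    using exp_ang[OF k, of "real j + 1", folded y_def] by (simp add: add.assoc)
  have "cg k (Suc j) = of_real (\<rho> * (x / y)) * (cis (om k j) * (cis (ang k (real j + 1/2)) / cis (ang k (real j + 1))))"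
    unfolding cg.simps \<rho>(2) a b by simp
  also have "cis (om k j) * (cis (ang k (real j + 1/2)) / cis (ang k (real j + 1)))
      = cis (om k (Suc j))"
    by (simp add: cis_divide cis_mult algebra_simps)
  finally show ?case using \<rho>(1) by (intro exI[of _ "\<rho> * (x / y)"]) (simp add: x_def y_def)
qed

text \<open>Filling the gaps between the segments only lowers the sum, which then telescopes to
  \<open>ang k (i + 1/2) - ang k (j + 1/2)\<close>; this exceeds \<open>- pi\<close> as all angles
  lie in \<open>(- pi, 0)\<close>.\<close>

lemma om_diff:
  assumes k: "Im k < 0" and "i \<le> j"
  shows "om k j - om k i \<le> 0" "- pi < om k j - om k i"
proof -
  have "om k j - om k i \<le> 0 \<and> ang k (real i + 1/2) - ang k (real j + 1/2) \<le> om k j - om k i"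
    using \<open>i \<le> j\<close>
  proof (induction j rule: dec_induct)
    case (step j)
    have "ang k (real j + 1/2) \<le> ang k (real j + 1)" "ang k (real j + 1) \<le> ang k (real (Suc j) + 1/2)"
      by (rule ang_mono[OF k]; simp)+
    then show ?case using step.IH by simp
  qed simp
  then show "om k j - om k i \<le> 0" "- pi < om k j - om k i"
    using ang_bounds[OF k, of "real i + 1/2"] ang_bounds[OF k, of "real j + 1/2"] by linarith+
qed

lemma Im_cnj_cg_le:
  assumes k: "Im k < 0" and "i \<le> j"
  shows "Im (cnj (cg k i) * cg k j) \<le> 0"
proof -
  obtain \<rho> \<sigma> where \<rho>: "\<rho> \<ge> 0" "cg k i = of_real \<rho> * cis (om k i)"
    and \<sigma>: "\<sigma> \<ge> 0" "cg k j = of_real \<sigma> * cis (om k j)"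
    using cg_polar[OF k] by metis
  have "cnj (cg k i) * cg k j = of_real (\<rho> * \<sigma>) * cis (om k j - om k i)"
    unfolding \<rho>(2) \<sigma>(2) by (simp add: cis_cnj cis_mult mult_ac)
  then have "Im (cnj (cg k i) * cg k j) = \<rho> * \<sigma> * sin (om k j - om k i)"
    by simp
  moreover have "sin (om k j - om k i) \<le> 0"
    using sin_ge_zero[of "- (om k j - om k i)"] om_diff[OF assms] by (simp only: sin_minus) linarith
  ultimately show ?thesis using \<rho>(1) \<sigma>(1) by (simp add: mult_nonneg_nonpos)
qed

text \<open>Chebyshev's sum inequality: symmetrizing the double sum for \<open>cnj F * G\<close> produces the
  terms \<open>(j - i) * Im (cnj (cg k i) * cg k j)\<close>, none of which is positive.\<close>

lemma Im_cnj_ser_le: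
  assumes k: "Im k < 0" and q: "0 \<le> q" "q < 1/3"
  shows "Im (cnj (ser 0 k (of_real q)) * ser 1 k (of_real q)) \<le> 0"
proof -
  define a where "a j = cr j * q ^ j" for j
  have a: "a j \<ge> 0" for j using cr_pos[of j] q by (simp add: a_def)
  define F G where "F N = (\<Sum>j<N. of_real (a j) * cg k j)" and "G N = (\<Sum>j<N. of_real (real j * a j) * cg k j)" for N
  have k0: "Im k \<noteq> 0" and cq: "cmod (of_real q) < 1/3" using k q by auto
  have "(\<lambda>N. \<Sum>j<N. of_nat j ^ p * cf k j * of_real q ^ j) \<longlonglongrightarrow> ser p k (of_real q)" if "p \<le> 2" for p
    unfolding ser_def by (rule summable_LIMSEQ[OF summable_ser[OF k0 that cq]])
  from this[of 0] this[of 1]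
  have lim: "F \<longlonglongrightarrow> ser 0 k (of_real q)" "G \<longlonglongrightarrow> ser 1 k (of_real q)"
    unfolding F_def G_def a_def cf_eq_cr_cg by (simp_all add: mult_ac)
  have fin: "Im (cnj (F N) * G N) \<le> 0" for N
  proof -
    define T where "T i j = Im (cnj (cg k i) * cg k j)" for i j
    have Tsym: "T j i = - T i j" for i j by (simp add: T_def)
    have S: "Im (cnj (F N) * G N) = (\<Sum>i<N. \<Sum>j<N. a i * a j * real j * T i j)"
      unfolding F_def G_def cnj_sum sum_product Im_sum
      by (intro sum.cong refl) (simp add: T_def algebra_simps)
    also have "\<dots> = (\<Sum>i<N. \<Sum>j<N. a j * a i * real i * T j i)" by (rule sum.swap)
    also have "\<dots> = (\<Sum>i<N. \<Sum>j<N. a i * a j * (- real i * T i j))"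
    proof -
      have "a j * a i * real i * T j i = a i * a j * (- real i * T i j)" for i j
        unfolding Tsym[of j i] by simp
      then show ?thesis by (simp only:)
    qed
    finally have S2: "Im (cnj (F N) * G N) = (\<Sum>i<N. \<Sum>j<N. a i * a j * (- real i * T i j))" .
    have "2 * Im (cnj (F N) * G N) = (\<Sum>i<N. \<Sum>j<N. a i * a j * real j * T i j) + (\<Sum>i<N. \<Sum>j<N. a i * a j * (- real i * T i j))"
      using S S2 by linarith
    also have "\<dots> = (\<Sum>i<N. \<Sum>j<N. a i * a j * ((real j - real i) * T i j))"
      unfolding sum.distrib[symmetric] by (intro sum.cong refl) (simp add: algebra_simps)
    also have "\<dots> \<le> 0"
    proof (intro sum_nonpos)
      fix i j
      have "(real j - real i) * T i j \<le> 0"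
      proof (cases "i \<le> j")
        case True
        then show ?thesis using Im_cnj_cg_le[OF k True] by (simp add: T_def mult_nonneg_nonpos)
      next
        case False
        then have "T j i \<le> 0" using Im_cnj_cg_le[OF k, of j i] by (simp add: T_def)
        then have "T i j \<ge> 0" using Tsym[of j i] by simp
        then show ?thesis using False by (simp add: mult_nonpos_nonneg)
      qed
      then show "a i * a j * ((real j - real i) * T i j) \<le> 0"
        by (rule mult_nonneg_nonpos[OF mult_nonneg_nonneg[OF a a]])
    qed
    finally show ?thesis by simp
  qed
  have "(\<lambda>N. Im (cnj (F N) * G N)) \<longlonglongrightarrow> Im (cnj (ser 0 k (of_real q)) * ser 1 k (of_real q))"
    by (intro tendsto_intros lim)
  then show ?thesis by (rule LIMSEQ_le_const2) (use fin in blast)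
qed

text \<open>Comparison with \<open>cg k 0 = 1\<close> shows that no term has positive imaginary
  part, and the one of index 1 is strictly negative. This keeps the denominator of \<open>Mf\<close>
  away from 0.\<close>

lemma Im_ser_neg:
  assumes k: "Im k < 0" and q: "0 < q" "q < 1/3"
  shows "Im (ser 0 k (of_real q)) < 0"
proof -
  have k0: "Im k \<noteq> 0" and cq: "cmod (of_real q) < 1/3" using k q by auto
  define t where "t j = Im (of_nat j ^ 0 * cf k j * of_real q ^ j)" for j
  have t: "t sums Im (ser 0 k (of_real q))"
    unfolding t_def ser_def by (intro sums_Im summable_sums summable_ser[OF k0 _ cq]) simp
  have tj: "t j = cr j * q ^ j * Im (cg k j)" for j
    by (simp add: t_def cf_eq_cr_cg mult.assoc flip: of_real_power of_real_mult)
  have le: "t j \<le> 0" for j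
    using Im_cnj_cg_le[OF k, of 0 j] cr_pos[of j] q by (simp add: tj mult_nonneg_nonpos)
  have "Im (cg k 1) < 0"
  proof -
    have n0: "k + 1 \<noteq> 0" using k0 by (auto simp: complex_eq_iff)
    have "cg k 1 = ((k + 1) - 1/2) / (k + 1)" by simp
    also have "\<dots> = 1 - (1/2) / (k + 1)" unfolding diff_divide_distrib divide_self[OF n0] ..
    finally have "cg k 1 = 1 - (1/2) / (k + 1)" .
    define Y where "Y = 1 / (k + 1)"
    have "(Re k + 1)\<^sup>2 + (Im k)\<^sup>2 > 0" using k0 by (simp add: add_nonneg_pos)
    moreover have "Im Y = - Im k / ((Re k + 1)\<^sup>2 + (Im k)\<^sup>2)" by (simp add: Y_def Im_divide)
    ultimately have "Im Y > 0" using k by (simp add: divide_neg_pos)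
    moreover have "cg k 1 = 1 - (1/2) * Y" unfolding \<open>cg k 1 = 1 - (1/2) / (k + 1)\<close> Y_def by simp
    ultimately show ?thesis by simp
  qed
  moreover have "cr 1 * q ^ 1 > 0" using cr_pos[of 1] q by simp
  ultimately have "t 1 < 0" unfolding tj by (rule mult_pos_neg[rotated])
  have "Im (ser 0 k (of_real q)) \<le> (\<Sum>j<2. t j)"
  proof -
    have "(\<Sum>j<2. - t j) \<le> (\<Sum>j. - t j)"
      by (rule sum_le_suminf[OF summable_minus[OF sums_summable[OF t]]]) (use le in auto)
    then show ?thesis using sums_unique[OF sums_minus[OF t]] by (simp add: sum_negf)
  qed
  also have "\<dots> < 0" using \<open>t 1 < 0\<close> le[of 0] by (simp add: numeral_2_eq_2)
  finally show ?thesis .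
qed

lemma cf_cnj: "cf (cnj k) j = cnj (cf k j)"
  by (induction j) simp_all

lemma ser_cnj:
  assumes "Im k \<noteq> 0" "p \<le> 2" "cmod q < 1/3"
  shows "ser p (cnj k) (cnj q) = cnj (ser p k q)"
proof -
  have "(\<lambda>j. cnj (of_nat j ^ p * cf k j * q ^ j)) sums cnj (ser p k q)"
    unfolding ser_def sums_cnj by (rule summable_sums[OF summable_ser[OF assms]])
  then have "(\<lambda>j. of_nat j ^ p * cf (cnj k) j * cnj q ^ j) sums cnj (ser p k q)"
    by (simp add: cf_cnj)
  then show ?thesis unfolding ser_def by (rule sums_unique[symmetric])
qed

text \<open>The logarithmic derivative \<open>jost' k 0 / jost k 0\<close>; 1/15 is
  \<open>q / (1 - q)\<close> at \<open>q = 1/16\<close>, the contribution of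
  \<open>rf\<close>.\<close>

definition Mf :: "complex \<Rightarrow> complex" where
  "Mf k = - k + 1/15 - 2 * (ser 1 k (1/16) / ser 0 k (1/16))"

lemma ser_nonzero:
  assumes "Im k \<noteq> 0"
  shows "ser 0 k (1/16) \<noteq> 0"
proof (cases "Im k < 0")
  case True
  then show ?thesis using Im_ser_neg[of k "1/16"] by auto
next
  case False
  then have "Im (cnj k) < 0" using assms by simp
  then have "ser 0 (cnj k) (1/16) \<noteq> 0" using Im_ser_neg[of "cnj k" "1/16"] by auto
  then show ?thesis using ser_cnj[OF assms, of 0 "1/16"] by auto
qed

lemma Mf_cnj:
  assumes "Im k \<noteq> 0"
  shows "Mf (cnj k) = cnj (Mf k)"
  using ser_cnj[OF assms, of 0 "1/16"] ser_cnj[OF assms, of 1 "1/16"] by (simp add: Mf_def)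

text \<open>\<open>G / F\<close> is a positive multiple of \<open>cnj F * G\<close>. Both signs of
  \<open>Re k\<close> are covered, so that after conjugation the lemma applies at
  \<open>\<i> * csqrt z\<close>, where the Jost solution grows.\<close>

lemma Im_Mf_pos:
  assumes k: "Im k < 0"
  shows "Im (Mf k) > 0"
proof -
  define F G where "F = ser 0 k (1/16)" and "G = ser 1 k (1/16)"
  have F: "F \<noteq> 0" using ser_nonzero[of k] k by (simp add: F_def)
  have "Im (cnj F * G) \<le> 0"
    using Im_cnj_ser_le[OF k, of "1/16"] by (simp add: F_def G_def)
  have "G / F = (cnj F * G) / of_real ((cmod F)\<^sup>2)"
    unfolding complex_norm_square using F by simp
  then have "Im (G / F) = Im (cnj F * G) / (cmod F)\<^sup>2" by (simp only: Im_divide_of_real)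
  define X where "X = G / F"
  have "Im X \<le> 0" unfolding X_def \<open>Im (G / F) = _\<close> using \<open>Im (cnj F * G) \<le> 0\<close> by (rule divide_nonpos_nonneg) simp
  moreover have "Mf k = - k + 1/15 - 2 * X" by (simp only: Mf_def F_def G_def X_def)
  ultimately show ?thesis using k by simp
qed

lemma cf_holomorphic_on:
  assumes "\<And>k. k \<in> S \<Longrightarrow> Im k \<noteq> 0"
  shows "(\<lambda>k. cf k j) holomorphic_on S"
proof (induction j)
  case (Suc j)
  have "complex_of_nat j + 1 \<noteq> 0" by (metis of_nat_Suc of_nat_neq_0 add.commute)
  then show ?case
    unfolding cf.simps using Suc nonreal_add_nonzero[OF assms] by (intro holomorphic_intros) auto
qed simp

lemma open_nonreal: "open {k. Im k \<noteq> 0}"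
proof -
  have "{k. Im k \<noteq> 0} = {k. Im k < 0} \<union> {k. Im k > 0}" by auto
  then show ?thesis by (simp add: open_Un open_halfspace_Im_lt open_halfspace_Im_gt)
qed

lemma ser_holomorphic:
  assumes p: "p \<le> 2" and q: "cmod q < 1/3"
  shows "(\<lambda>k. ser p k q) holomorphic_on {k. Im k \<noteq> 0}"
proof (rule holomorphic_uniform_sequence[OF open_nonreal])
  show "(\<lambda>k. \<Sum>j<n. of_nat j ^ p * cf k j * q ^ j) holomorphic_on {k. Im k \<noteq> 0}" for n
    by (intro holomorphic_intros cf_holomorphic_on) auto
  fix k assume k: "k \<in> {k. Im k \<noteq> 0}"
  define d where "d = \<bar>Im k\<bar> / 2"
  have d: "d > 0" using k by (simp add: d_def)
  obtain N where N: "cmod k + d \<le> real N" using real_arch_simple by blast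
  have K: "d \<le> \<bar>Im w\<bar> \<and> cmod w \<le> real N" if "w \<in> cball k d" for w
  proof -
    have kw: "cmod (k - w) \<le> d" using that by (simp add: dist_norm)
    have "\<bar>Im k - Im w\<bar> \<le> d" using abs_Im_le_cmod[of "k - w"] kw by simp
    moreover have "cmod w \<le> cmod k + cmod (k - w)"
      using norm_triangle_ineq4[of k "k - w"] by simp
    moreover have "\<bar>Im k\<bar> - \<bar>Im w\<bar> \<le> \<bar>Im k - Im w\<bar>" by (rule abs_triangle_ineq2)
    ultimately show ?thesis using kw N unfolding d_def by linarith
  qed
  have "uniform_limit (cball k d) (\<lambda>n k. \<Sum>j<n. of_nat j ^ p * cf k j * q ^ j) (\<lambda>k. \<Sum>j. of_nat j ^ p * cf k j * q ^ j) sequentially"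
  proof (rule Weierstrass_m_test)
    show "cmod (of_nat j ^ p * cf w j * q ^ j) \<le> 4 * (1 + 1 / d) ^ N * (3 * cmod q) ^ j" if "w \<in> cball k d" for j w
      using K[OF that] by (intro norm_ser_term_le d p) auto
    show "summable (\<lambda>j. 4 * (1 + 1 / d) ^ N * (3 * cmod q) ^ j)"
      using q by (intro summable_mult summable_geometric) simp
  qed
  then show "\<exists>d>0. cball k d \<subseteq> {k. Im k \<noteq> 0} \<and>
      uniform_limit (cball k d) (\<lambda>n k. \<Sum>j<n. of_nat j ^ p * cf k j * q ^ j) (\<lambda>k. ser p k q) sequentially"
    unfolding ser_def using d K by (intro exI[of _ d]) force
qed

lemma Mf_holomorphic: "Mf holomorphic_on {k. Im k \<noteq> 0}"
  unfolding Mf_def by (intro holomorphic_intros ser_holomorphic) (auto simp: ser_nonzero)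

section \<open>Behaviour near the poles\<close>

lemma cmod_mono_Re: "Im u = Im v \<Longrightarrow> \<bar>Re u\<bar> \<le> \<bar>Re v\<bar> \<Longrightarrow> cmod u \<le> cmod v"
  unfolding cmod_def by (simp add: abs_le_square_iff)

text \<open>The denominator \<open>k + n = \<i> * \<eta>\<close> makes the term of index
  \<open>n\<close> dominate both series. \<open>ser 1\<close> weighs it with the factor
  \<open>n\<close>, so \<open>ser 1 / ser 0\<close> is \<open>n\<close> up to an error of modulus 1,
  and \<open>- Mf k\<close> is about \<open>- n + 2 * n\<close>.\<close>

lemma Mf_near_pole:
  assumes n: "n \<ge> 1" and \<eta>: "\<eta> = (1/2) ^ (10 * n)" and k: "k = Complex (- real n) \<eta>"
  shows "cmod (- Mf k - of_nat n) \<le> 4"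
proof -
  have \<eta>0: "0 < \<eta>" "\<eta> \<le> 1" unfolding \<eta> by (auto intro: power_le_one)
  have k0: "Im k \<noteq> 0" using \<eta>0 by (simp add: k)
  define c where "c = cf k"
  \<comment> \<open>Before the pole the real parts are negative, so \<open>k + j + 1\<close> is
    nearer to 0 than \<open>k + j + 1/2\<close>, but has modulus at least 1: the quotient lies
    between 1 and 2. The factor \<open>(j + 1/2) / (j + 1)\<close> lies between 1/2 and 1.\<close>
  have lu: "(1/2) ^ j \<le> cmod (c j) \<and> cmod (c j) \<le> 2 ^ j" if "j < n" for j
    using that
  proof (induction j)
    case (Suc j)
    have Re1: "Re (k + of_nat j + 1) = - (real n - real j - 1)" and Re2: "Re (k + of_nat j + 1/2) = - (real n - real j - 1/2)"
      by (simp_all add: k)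
    have ge1: "real n - real j - 1 \<ge> 1" using Suc.prems by linarith
    have "1 \<le> cmod (k + of_nat j + 1)"
      using abs_Re_le_cmod[of "k + of_nat j + 1"] ge1 unfolding Re1 by linarith
    then have "cmod (k + of_nat j + 1/2) \<le> 2 * cmod (k + of_nat j + 1)"
      using norm_triangle_ineq4[of "k + of_nat j + 1" "1/2"] by (simp add: algebra_simps)
    then have "cmod (c (Suc j)) \<le> cmod (c j) * 2"
      unfolding c_def by (rule norm_cf_Suc_le) (use nonreal_add_nonzero[OF k0] in auto)
    moreover have IH: "(1/2) ^ j \<le> cmod (c j)" "cmod (c j) \<le> 2 ^ j" using Suc by auto
    ultimately have up: "cmod (c (Suc j)) \<le> 2 ^ Suc j" by simp
    have "cmod (k + of_nat j + 1) \<le> cmod (k + of_nat j + 1/2)"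
      by (rule cmod_mono_Re) (use ge1 in \<open>simp, unfold Re1 Re2, linarith\<close>)
    then have r: "1 \<le> cmod (k + of_nat j + 1/2) / cmod (k + of_nat j + 1)"
      using nonreal_add_nonzero[OF k0, of j] by simp
    have "(1/2) ^ Suc j = (1/2) ^ j * (1/2) * (1::real)" by simp
    also have "\<dots> \<le> cmod (c j) * ((real j + 1/2) / (real j + 1)) * (cmod (k + of_nat j + 1/2) / cmod (k + of_nat j + 1))"
      using IH r by (intro mult_mono) (auto simp: field_simps)
    also have "\<dots> = cmod (c (Suc j))" unfolding c_def norm_cf_Suc ..
    finally show ?case using up by simp
  qed (simp add: c_def)
  then have lo: "(1/2) ^ j \<le> cmod (c j)" and up: "cmod (c j) \<le> 2 ^ j" if "j < n" for j using that by auto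
  have cn: "(1/2) ^ n * (1 / (2 * \<eta>)) \<le> cmod (c n)"
  proof -
    obtain m where m: "n = Suc m" using n by (cases n) auto
    have a: "k + of_nat m + 1 = Complex 0 \<eta>" and b: "k + of_nat m + 1/2 = Complex (-1/2) \<eta>"
      by (simp_all add: k m complex_eq_iff)
    have A: "1/2 \<le> cmod (k + of_nat m + 1/2)"
      using abs_Re_le_cmod[of "k + of_nat m + 1/2"] unfolding b by simp
    have B: "cmod (k + of_nat m + 1) = \<eta>" unfolding a using \<eta>0 by (simp add: cmod_def)
    have "(1/2) / \<eta> \<le> cmod (k + of_nat m + 1/2) / cmod (k + of_nat m + 1)"
      unfolding B by (rule divide_right_mono[OF A]) (use \<eta>0 in simp)
    then have "(1/2) ^ m * (1/2) * ((1/2) / \<eta>) \<le> cmod (c m) * ((real m + 1/2) / (real m + 1)) * (cmod (k + of_nat m + 1/2) / cmod (k + of_nat m + 1))"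
      using lo[of m] m \<eta>0 by (intro mult_mono) (auto simp: field_simps)
    also have "\<dots> = cmod (c n)" unfolding c_def m norm_cf_Suc ..
    finally show ?thesis unfolding m by simp
  qed
  \<comment> \<open>Past the pole the real parts are positive, and the moduli of the coefficients no
    longer increase.\<close>
  have tail: "cmod (c (l + n)) \<le> cmod (c n)" for l
  proof (induction l)
    case (Suc l)
    have "cmod (k + of_nat (l + n) + 1/2) \<le> 1 * cmod (k + of_nat (l + n) + 1)"
      unfolding mult_1 by (rule cmod_mono_Re) (simp_all add: k)
    then have "cmod (c (Suc (l + n))) \<le> cmod (c (l + n)) * 1"
      unfolding c_def by (rule norm_cf_Suc_le[OF _ _ nonreal_add_nonzero[OF k0]]) simp
    then show ?case using Suc by simp
  qed simp
  define q where "q = (1/16 :: complex)"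
  have q: "cmod q = 1/16" by (simp add: q_def norm_divide)
  define X where "X = cmod (c n) * (1/16) ^ n"
  \<comment> \<open>\<open>2 ^ (-n) * 16 ^ (-n) * 2 ^ (10 n) / 2\<close> is
    \<open>32 ^ n / 2\<close>. The bound \<open>16 * n\<close> makes the contribution
    \<open>2 * n\<close> of the indices below \<open>n\<close> at most \<open>X / 8\<close>.\<close>
  have X: "16 * real n \<le> X"
  proof -
    obtain m where m: "n = Suc m" using n by (cases n) auto
    have e: "\<eta> * 1024 ^ n = 1"
    proof -
      have "\<eta> * 1024 ^ n = ((1/2) ^ 10 * 1024) ^ n" unfolding \<eta> power_mult by (rule power_mult_distrib[symmetric])
      also have "(1/2) ^ 10 * 1024 = (1::real)" by (simp add: power_divide)
      finally show ?thesis by simp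
    qed
    have e2: "((1/2) ^ n * (1/16) ^ n) * 1024 ^ n = (32::real) ^ n"
    proof -
      have "((1/2) ^ n * (1/16) ^ n) * 1024 ^ n = ((1/2) * (1/16) * 1024 :: real) ^ n"
        unfolding power_mult_distrib ..
      then show ?thesis by simp
    qed
    have "16 * real n \<le> 16 * 32 ^ m"
    proof -
      have "1 + real m * 31 \<le> (1 + 31) ^ m" by (rule Bernoulli_inequality) simp
      then show ?thesis by (simp add: m)
    qed
    also have "\<dots> = (1/2) * 32 ^ n" by (simp add: m)
    also have "\<dots> = ((1/2) ^ n * (1/16) ^ n) * ((1/2) * 1024 ^ n)"
      unfolding e2[symmetric] by (rule mult.left_commute)
    also have "(1/2) * 1024 ^ n = 1 / (2 * \<eta>)" using e \<eta>0 by (simp add: field_simps)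
    also have "((1/2) ^ n * (1/16) ^ n) * (1 / (2 * \<eta>)) = ((1/2) ^ n * (1 / (2 * \<eta>))) * (1/16) ^ n" by simp
    also have "\<dots> \<le> X" unfolding X_def by (rule mult_right_mono[OF cn]) simp
    finally show ?thesis .
  qed
  have e8: "2 ^ l * (1/16) ^ l = (1/8::real) ^ l" for l
  proof -
    have "2 ^ l * (1/16) ^ l = (2 * (1/16) :: real) ^ l" by (rule power_mult_distrib[symmetric])
    then show ?thesis by simp
  qed
  have X16: "X \<ge> 16" using X n by simp
  have sm: "summable (\<lambda>j. of_nat j ^ p * c j * q ^ j)" if "p \<le> 2" for p
    unfolding c_def by (rule summable_ser[OF k0 that]) (simp add: q)
  have tle: "cmod (c (l + n) * q ^ (l + n)) \<le> X * (1/16) ^ l" for l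
  proof -
    have "cmod (c (l + n) * q ^ (l + n)) = cmod (c (l + n)) * ((1/16) ^ l * (1/16) ^ n)"
      by (simp add: norm_mult norm_power q power_add)
    also have "\<dots> \<le> cmod (c n) * ((1/16) ^ l * (1/16) ^ n)" by (rule mult_right_mono[OF tail]) simp
    finally show ?thesis by (simp add: X_def mult_ac)
  qed
  define A0 where "A0 = (\<Sum>j<n. c j * q ^ j)"
  define T0 where "T0 = (\<Sum>l. c (l + n) * q ^ (l + n))"
  define A1 where "A1 = (\<Sum>j<n. (of_nat j - of_nat n) * (c j * q ^ j))"
  define T1 where "T1 = (\<Sum>l. of_nat l * (c (l + n) * q ^ (l + n)))"
  have s0: "summable (\<lambda>j. c j * q ^ j)" using sm[of 0] by simp
  have s1: "summable (\<lambda>j. of_nat j * (c j * q ^ j))" using sm[of 1] by (simp add: mult.assoc)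
  have F: "ser 0 k q = T0 + A0"
    unfolding T0_def A0_def using suminf_split_initial_segment[OF s0, of n] by (simp add: ser_def c_def)
  have sd: "summable (\<lambda>j. (of_nat j - of_nat n) * (c j * q ^ j))"
    using summable_diff[OF s1 summable_mult[OF s0, of "of_nat n"]] by (simp add: left_diff_distrib)
  \<comment> \<open>Subtracting \<open>n\<close> times the series cancels the dominating
    term.\<close>
  have "ser 1 k q - of_nat n * ser 0 k q = (\<Sum>j. (of_nat j - of_nat n) * (c j * q ^ j))"
  proof -
    have "ser 1 k q = (\<Sum>j. of_nat j * (c j * q ^ j))" by (simp add: ser_def c_def mult.assoc)
    moreover have "of_nat n * ser 0 k q = (\<Sum>j. of_nat n * (c j * q ^ j))"
      using suminf_mult[OF s0, of "of_nat n"] by (simp add: ser_def c_def)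
    ultimately show ?thesis
      using suminf_diff[OF s1 summable_mult[OF s0, of "of_nat n"]] by (simp add: left_diff_distrib)
  qed
  also have "\<dots> = T1 + A1"
    unfolding T1_def A1_def using suminf_split_initial_segment[OF sd, of n] by simp
  finally have G: "ser 1 k q - of_nat n * ser 0 k q = T1 + A1" .
  have geo: "summable (\<lambda>l. (1/16::real) ^ l)" "summable (\<lambda>l. (1/8::real) ^ l)" by (simp_all add: summable_geometric)
  have T0: "cmod (T0 - c n * q ^ n) \<le> X / 15"
  proof -
    have "T0 = (\<Sum>l. c (Suc l + n) * q ^ (Suc l + n)) + c n * q ^ n"
      unfolding T0_def using suminf_split_head[OF summable_ignore_initial_segment[OF s0, of n]] by simp
    then have "cmod (T0 - c n * q ^ n) = cmod (\<Sum>l. c (Suc l + n) * q ^ (Suc l + n))" by simp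
    also have "\<dots> \<le> (\<Sum>l. X / 16 * (1/16) ^ l)"
    proof (rule norm_suminf_le)
      show "summable (\<lambda>l. X / 16 * (1/16) ^ l)" by (rule summable_mult[OF geo(1)])
      show "cmod (c (Suc l + n) * q ^ (Suc l + n)) \<le> X / 16 * (1/16) ^ l" for l using tle[of "Suc l"] by simp
    qed
    also have "\<dots> = X / 15" using suminf_mult[OF geo(1), of "X / 16"] suminf_geometric[of "1/16::real"] by simp
    finally show ?thesis .
  qed
  have T1: "cmod T1 \<le> X / 7"
  proof -
    have le: "cmod (of_nat l * (c (l + n) * q ^ (l + n))) \<le> X * ((1/8) ^ l - (if l = 0 then 1 else 0))" for l
    proof (cases l)
      case (Suc m)
      have "cmod (of_nat l * (c (l + n) * q ^ (l + n))) \<le> real l * (X * (1/16) ^ l)"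
        unfolding norm_mult[of "of_nat l"] norm_of_nat by (intro mult_left_mono tle) simp
      also have "\<dots> \<le> 2 ^ l * (X * (1/16) ^ l)"
        using X16 of_nat_less_two_power[of l, where 'a = real] by (intro mult_right_mono) auto
      also have "\<dots> = X * (1/8) ^ l" unfolding e8[symmetric] by (rule mult.left_commute)
      finally show ?thesis using Suc by simp
    qed simp
    have s: "(\<lambda>l. X * ((1/8) ^ l - (if l = 0 then 1 else 0))) sums (X * (1 / (1 - 1/8) - 1))"
      by (intro sums_mult sums_diff geometric_sums sums_single[of 0 "\<lambda>_. 1", simplified]) simp
    have "cmod T1 \<le> (\<Sum>l. X * ((1/8) ^ l - (if l = 0 then 1 else 0)))"
      unfolding T1_def by (rule norm_suminf_le[OF le sums_summable[OF s]])
    also have "\<dots> = X / 7" using sums_unique[OF s] by simp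
    finally show ?thesis .
  qed
  have head: "(\<Sum>j<n. cmod (c j * q ^ j)) \<le> 2"
  proof -
    have "(\<Sum>j<n. cmod (c j * q ^ j)) \<le> (\<Sum>j<n. (1/8) ^ j)"
    proof (rule sum_mono)
      fix j assume "j \<in> {..<n}"
      then have "cmod (c j) * (1/16) ^ j \<le> 2 ^ j * (1/16) ^ j" using up[of j] by (intro mult_right_mono) auto
      then show "cmod (c j * q ^ j) \<le> (1/8) ^ j" unfolding e8 norm_mult norm_power q .
    qed
    also have "\<dots> \<le> (\<Sum>j. (1/8) ^ j)" by (rule sum_le_suminf[OF geo(2)]) auto
    also have "\<dots> \<le> 2" by (simp add: suminf_geometric)
    finally show ?thesis .
  qed
  have A0: "cmod A0 \<le> 2" unfolding A0_def by (rule order_trans[OF norm_sum head])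
  have A1: "cmod A1 \<le> 2 * real n"
  proof -
    have "cmod A1 \<le> (\<Sum>j<n. real n * cmod (c j * q ^ j))"
      unfolding A1_def
    proof (rule sum_norm_le)
      fix j assume "j \<in> {..<n}"
      then have "cmod (of_nat j - of_nat n) \<le> real n"
        using norm_of_real[of "real j - real n", where 'a = complex] by simp
      then show "cmod ((of_nat j - of_nat n) * (c j * q ^ j)) \<le> real n * cmod (c j * q ^ j)"
        unfolding norm_mult[of "of_nat j - of_nat n"] by (rule mult_right_mono) simp
    qed
    also have "\<dots> \<le> real n * 2" unfolding sum_distrib_left[symmetric] by (rule mult_left_mono[OF head]) simp
    finally show ?thesis by simp
  qed
  define S where "S = ser 0 k q"
  have S: "X / 2 \<le> cmod S"
  proof -
    have "cmod (c n * q ^ n) = X" by (simp add: X_def norm_mult norm_power q)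
    moreover have "S = c n * q ^ n + ((T0 - c n * q ^ n) + A0)" by (simp add: S_def F)
    then have "cmod (c n * q ^ n) \<le> cmod S + (cmod (T0 - c n * q ^ n) + cmod A0)"
      using norm_triangle_ineq4[of S "(T0 - c n * q ^ n) + A0"] norm_triangle_ineq[of "T0 - c n * q ^ n" A0] by simp
    ultimately show ?thesis using T0 A0 X16 by linarith
  qed
  then have S0: "S \<noteq> 0" using X16 by auto
  define \<delta> where "\<delta> = (T1 + A1) / S"
  have "cmod (T1 + A1) \<le> X / 2"
    using norm_triangle_ineq[of T1 A1] T1 A1 X by linarith
  then have "cmod (T1 + A1) \<le> cmod S" using S by linarith
  then have \<delta>: "cmod \<delta> \<le> 1" using S0 by (simp add: \<delta>_def norm_divide divide_le_eq)
  have "ser 1 k q = of_nat n * S + (T1 + A1)" using G by (simp add: S_def algebra_simps)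
  then have "ser 1 k q / S = of_nat n + \<delta>" using S0 by (simp add: \<delta>_def add_divide_distrib)
  then have Mk: "Mf k = - k + 1/15 - 2 * (of_nat n + \<delta>)" unfolding Mf_def S_def q_def by simp
  have "- Mf k - of_nat n = (k + of_nat n) - 1/15 + 2 * \<delta>" unfolding Mk by (simp add: algebra_simps)
  also have "k + of_nat n = \<i> * of_real \<eta>" by (simp add: k complex_eq_iff)
  finally have "- Mf k - of_nat n = \<i> * of_real \<eta> - 1/15 + 2 * \<delta>" .
  also have "cmod \<dots> \<le> cmod (\<i> * of_real \<eta>) + cmod (1/15 :: complex) + cmod (2 * \<delta>)"
    using norm_triangle_ineq[of "\<i> * of_real \<eta> - 1/15" "2 * \<delta>"] norm_triangle_ineq4[of "\<i> * of_real \<eta>" "1/15"] by linarith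
  also have "\<dots> \<le> 4" using \<delta> \<eta>0 by (simp add: norm_mult norm_divide)
  finally show ?thesis .
qed

section \<open>Growth of the solutions with these data\<close>

lemma primitive_on_exp:
  assumes "0 \<le> b"
  shows "primitive_on 0 b (\<lambda>x. - k * exp (- k * complex_of_real x)) (\<lambda>x. exp (- k * of_real x))"
  unfolding primitive_on_def
proof (intro conjI ballI)
  show "(\<lambda>x. - k * exp (- k * complex_of_real x)) absolutely_integrable_on {0..b}"
    by (rule absolutely_integrable_continuous_real) (intro continuous_intros)
  fix x assume "x \<in> {0..b}"
  then show "((\<lambda>x. - k * exp (- k * complex_of_real x)) has_integral (exp (- k * of_real x) - exp (- k * of_real 0))) {0..x}"
    by (intro fundamental_theorem_of_calculus has_vector_derivative_at_within[OF exp_lin_deriv]) simp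
qed

text \<open>Variation of constants: for the zero potential
  \<open>exp (- k * x) * (v + k * u)\<close> is constant. It is applied with both signs of
  \<open>k\<close>.\<close>

lemma sol_variation:
  assumes s: "sol q (- k\<^sup>2) u v" and b: "0 \<le> b"
  shows "((\<lambda>t. exp (- k * of_real t) * (of_real (q t) * u t)) has_integral
     (exp (- k * of_real b) * (v b + k * u b) - (v 0 + k * u 0))) {0..b}"
proof -
  have P: "primitive_on 0 b (\<lambda>t. (- k * exp (- k * of_real t)) * (1 * v t + k * u t)
      + exp (- k * of_real t) * (1 * ((of_real (q t) - - k\<^sup>2) * u t) + k * v t))
      (\<lambda>x. exp (- k * of_real x) * (1 * v x + k * u x))"
    by (rule primitive_on_mult[OF primitive_on_exp[OF b] primitive_on_lincomb[OF solD(2)[OF s] solD(1)[OF s]]])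
  have "primitive_on 0 b (\<lambda>t. exp (- k * of_real t) * (of_real (q t) * u t)) (\<lambda>x. exp (- k * of_real x) * (v x + k * u x))"
    by (rule primitive_on_cong[OF P]) (simp_all add: power2_eq_square algebra_simps)
  from primitive_on_integral[OF this order_refl b order_refl] show ?thesis by simp
qed

text \<open>The data make the coefficient of the growing exponential about \<open>2 * n\<close> and
  that of the decaying one at most 5. With \<open>Y\<close> the maximum of the rescaled solution
  \<open>g\<close>, the potential changes each by at most \<open>Y * Q\<close>, up to the
  exponential scale. For \<open>n\<close> large against \<open>Q\<close> this first gives
  \<open>Y \<le> 3\<close> and then the lower bound.\<close>

lemma sol_growth:
  assumes q: "locally_integrable {0..} q" and s: "sol q (- \<kappa>\<^sup>2) u v"
    and \<kappa>: "\<kappa> = Complex (real n) (- \<eta>)" and \<eta>: "0 < \<eta>" "\<eta> \<le> 1"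
    and u0: "u 0 = 1" and m: "cmod (v 0 - of_nat n) \<le> 4"
    and Q: "integral {0..b} (\<lambda>t. \<bar>q t\<bar>) \<le> Q" and n: "real n \<ge> 11 + 6 * Q" and x: "x \<in> {0..b}"
  shows "exp (real n * x) / 2 \<le> cmod (u x)"
proof -
  define g where "g x = exp (- \<kappa> * of_real x) * u x" for x
  have nexp: "cmod (exp (- \<kappa> * of_real t)) = exp (- real n * t)" "cmod (exp (- (- \<kappa>) * of_real t)) = exp (real n * t)" for t
    by (simp_all add: norm_exp_eq_Re \<kappa>)
  have cg: "continuous_on {0..b} g"
    unfolding g_def by (intro continuous_intros sol_continuous(1)[OF s])
  have "\<exists>x1\<in>{0..b}. \<forall>y\<in>{0..b}. cmod (g y) \<le> cmod (g x1)"
    by (rule continuous_attains_sup) (use x cg in \<open>auto intro!: continuous_intros\<close>)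
  then obtain x1 where x1: "x1 \<in> {0..b}" "\<And>y. y \<in> {0..b} \<Longrightarrow> cmod (g y) \<le> cmod (g x1)" by blast
  define Y where "Y = cmod (g x1)"
  have Y: "Y \<ge> 0" by (simp add: Y_def)
  have qi: "(\<lambda>t. \<bar>q t\<bar>) integrable_on {0..y}" for y
  proof -
    have "q absolutely_integrable_on {0..y}" using q by (auto simp: locally_integrable_def)
    then show ?thesis by (simp add: absolutely_integrable_on_def)
  qed
  have Qy: "integral {0..y} (\<lambda>t. \<bar>q t\<bar>) \<le> Q" if "y \<in> {0..b}" for y
  proof -
    have "integral {0..y} (\<lambda>t. \<bar>q t\<bar>) \<le> integral {0..b} (\<lambda>t. \<bar>q t\<bar>)"
      by (rule integral_subset_le) (use that qi in auto)
    then show ?thesis using Q by linarith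
  qed
  have Q0: "Q \<ge> 0"
    using Qy[OF x] integral_nonneg[OF qi[of x]] by simp
  define P where "P k y = exp (- k * of_real y) * (v y + k * u y)" for k y
  have bd1: "cmod (P \<kappa> y - (v 0 + \<kappa>)) \<le> Y * Q" if y: "y \<in> {0..b}" for y
  proof -
    have h: "((\<lambda>t. exp (- \<kappa> * of_real t) * (of_real (q t) * u t)) has_integral (P \<kappa> y - (v 0 + \<kappa>))) {0..y}"
      using sol_variation[OF s, of y] y u0 by (simp add: P_def)
    have "cmod (integral {0..y} (\<lambda>t. exp (- \<kappa> * of_real t) * (of_real (q t) * u t))) \<le> integral {0..y} (\<lambda>t. Y * \<bar>q t\<bar>)"
    proof (rule integral_norm_bound_integral[OF has_integral_integrable[OF h]])
      show "(\<lambda>t. Y * \<bar>q t\<bar>) integrable_on {0..y}" by (rule integrable_on_mult_right[OF qi])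
      fix t assume "t \<in> {0..y}"
      then have "cmod (g t) * \<bar>q t\<bar> \<le> Y * \<bar>q t\<bar>" using x1(2)[of t] y by (intro mult_right_mono) (auto simp: Y_def)
      then show "cmod (exp (- \<kappa> * of_real t) * (of_real (q t) * u t)) \<le> Y * \<bar>q t\<bar>"
        by (simp add: g_def norm_mult mult_ac)
    qed
    also have "\<dots> \<le> Y * Q" using Qy[OF y] Y by (simp add: mult_left_mono)
    finally show ?thesis unfolding integral_unique[OF h] .
  qed
  have bd2: "cmod (exp (- 2 * \<kappa> * of_real y) * P (- \<kappa>) y) \<le> 5 + Y * Q" if y: "y \<in> {0..b}" for y
  proof -
    define E where "E = exp (2 * (real n * y))"
    have E: "E \<ge> 1" using y by (simp add: E_def)
    have h: "((\<lambda>t. exp (- (- \<kappa>) * of_real t) * (of_real (q t) * u t)) has_integral (P (- \<kappa>) y - (v 0 + (- \<kappa>)))) {0..y}"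
      using sol_variation[of q "- \<kappa>" u v y] s y u0 by (simp add: P_def)
    have "cmod (integral {0..y} (\<lambda>t. exp (- (- \<kappa>) * of_real t) * (of_real (q t) * u t))) \<le> integral {0..y} (\<lambda>t. (E * Y) * \<bar>q t\<bar>)"
    proof (rule integral_norm_bound_integral[OF has_integral_integrable[OF h]])
      show "(\<lambda>t. (E * Y) * \<bar>q t\<bar>) integrable_on {0..y}" by (rule integrable_on_mult_right[OF qi])
      fix t assume t: "t \<in> {0..y}"
      have "exp (- (- \<kappa>) * of_real t) * u t = exp (2 * \<kappa> * of_real t) * g t"
        unfolding g_def mult.assoc[symmetric] exp_add[symmetric] by (simp add: algebra_simps)
      then have "cmod (exp (- (- \<kappa>) * of_real t) * u t) = exp (2 * (real n * t)) * cmod (g t)"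
        by (simp add: norm_mult norm_exp_eq_Re \<kappa>)
      also have "\<dots> \<le> E * Y"
        using x1(2)[of t] t y by (intro mult_mono) (auto simp: Y_def E_def mult_left_mono)
      finally have "cmod (exp (- (- \<kappa>) * of_real t) * u t) * \<bar>q t\<bar> \<le> (E * Y) * \<bar>q t\<bar>" by (rule mult_right_mono) simp
      then show "cmod (exp (- (- \<kappa>) * of_real t) * (of_real (q t) * u t)) \<le> (E * Y) * \<bar>q t\<bar>"
        by (simp add: norm_mult mult_ac)
    qed
    also have "\<dots> \<le> (E * Y) * Q" using Qy[OF y] Y E by (simp add: mult_left_mono)
    finally have "cmod (P (- \<kappa>) y - (v 0 + (- \<kappa>))) \<le> E * (Y * Q)" unfolding integral_unique[OF h] by (simp add: mult.assoc)
    moreover have "cmod (v 0 + (- \<kappa>)) \<le> E * 5"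
    proof -
      have e: "v 0 + (- \<kappa>) = (v 0 - of_nat n) + \<i> * of_real \<eta>" by (simp add: \<kappa> complex_eq_iff)
      have "cmod ((v 0 - of_nat n) + \<i> * of_real \<eta>) \<le> 4 + 1"
        using norm_triangle_ineq[of "v 0 - of_nat n" "\<i> * of_real \<eta>"] m \<eta> by (simp add: norm_mult)
      then show ?thesis unfolding e using E by linarith
    qed
    ultimately have B: "cmod (P (- \<kappa>) y) \<le> E * (5 + Y * Q)"
      using norm_triangle_sub[of "P (- \<kappa>) y" "v 0 + (- \<kappa>)"] unfolding distrib_left by linarith
    have "cmod (exp (- 2 * \<kappa> * of_real y)) = exp (- (2 * (real n * y)))"
      unfolding norm_exp_eq_Re by (simp add: \<kappa>)
    then have A: "cmod (exp (- 2 * \<kappa> * of_real y)) = 1 / E" by (simp add: E_def exp_minus inverse_eq_divide)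
    have "cmod (exp (- 2 * \<kappa> * of_real y) * P (- \<kappa>) y) = 1 / E * cmod (P (- \<kappa>) y)" unfolding norm_mult A ..
    also have "\<dots> \<le> 1 / E * (E * (5 + Y * Q))" by (rule mult_left_mono[OF B]) (use E in simp)
    also have "\<dots> = 5 + Y * Q" using E by simp
    finally show ?thesis .
  qed
  \<comment> \<open>The derivative \<open>v\<close> is eliminated from the two variation
    formulas.\<close>
  have rep: "2 * \<kappa> * g y = P \<kappa> y - exp (- 2 * \<kappa> * of_real y) * P (- \<kappa>) y" for y
  proof -
    have e: "exp (- 2 * \<kappa> * of_real y) * exp (- (- \<kappa>) * of_real y) = exp (- \<kappa> * of_real y)"
      unfolding exp_add[symmetric] by (simp add: algebra_simps)
    have "exp (- 2 * \<kappa> * of_real y) * P (- \<kappa>) y = exp (- \<kappa> * of_real y) * (v y + (- \<kappa>) * u y)"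
      unfolding P_def mult.assoc[symmetric] e ..
    then show ?thesis by (simp add: P_def g_def algebra_simps)
  qed
  have k1: "real n \<le> cmod \<kappa>" "cmod \<kappa> \<le> real n + 1"
    using abs_Re_le_cmod[of \<kappa>] cmod_le[of \<kappa>] \<eta> by (auto simp: \<kappa>)
  have vk: "v 0 + \<kappa> = 2 * of_nat n + ((v 0 - of_nat n) - \<i> * of_real \<eta>)" by (simp add: \<kappa> complex_eq_iff)
  have small: "cmod ((v 0 - of_nat n) - \<i> * of_real \<eta>) \<le> 5"
    using norm_triangle_ineq4[of "v 0 - of_nat n" "\<i> * of_real \<eta>"] m \<eta> by (simp add: norm_mult)
  have n2: "cmod (2 * of_nat n :: complex) = 2 * real n" by (simp add: norm_mult)
  have vk_up: "cmod (v 0 + \<kappa>) \<le> 2 * real n + 5"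
    unfolding vk using norm_triangle_ineq[of "2 * of_nat n" "(v 0 - of_nat n) - \<i> * of_real \<eta>"] small n2 by linarith
  have vk_lo: "2 * real n - 5 \<le> cmod (v 0 + \<kappa>)"
    unfolding vk using norm_diff_ineq[of "2 * of_nat n" "(v 0 - of_nat n) - \<i> * of_real \<eta>"] small n2 by linarith
  have g_up: "2 * cmod \<kappa> * cmod (g y) \<le> 2 * real n + 10 + 2 * (Y * Q)" if y: "y \<in> {0..b}" for y
  proof -
    have "2 * cmod \<kappa> * cmod (g y) = cmod (P \<kappa> y - exp (- 2 * \<kappa> * of_real y) * P (- \<kappa>) y)"
      unfolding rep[symmetric] by (simp add: norm_mult)
    also have "\<dots> \<le> cmod (P \<kappa> y) + cmod (exp (- 2 * \<kappa> * of_real y) * P (- \<kappa>) y)" by (rule norm_triangle_ineq4)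
    finally show ?thesis
      using norm_triangle_sub[of "P \<kappa> y" "v 0 + \<kappa>"] bd1[OF y] bd2[OF y] vk_up by linarith
  qed
  have Y3: "Y \<le> 3"
  proof -
    have "2 * real n * Y \<le> 2 * cmod \<kappa> * Y" using k1 Y by (intro mult_right_mono) auto
    also have "\<dots> \<le> 2 * real n + 10 + 2 * (Y * Q)" using g_up[OF x1(1)] by (simp add: Y_def)
    also have "2 * (Y * Q) \<le> Y * real n"
    proof -
      have "Y * (2 * Q) \<le> Y * real n" using n Q0 Y by (intro mult_left_mono) auto
      then show ?thesis by simp
    qed
    finally have "real n * Y \<le> 2 * real n + 10" by (simp add: mult.commute)
    also have "\<dots> \<le> real n * 3" using n Q0 by simp
    finally show ?thesis using n Q0 by simp
  qed
  have "2 * real n - 10 - 2 * (Y * Q) \<le> 2 * cmod \<kappa> * cmod (g x)"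
  proof -
    have "2 * cmod \<kappa> * cmod (g x) = cmod (P \<kappa> x - exp (- 2 * \<kappa> * of_real x) * P (- \<kappa>) x)"
      unfolding rep[symmetric] by (simp add: norm_mult)
    also have "\<dots> \<ge> cmod (P \<kappa> x) - cmod (exp (- 2 * \<kappa> * of_real x) * P (- \<kappa>) x)" by (rule norm_triangle_ineq2)
    finally show ?thesis
      using norm_triangle_sub[of "v 0 + \<kappa>" "P \<kappa> x"] bd1[OF x] bd2[OF x] vk_lo norm_minus_commute[of "P \<kappa> x" "v 0 + \<kappa>"] by linarith
  qed
  \<comment> \<open>The condition \<open>n \<ge> 11 + 6 * Q\<close> is made for this place: it turns
    \<open>2 * n - 10 - 6 * Q\<close> into at least \<open>n + 1\<close>.\<close>
  moreover have "Y * Q \<le> 3 * Q" using Y3 Q0 by (rule mult_right_mono)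
  ultimately have "real n + 1 \<le> 2 * cmod \<kappa> * cmod (g x)" using n by linarith
  also have "\<dots> \<le> 2 * (real n + 1) * cmod (g x)" using k1 by (intro mult_right_mono) auto
  finally have le: "real n + 1 \<le> 2 * (real n + 1) * cmod (g x)" .
  have "2 * (real n + 1) * cmod (g x) = (real n + 1) * (2 * cmod (g x))" by (simp add: algebra_simps)
  with le have "(real n + 1) * 1 \<le> (real n + 1) * (2 * cmod (g x))" by (simp only: mult_1_right)
  then have "1 \<le> 2 * cmod (g x)" by (rule mult_left_le_imp_le) simp
  then have "1 / 2 \<le> cmod (g x)" by simp
  also have "cmod (g x) = exp (- real n * x) * cmod (u x)" unfolding g_def norm_mult nexp ..
  finally have "exp (real n * x) * (1 / 2) \<le> exp (real n * x) * (exp (- real n * x) * cmod (u x))" by (rule mult_left_mono) simp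
  also have "\<dots> = cmod (u x)" by (simp add: mult.assoc[symmetric] exp_add[symmetric])
  finally show ?thesis by simp
qed

text \<open>Near its pole at \<open>-n\<close>, \<open>m\<close> is close to \<open>n\<close>, so that the solution grows like
  \<open>exp (n * x)\<close>; at the distance \<open>2 ^ (-10 * n)\<close> its mass on \<open>[0, 10]\<close> is too large.\<close>

lemma Mf_not_weyl:
  assumes q: "locally_integrable {0..} q"
    and m: "\<And>z b. Im z > 0 \<Longrightarrow> b \<ge> 0 \<Longrightarrow> Im z * mass (weyl q z (m z)) b \<le> Im (m z)"
    and M: "\<And>z. Im z > 0 \<Longrightarrow> m z = - Mf (\<i> * csqrt z)"
  shows False
proof -
  define Q where "Q = integral {0..10} (\<lambda>t. \<bar>q t\<bar>)"
  obtain n where n0: "11 + 6 * Q \<le> real n" using real_arch_simple by blast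
  have "Q \<ge> 0" unfolding Q_def by (cases "(\<lambda>t. \<bar>q t\<bar>) integrable_on {0..10}") (auto intro: integral_nonneg simp: not_integrable_integral)
  then have n: "n \<ge> 1" using n0 by (cases n) auto
  define \<eta> :: real where "\<eta> = (1/2) ^ (10 * n)"
  have \<eta>: "0 < \<eta>" "\<eta> \<le> 1" unfolding \<eta>_def by (auto intro: power_le_one)
  \<comment> \<open>\<open>w\<close> is the principal square root of \<open>z\<close>;
    \<open>\<i> * w\<close> is the point at height \<eta> above the pole \<open>- n\<close>, and
    \<kappa> is its negative.\<close>
  define w where "w = Complex \<eta> (real n)"
  define z where "z = w\<^sup>2"
  define \<kappa> where "\<kappa> = Complex (real n) (- \<eta>)"
  have cs: "csqrt z = w" unfolding z_def by (rule csqrt_square) (use \<eta> in \<open>simp add: w_def\<close>)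
  have Imz: "Im z = 2 * real n * \<eta>" by (simp add: z_def w_def power2_eq_square)
  then have z: "Im z > 0" using n \<eta> by simp
  have iw: "\<i> * w = Complex (- real n) \<eta>" by (simp add: w_def complex_eq_iff)
  have zk: "z = - \<kappa>\<^sup>2" by (simp add: z_def w_def \<kappa>_def power2_eq_square complex_eq_iff)
  have mz: "cmod (m z - of_nat n) \<le> 4"
    unfolding M[OF z] cs iw by (rule Mf_near_pole[OF n \<eta>_def refl])
  define u where "u = weyl q z (m z)"
  have s: "sol q (- \<kappa>\<^sup>2) u (weyl' q z (m z))" unfolding zk[symmetric] u_def by (rule weyl_sol(1)[OF q])
  have u0: "u 0 = 1" unfolding u_def by (rule weyl_sol(2)[OF q])
  have growth: "exp (real n * x) / 2 \<le> cmod (u x)" if "x \<in> {0..10}" for x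
    by (rule sol_growth[OF q s \<kappa>_def \<eta> u0 _ _ n0 that]) (use mz in \<open>simp_all add: weyl_sol(3)[OF q] Q_def\<close>)
  have cu: "continuous_on {0..10} u" by (rule sol_continuous(1)[OF s])
  have cu': "continuous_on {9..10} u" by (rule continuous_on_subset[OF cu]) auto
  have i9: "(\<lambda>t. (cmod (u t))\<^sup>2) integrable_on {9..10}"
    by (rule integrable_continuous_real) (intro continuous_intros cu')
  \<comment> \<open>Only \<open>[9, 10]\<close> is used, with 2 in place of \<open>exp 1\<close>.
    Multiplication by \<open>Im z = 2 * n * \<eta>\<close> will leave a factor
    \<open>2 ^ (8 * n)\<close>.\<close>
  have "2 ^ (18 * n) / 4 \<le> mass u 10"
  proof -
    have e: "(2::real) ^ (9 * n) \<le> exp (real n * x)" if "x \<ge> 9" for x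
    proof -
      have "(2::real) ^ (9 * n) \<le> exp 1 ^ (9 * n)" using exp_ge_add_one_self[of 1] by (intro power_mono) auto
      also have "\<dots> = exp (real (9 * n) * 1)" by (rule exp_of_nat_mult[symmetric])
      also have "\<dots> \<le> exp (real n * x)" using mult_left_mono[OF that, of "real n"] by simp
      finally show ?thesis .
    qed
    have "2 ^ (18 * n) / 4 = integral {9..10} (\<lambda>t::real. (2 ^ (9 * n) / 2)\<^sup>2 :: real)"
      by (simp add: power_divide power_mult[symmetric])
    also have "\<dots> \<le> integral {9..10} (\<lambda>t. (cmod (u t))\<^sup>2)"
    proof (rule integral_le[OF _ i9])
      fix t :: real assume t: "t \<in> {9..10}"
      have "2 ^ (9 * n) / 2 \<le> cmod (u t)" using e[of t] growth[of t] t by auto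
      then show "(2 ^ (9 * n) / 2)\<^sup>2 \<le> (cmod (u t))\<^sup>2" by (rule power_mono) simp
    qed (rule integrable_const_ivl)
    also have "\<dots> \<le> mass u 10"
      unfolding mass_def
      by (rule integral_subset_le[OF _ i9 has_integral_integrable[OF mass_has_integral[OF cu]]]) auto
    finally show ?thesis .
  qed
  then have "Im z * (2 ^ (18 * n) / 4) \<le> Im z * mass u 10" using z by simp
  also have "\<dots> \<le> Im (m z)" unfolding u_def by (rule m[OF z]) simp
  also have "\<dots> = Im (m z - of_nat n)" by simp
  also have "\<dots> \<le> 4" using abs_Im_le_cmod[of "m z - of_nat n"] mz by linarith
  also have "Im z * (2 ^ (18 * n) / 4) = real n / 2 * 2 ^ (8 * n)"
  proof -
    have "18 * n = 10 * n + 8 * n" by simp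
    then have "\<eta> * 2 ^ (18 * n) = 2 ^ (8 * n)"
      unfolding \<eta>_def by (simp only: power_add power_divide power_one) simp
    then show ?thesis unfolding Imz by (simp add: mult.assoc)
  qed
  finally have le4: "real n / 2 * 2 ^ (8 * n) \<le> 4" .
  have "(2::real) ^ 8 \<le> 2 ^ (8 * n)" using n by (intro power_increasing) auto
  then have "1 / 2 * 2 ^ 8 \<le> real n / 2 * (2::real) ^ (8 * n)" using n by (intro mult_mono) auto
  with le4 show False by simp
qed

section \<open>The limit point property of bounded potentials\<close>

text \<open>Integration by parts bounds the mass of \<open>v\<close> by a constant plus
  \<open>g b\<close>, where \<open>2 * g\<close> is the derivative of the square of
  \<open>cmod u\<close>. Were that mass too large, \<open>g\<close> would stay above 1, and
  \<open>u\<close> could not be square integrable.\<close>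

lemma sol_derivative_mass_bounded:
  assumes s: "sol q z u v" and C: "\<And>x. x \<ge> 0 \<Longrightarrow> \<bar>q x\<bar> \<le> C" and K: "\<And>b. b \<ge> 0 \<Longrightarrow> mass u b \<le> K"
  obtains D where "\<And>b. b \<ge> 0 \<Longrightarrow> mass v b \<le> D"
proof -
  have cu: "continuous_on {0..b} u" and cv: "continuous_on {0..b} v" for b
    using sol_continuous[OF s] by auto
  have "C \<ge> 0" using C[of 0] by simp
  define g where "g x = Re (cnj (u x) * v x)" for x
  define D where "D = (C + cmod z) * K - g 0"
  have le: "mass v b \<le> g b + D" if b: "b \<ge> 0" for b
  proof -
    have P: "primitive_on 0 b (\<lambda>t. cnj (v t) * v t + cnj (u t) * ((of_real (q t) - z) * u t)) (\<lambda>x. cnj (u x) * v x)"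
      by (rule primitive_on_mult[OF primitive_on_cnj[OF solD(1)[OF s]] solD(2)[OF s]])
    have "((\<lambda>t. Re (cnj (v t) * v t + cnj (u t) * ((of_real (q t) - z) * u t))) has_integral Re (cnj (u b) * v b - cnj (u 0) * v 0)) {0..b}"
      by (rule has_integral_Re[OF primitive_on_integral[OF P order_refl b order_refl]])
    from has_integral_add[OF this has_integral_mult_right[OF mass_has_integral[OF cu[of b]], of "C + cmod z"]]
    have "((\<lambda>t. Re (cnj (v t) * v t + cnj (u t) * ((of_real (q t) - z) * u t)) + (C + cmod z) * (cmod (u t))\<^sup>2) has_integral (g b - g 0 + (C + cmod z) * mass u b)) {0..b}"
      by (simp add: g_def)
    then have "mass v b \<le> g b - g 0 + (C + cmod z) * mass u b"
    proof (rule has_integral_le[OF mass_has_integral[OF cv]])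
      fix t assume t: "t \<in> {0..b}"
      have e: "Re (cnj (v t) * v t + cnj (u t) * ((of_real (q t) - z) * u t)) = (cmod (v t))\<^sup>2 + (q t - Re z) * (cmod (u t))\<^sup>2"
        unfolding cmod_power2 by (simp add: power2_eq_square algebra_simps)
      have "0 \<le> (q t - Re z + (C + cmod z)) * (cmod (u t))\<^sup>2"
        using C[of t] t abs_Re_le_cmod[of z] by (intro mult_nonneg_nonneg) auto
      then show "(cmod (v t))\<^sup>2 \<le> Re (cnj (v t) * v t + cnj (u t) * ((of_real (q t) - z) * u t)) + (C + cmod z) * (cmod (u t))\<^sup>2"
        unfolding e by (simp add: algebra_simps)
    qed
    moreover have "(C + cmod z) * mass u b \<le> (C + cmod z) * K" using K[OF b] \<open>C \<ge> 0\<close> by (intro mult_left_mono) auto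
    ultimately show ?thesis by (simp add: D_def)
  qed
  have "mass v b \<le> D + 1" if b: "b \<ge> 0" for b
  proof (rule ccontr)
    assume "\<not> mass v b \<le> D + 1"
    then have g1: "g x \<ge> 1" if "x \<ge> b" for x
      using mass_mono[OF cv b that] le[of x] b that by linarith
    have u2: "2 * (x - b) \<le> (cmod (u x))\<^sup>2" if x: "x \<ge> b" for x
    proof -
      have P: "primitive_on 0 x (\<lambda>t. cnj (v t) * u t + cnj (u t) * v t) (\<lambda>x. cnj (u x) * u x)"
        by (rule primitive_on_mult[OF primitive_on_cnj[OF solD(1)[OF s]] solD(1)[OF s]])
      have "((\<lambda>t. Re (cnj (v t) * u t + cnj (u t) * v t)) has_integral Re (cnj (u x) * u x - cnj (u b) * u b)) {b..x}"
        by (rule has_integral_Re[OF primitive_on_integral[OF P b x order_refl]])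
      then have "2 * (x - b) \<le> Re (cnj (u x) * u x - cnj (u b) * u b)"
      proof (rule has_integral_le[rotated])
        show "((\<lambda>t. 2) has_integral 2 * (x - b)) {b..x}"
          using has_integral_const_real[of "2::real" b x] x by (simp add: mult.commute)
        show "2 \<le> Re (cnj (v t) * u t + cnj (u t) * v t)" if "t \<in> {b..x}" for t
          using g1[of t] that by (simp add: g_def algebra_simps)
      qed
      also have "\<dots> = (cmod (u x))\<^sup>2 - (cmod (u b))\<^sup>2" unfolding cmod_power2 by (simp add: power2_eq_square)
      finally show ?thesis using zero_le_power2[of "cmod (u b)"] by linarith
    qed
    have "mass u 0 \<le> K" using K[of 0] by simp
    then have K0: "K \<ge> 0" using mass_nonneg[OF cu[of 0]] by linarith
    define T where "T = b + 1 + K"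
    have "2 * K = integral {b + 1..T} (\<lambda>t::real. 2::real)" using K0 by (simp add: T_def)
    also have "\<dots> \<le> integral {b + 1..T} (\<lambda>t. (cmod (u t))\<^sup>2)"
    proof (rule integral_le)
      have "continuous_on {b + 1..T} u" by (rule continuous_on_subset[OF cu[of T]]) (use b in auto)
      then show "(\<lambda>t. (cmod (u t))\<^sup>2) integrable_on {b + 1..T}"
        by (intro integrable_continuous_real continuous_intros)
      show "2 \<le> (cmod (u t))\<^sup>2" if "t \<in> {b + 1..T}" for t using u2[of t] that by auto
    qed (rule integrable_const_ivl)
    also have "\<dots> \<le> mass u T"
      unfolding mass_def
    proof (rule integral_subset_le[OF _ _ has_integral_integrable[OF mass_has_integral[OF cu]]])
      have "continuous_on {b + 1..T} u" by (rule continuous_on_subset[OF cu[of T]]) (use b in auto)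
      then show "(\<lambda>t. (cmod (u t))\<^sup>2) integrable_on {b + 1..T}"
        by (intro integrable_continuous_real continuous_intros)
    qed (use b in auto)
    also have "\<dots> \<le> K" using K[of T] b K0 by (simp add: T_def)
    \<comment> \<open>An interval of length \<open>K\<close> gives no contradiction if
      \<open>K = 0\<close>; one of length 1 does.\<close>
    finally have "K = 0" using K0 by simp
    have "(2::real) \<le> mass u (b + 2)"
    proof -
      have c: "continuous_on {b + 1..b + 2} u" by (rule continuous_on_subset[OF cu[of "b + 2"]]) (use b in auto)
      have i: "(\<lambda>t. (cmod (u t))\<^sup>2) integrable_on {b + 1..b + 2}"
        by (intro integrable_continuous_real continuous_intros c)
      have "2 = integral {b + 1..b + 2} (\<lambda>t::real. 2::real)" by simp
      also have "\<dots> \<le> integral {b + 1..b + 2} (\<lambda>t. (cmod (u t))\<^sup>2)"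
      proof (rule integral_le[OF integrable_const_ivl i])
        show "2 \<le> (cmod (u t))\<^sup>2" if "t \<in> {b + 1..b + 2}" for t using u2[of t] that by auto
      qed
      also have "\<dots> \<le> mass u (b + 2)"
        unfolding mass_def
        by (rule integral_subset_le[OF _ i has_integral_integrable[OF mass_has_integral[OF cu]]]) (use b in auto)
      finally show ?thesis .
    qed
    with K[of "b + 2"] b \<open>K = 0\<close> show False by simp
  qed
  then show ?thesis using that by blast
qed

text \<open>If all solutions were square integrable, so would be their derivatives, and the
  Wronskian, a nonzero constant, would be integrable on the half line.\<close>

lemma bounded_potential_limit_point:
  assumes q: "locally_integrable {0..} q" and C: "\<And>x. x \<ge> 0 \<Longrightarrow> \<bar>q x\<bar> \<le> C"
  shows "limit_point_at_top {0..} q"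
  unfolding limit_point_at_top_def
proof (intro notI, elim exE)
  fix z assume all: "\<forall>f f'. schroedinger_solution {0..} q z (f, f') \<longrightarrow> sq_integrable_at_top f"
  note V = vsol[OF q, where z = z]
  define \<theta> \<theta>' \<phi> \<phi>' where "\<theta> = theta q z" and "\<theta>' = snd (vsol q z 1 0)" and "\<phi> = phi q z" and "\<phi>' = snd (vsol q z 0 1)"
  have s: "sol q z \<theta> \<theta>'" "sol q z \<phi> \<phi>'" unfolding \<theta>_def \<theta>'_def \<phi>_def \<phi>'_def by (rule V(1))+
  have i: "\<theta> 0 = 1" "\<theta>' 0 = 0" "\<phi> 0 = 0" "\<phi>' 0 = 1" unfolding \<theta>_def \<theta>'_def \<phi>_def \<phi>'_def V by simp_all
  note c = sol_continuous[OF s(1)] sol_continuous[OF s(2)]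
  have "sq_integrable_at_top \<theta>" "sq_integrable_at_top \<phi>"
    using all s schroedinger_solution_half_iff[OF q] by blast+
  then obtain K1 K2 where K: "\<And>b. b \<ge> 0 \<Longrightarrow> mass \<theta> b \<le> K1" "\<And>b. b \<ge> 0 \<Longrightarrow> mass \<phi> b \<le> K2"
    unfolding sq_integrable_at_top_iff_mass_bounded[OF c(1)] sq_integrable_at_top_iff_mass_bounded[OF c(3)] by blast
  obtain D1 where D1: "\<And>b. b \<ge> 0 \<Longrightarrow> mass \<theta>' b \<le> D1" using sol_derivative_mass_bounded[OF s(1) C K(1)] by blast
  obtain D2 where D2: "\<And>b. b \<ge> 0 \<Longrightarrow> mass \<phi>' b \<le> D2" using sol_derivative_mass_bounded[OF s(2) C K(2)] by blast
  have le: "2 * b \<le> (K1 + D2) + (K2 + D1)" if b: "b \<ge> 0" for b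
  proof -
    have A: "((\<lambda>t. ((cmod (\<theta> t))\<^sup>2 + (cmod (\<phi>' t))\<^sup>2) + ((cmod (\<phi> t))\<^sup>2 + (cmod (\<theta>' t))\<^sup>2)) has_integral
       ((mass \<theta> b + mass \<phi>' b) + (mass \<phi> b + mass \<theta>' b))) {0..b}"
      by (intro has_integral_add mass_has_integral c)
    have B: "((\<lambda>t. 2) has_integral 2 * b) {0..b}"
      using has_integral_const_real[of "2::real" 0 b] b by (simp add: mult.commute)
    have "2 * b \<le> (mass \<theta> b + mass \<phi>' b) + (mass \<phi> b + mass \<theta>' b)"
    proof (rule has_integral_le[OF B A])
      fix t assume t: "t \<in> {0..b}"
      have "\<theta>' t * \<phi> t - \<theta> t * \<phi>' t = - 1"
        using sol_wronskian_const[OF s, of t] t i by simp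
      define A B where "A = cmod (\<theta>' t) * cmod (\<phi> t)" and "B = cmod (\<theta> t) * cmod (\<phi>' t)"
      have "1 \<le> A + B"
        using norm_triangle_ineq4[of "\<theta>' t * \<phi> t" "\<theta> t * \<phi>' t"] \<open>\<theta>' t * \<phi> t - \<theta> t * \<phi>' t = - 1\<close>
        by (simp add: norm_mult A_def B_def)
      moreover have am: "2 * (x * y) \<le> x\<^sup>2 + y\<^sup>2" for x y :: real
        using zero_le_power2[of "x - y"] by (simp add: power2_eq_square algebra_simps)
      have "2 * A \<le> (cmod (\<theta>' t))\<^sup>2 + (cmod (\<phi> t))\<^sup>2" "2 * B \<le> (cmod (\<theta> t))\<^sup>2 + (cmod (\<phi>' t))\<^sup>2"
        unfolding A_def B_def by (rule am)+
      ultimately show "2 \<le> ((cmod (\<theta> t))\<^sup>2 + (cmod (\<phi>' t))\<^sup>2) + ((cmod (\<phi> t))\<^sup>2 + (cmod (\<theta>' t))\<^sup>2)" by linarith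
    qed
    then show ?thesis using K[OF b] D1[OF b] D2[OF b] by linarith
  qed
  define R where "R = (K1 + D2) + (K2 + D1)"
  have "2 * (\<bar>R\<bar> + 1) \<le> R" unfolding R_def by (rule le) simp
  then show False by (cases "R \<ge> 0") auto
qed

lemma locally_integrableI:
  assumes "\<And>b. q absolutely_integrable_on {0..b}"
  shows "locally_integrable {0..} q"
  unfolding locally_integrable_def
proof (intro allI impI)
  fix K :: "real set" assume K: "compact K \<and> K \<subseteq> {0..}"
  then obtain B where B: "\<And>x. x \<in> K \<Longrightarrow> \<bar>x\<bar> \<le> B"
    using compact_imp_bounded[of K] unfolding bounded_iff by auto
  have "K \<in> sets lebesgue" using K by (simp add: borel_compact lmeasurable_compact fmeasurableD)
  moreover have "K \<subseteq> {0..B}" using K B by fastforce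
  ultimately show "q absolutely_integrable_on K"
    using set_integrable_subset[OF assms[of B]] by blast
qed

lemma Vp_continuous: "continuous_on {0..b} Vp"
proof -
  have "1 - qf x \<noteq> 0" if "x \<in> {0..b}" for x using qf_bounds[of x] that by auto
  then show ?thesis unfolding Vp_def qf_def by (intro continuous_intros) auto
qed

lemma Vp_locally_integrable: "locally_integrable {0..} Vp"
  by (rule locally_integrableI) (rule absolutely_integrable_continuous_real[OF Vp_continuous])

lemma Vp_limit_point: "limit_point_at_top {0..} Vp"
proof (rule bounded_potential_limit_point[OF Vp_locally_integrable])
  fix x :: real assume x: "x \<ge> 0"
  have "(15/16)\<^sup>2 \<le> (1 - qf x)\<^sup>2" using qf_bounds[of x] x by (intro power_mono) auto
  then have "(1/2::real) \<le> (1 - qf x)\<^sup>2" by (simp add: power2_eq_square)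
  then have "qf x / (1 - qf x)\<^sup>2 \<le> (1/16) / (1/2)" using qf_bounds[of x] x by (intro frac_le) auto
  also have "\<dots> \<le> 1" by simp
  finally have le: "qf x / (1 - qf x)\<^sup>2 \<le> 1" .
  have "\<bar>Vp x\<bar> = qf x / (1 - qf x)\<^sup>2" using qf_bounds(1)[of x] by (simp add: Vp_def abs_divide)
  with le show "\<bar>Vp x\<bar> \<le> 1" by simp
qed

lemma jost_sol:
  assumes k: "Im k \<noteq> 0"
  shows "sol Vp (- k\<^sup>2) (jost k) (jost' k)"
proof -
  have "schroedinger_solution {0..} Vp (- k\<^sup>2) (jost k, jost' k)"
    unfolding schroedinger_solution_def prod.case
  proof (intro conjI ballI impI)
    fix x :: real assume "x \<in> {0..}"
    then show "(jost k has_vector_derivative jost' k x) (at x within {0..})"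
      by (intro has_vector_derivative_at_within[OF jost_deriv[OF k]]) simp
    fix y :: real assume "x \<le> y"
    have "((\<lambda>t. (complex_of_real (Vp t) + k\<^sup>2) * jost k t) has_integral jost' k y - jost' k x) {x..y}"
      by (rule fundamental_theorem_of_calculus[OF \<open>x \<le> y\<close>])
         (use \<open>x \<in> {0..}\<close> in \<open>auto intro!: has_vector_derivative_at_within[OF jost'_deriv[OF k]]\<close>)
    then show "((\<lambda>t. (complex_of_real (Vp t) - - k\<^sup>2) * jost k t) has_integral jost' k y - jost' k x) {x..y}"
      by simp
  qed
  then show ?thesis using schroedinger_solution_half_iff[OF Vp_locally_integrable] by blast
qed

lemma jost_square_integrable:
  assumes k: "Im k \<noteq> 0" "Re k > 0"
  shows "sq_integrable_at_top (jost k)"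
proof -
  have cj: "continuous_on {0..b} (jost k)" for b by (rule sol_continuous(1)[OF jost_sol[OF k(1)]])
  obtain N where N: "cmod k \<le> real N" using real_arch_simple by blast
  define B where "B = (\<Sum>j. 4 * (1 + 1 / \<bar>Im k\<bar>) ^ N * (3/16) ^ j)"
  have sB: "summable (\<lambda>j. 4 * (1 + 1 / \<bar>Im k\<bar>) ^ N * (3/16::real) ^ j)"
    by (intro summable_mult summable_geometric) simp
  have jle: "(cmod (jost k x))\<^sup>2 \<le> B\<^sup>2 * exp (- (2 * Re k) * x)" if x: "x \<ge> 0" for x
  proof -
    have "cmod (ser 0 k (of_real (qf x))) \<le> B"
      unfolding ser_def B_def
    proof (rule norm_suminf_le[OF _ sB])
      fix j
      have "cmod (of_nat j ^ 0 * cf k j * of_real (qf x) ^ j) \<le> 4 * (1 + 1 / \<bar>Im k\<bar>) ^ N * (3 * cmod (of_real (qf x))) ^ j"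
        by (rule norm_ser_term_le) (use k N in auto)
      also have "\<dots> \<le> 4 * (1 + 1 / \<bar>Im k\<bar>) ^ N * (3/16) ^ j"
        using qf_bounds[of x] x by (intro mult_left_mono power_mono) auto
      finally show "cmod (of_nat j ^ 0 * cf k j * of_real (qf x) ^ j) \<le> 4 * (1 + 1 / \<bar>Im k\<bar>) ^ N * (3/16) ^ j" .
    qed
    moreover have "cmod (of_real (rf x)) \<le> 1" using rf_pos[OF x] qf_bounds(1)[of x] by (simp add: rf_def)
    ultimately have "cmod (of_real (rf x)) * cmod (ser 0 k (of_real (qf x))) \<le> 1 * B" by (intro mult_mono) auto
    then have "cmod (jost k x) \<le> exp (- Re k * x) * B"
      by (simp add: jost_def norm_mult norm_exp_eq_Re)
    then have "(cmod (jost k x))\<^sup>2 \<le> (exp (- Re k * x) * B)\<^sup>2" by (rule power_mono) simp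
    also have "\<dots> = B\<^sup>2 * exp (- (2 * Re k) * x)"
      by (simp add: power2_eq_square exp_add[symmetric] algebra_simps)
    finally show ?thesis .
  qed
  have "mass (jost k) b \<le> B\<^sup>2 / (2 * Re k)" if b: "b \<ge> 0" for b
  proof -
    define h where "h x = - B\<^sup>2 / (2 * Re k) * exp (- (2 * Re k) * x)" for x
    have "((\<lambda>x. B\<^sup>2 * exp (- (2 * Re k) * x)) has_integral (h b - h 0)) {0..b}"
    proof (rule fundamental_theorem_of_calculus[OF b])
      fix x
      show "(h has_vector_derivative B\<^sup>2 * exp (- (2 * Re k) * x)) (at x within {0..b})"
        unfolding h_def has_real_derivative_iff_has_vector_derivative[symmetric]
        using k(2) by (auto intro!: derivative_eq_intros)
    qed
    then have "mass (jost k) b \<le> h b - h 0"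
      by (rule has_integral_le[OF mass_has_integral[OF cj]]) (use jle in auto)
    also have "\<dots> \<le> B\<^sup>2 / (2 * Re k)" using k(2) by (simp add: h_def)
    finally show ?thesis .
  qed
  then show ?thesis unfolding sq_integrable_at_top_iff_mass_bounded[OF cj] by blast
qed

lemma jost_zero:
  assumes k: "Im k \<noteq> 0"
  shows "jost k 0 \<noteq> 0" "jost' k 0 = Mf k * jost k 0"
proof -
  have q0: "qf 0 = 1/16" by (simp add: qf_def)
  define r F G where "r = complex_of_real (rf 0)" and "F = ser 0 k (1/16)" and "G = ser 1 k (1/16)"
  have r0: "r \<noteq> 0" using rf_pos[of 0] by (simp add: r_def)
  have "rf 0 * rf 0 = 15/16" using rf_square[of 0] by (simp add: q0 power2_eq_square)
  then have "r * r = of_real (15/16)" unfolding r_def of_real_mult[symmetric] by (rule arg_cong)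
  then have rr: "r * r = 15/16" by simp
  have F: "F \<noteq> 0" unfolding F_def by (rule ser_nonzero[OF k])
  have e1: "jost k 0 = r * F" by (simp add: jost_def q0 r_def F_def)
  have e2: "jost' k 0 = - k * r * F + (1/16) / r * F - 2 * r * G" by (simp add: jost'_def q0 r_def F_def G_def)
  show "jost k 0 \<noteq> 0" using r0 F by (simp add: e1)
  have "r * ((16/15) * r) = (16/15) * (r * r)" by (rule mult.left_commute)
  also have "\<dots> = 1" unfolding rr by simp
  finally have "inverse r = (16/15) * r" by (rule inverse_unique)
  then have r16: "(1/16) / r = (1/15) * r" unfolding divide_inverse[of "1/16" r] by simp
  have "(- k + 1/15 - 2 * (G / F)) * (r * F) = - k * r * F + (1/15) * r * F - 2 * r * (G / F * F)"
    by (simp add: algebra_simps)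
  also have "G / F * F = G" using F by simp
  finally show "jost' k 0 = Mf k * jost k 0"
    unfolding e1 e2 Mf_def F_def[symmetric] G_def[symmetric] r16 by simp
qed

section \<open>Whole line Schroedinger operators\<close>

lemma has_vector_derivative_within_Un:
  assumes "(f has_vector_derivative D) (at x within S)" "(f has_vector_derivative D) (at x within T)"
  shows "(f has_vector_derivative D) (at x within (S \<union> T))"
  using assms unfolding has_vector_derivative_def has_derivative_within
  by (auto simp: at_within_union intro: filterlim_sup)

lemma schroedinger_solution_restrict:
  assumes "schroedinger_solution UNIV W z (f, f')"
  shows "schroedinger_solution {0..} W z (f, f')"
  using assms unfolding schroedinger_solution_def prod.case
  by (blast intro: has_vector_derivative_within_subset)

lemma schroedinger_solution_reflect:
  assumes "schroedinger_solution UNIV W z (f, f')"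
  shows "schroedinger_solution {0..} (\<lambda>x. W (- x)) z (\<lambda>x. f (- x), \<lambda>x. - f' (- x))"
  unfolding schroedinger_solution_def prod.case
proof (intro conjI ballI impI)
  have d: "\<And>x. (f has_vector_derivative f' x) (at x)"
    and i: "\<And>x y. x \<le> y \<Longrightarrow> ((\<lambda>t. (of_real (W t) - z) * f t) has_integral (f' y - f' x)) {x..y}"
    using assms by (auto simp: schroedinger_solution_def)
  fix x :: real
  have "(uminus has_vector_derivative (-1)) (at x within {0..})"
    by (auto intro!: derivative_eq_intros)
  from vector_diff_chain_within[OF this has_vector_derivative_at_within[OF d]]
  show "((\<lambda>x. f (- x)) has_vector_derivative - f' (- x)) (at x within {0..})" by (simp add: o_def)
  fix y :: real assume "x \<le> y"
  then have "((\<lambda>t. (of_real (W t) - z) * f t) has_integral (f' (- x) - f' (- y))) {- y..- x}" by (intro i) simp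
  then have "((\<lambda>t. (of_real (W (- t)) - z) * f (- t)) has_integral (f' (- x) - f' (- y))) {- (- x)..- (- y)}"
    by (subst has_integral_reflect_real) simp
  then show "((\<lambda>t. (of_real (W (- t)) - z) * f (- t)) has_integral (- f' (- y) - - f' (- x))) {x..y}" by simp
qed

text \<open>The sign in \<open>v 0 = - g 0\<close> comes from the reflection of the left half. In
  this way solutions on the line are built from half line ones.\<close>

lemma schroedinger_solution_glue:
  assumes r: "schroedinger_solution {0..} W z (f, g)"
    and l: "schroedinger_solution {0..} (\<lambda>x. W (- x)) z (u, v)"
    and 0: "u 0 = f 0" "v 0 = - g 0"
  shows "schroedinger_solution UNIV W z (\<lambda>x. if x \<ge> 0 then f x else u (- x), \<lambda>x. if x \<ge> 0 then g x else - v (- x))"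
proof -
  define F G where "F x = (if x \<ge> 0 then f x else u (- x))" and "G x = (if x \<ge> 0 then g x else - v (- x))" for x
  have Fl: "F x = u (- x)" "G x = - v (- x)" if "x \<le> 0" for x
    using that 0 by (auto simp: F_def G_def)
  have Fr: "F x = f x" "G x = g x" if "x \<ge> 0" for x using that by (auto simp: F_def G_def)
  have rd: "(f has_vector_derivative g x) (at x within {0..})" if "x \<ge> 0" for x
    using r that by (auto simp: schroedinger_solution_def)
  have ld: "(u has_vector_derivative v x) (at x within {0..})" if "x \<ge> 0" for x
    using l that by (auto simp: schroedinger_solution_def)
  have ri: "((\<lambda>t. (of_real (W t) - z) * f t) has_integral (g y - g x)) {x..y}" if "0 \<le> x" "x \<le> y" for x y
    using r that by (auto simp: schroedinger_solution_def)
  have li: "((\<lambda>t. (of_real (W (- t)) - z) * u t) has_integral (v y - v x)) {x..y}" if "0 \<le> x" "x \<le> y" for x y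
    using l that by (auto simp: schroedinger_solution_def)
  have Rd: "(F has_vector_derivative G x) (at x within {0..})" if "x \<ge> 0" for x
    by (rule has_vector_derivative_transform[OF _ _ rd[OF that, folded Fr(2)[OF that]]]) (use that Fr in auto)
  have Ld: "(F has_vector_derivative G x) (at x within {..0})" if "x \<le> 0" for x
  proof -
    have "(uminus has_vector_derivative (-1)) (at x within {..0})"
      by (auto intro!: derivative_eq_intros)
    moreover have "(u has_vector_derivative v (- x)) (at (- x) within (uminus ` {..0}))"
      using ld[of "- x"] that by simp
    ultimately have "((u \<circ> uminus) has_vector_derivative (-1) *\<^sub>R v (- x)) (at x within {..0})"
      by (rule vector_diff_chain_within)
    then have "((\<lambda>y. u (- y)) has_vector_derivative G x) (at x within {..0})"
      using Fl[OF that] by (simp add: o_def)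
    from has_vector_derivative_transform[OF _ _ this] show ?thesis using that Fl by auto
  qed
  have D: "(F has_vector_derivative G x) (at x within UNIV)" for x
  proof -
    consider "x > 0" | "x < 0" | "x = 0" by linarith
    then show ?thesis
    proof cases
      case 1
      have "at x within {0..} = at x within UNIV" by (rule at_within_nhd[of _ "{0<..}"]) (use 1 in auto)
      then show ?thesis using Rd[of x] 1 by simp
    next
      case 2
      have "at x within {..0} = at x within UNIV" by (rule at_within_nhd[of _ "{..<0}"]) (use 2 in auto)
      then show ?thesis using Ld[of x] 2 by simp
    next
      case 3
      have "(F has_vector_derivative G x) (at x within ({0..} \<union> {..0}))"
        by (rule has_vector_derivative_within_Un[OF Rd Ld]) (use 3 in auto)
      moreover have "{0..} \<union> {..0::real} = UNIV" by auto
      ultimately show ?thesis by simp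
    qed
  qed
  have Ri: "((\<lambda>t. (of_real (W t) - z) * F t) has_integral (G y - G x)) {x..y}" if "0 \<le> x" "x \<le> y" for x y
    using has_integral_eq[of "{x..y}", OF _ ri[OF that]] that by (simp add: Fr)
  have Li: "((\<lambda>t. (of_real (W t) - z) * F t) has_integral (G y - G x)) {x..y}" if "x \<le> y" "y \<le> 0" for x y
  proof -
    have "((\<lambda>t. (of_real (W (- t)) - z) * u t) has_integral (v (- x) - v (- y))) {- y..- x}"
      by (rule li) (use that in auto)
    then have "((\<lambda>t. (of_real (W (- (- t))) - z) * u (- t)) has_integral (v (- x) - v (- y))) {- (- x)..- (- y)}"
      by (subst has_integral_reflect_real) simp
    then have h: "((\<lambda>t. (of_real (W t) - z) * u (- t)) has_integral (G y - G x)) {x..y}"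
      using Fl that by simp
    show ?thesis by (rule has_integral_eq[OF _ h]) (use that Fl in auto)
  qed
  have I: "((\<lambda>t. (of_real (W t) - z) * F t) has_integral (G y - G x)) {x..y}" if "x \<le> y" for x y
  proof -
    consider "0 \<le> x" | "y \<le> 0" | "x \<le> 0" "0 \<le> y" by linarith
    then show ?thesis
    proof cases
      case 3
      from has_integral_combine[OF 3 Li[OF 3(1) order_refl] Ri[OF order_refl 3(2)]] show ?thesis by simp
    qed (use Ri Li that in auto)
  qed
  have "schroedinger_solution UNIV W z (F, G)"
    using D I by (simp add: schroedinger_solution_def)
  then show ?thesis unfolding F_def[abs_def] G_def[abs_def] .
qed

lemma schroedinger_solution_AE_cong:
  assumes ae: "AE x in lebesgue. x > 0 \<longrightarrow> W x = V x" and s: "schroedinger_solution {0..} W z (f, f')"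
  shows "schroedinger_solution {0..} V z (f, f')"
proof -
  have neg: "negligible ({x. x > 0 \<and> W x \<noteq> V x} \<union> {0})"
  proof -
    obtain N where N: "N \<in> null_sets lebesgue" "{x. x > 0 \<and> W x \<noteq> V x} \<subseteq> N"
      using ae by (auto simp: eventually_ae_filter subset_iff)
    then have "negligible {x. x > 0 \<and> W x \<noteq> V x}"
      using negligible_iff_null_sets negligible_subset by blast
    then show ?thesis by simp
  qed
  have "((\<lambda>t. (of_real (V t) - z) * f t) has_integral (f' y - f' x)) {x..y}" if "0 \<le> x" "x \<le> y" for x y
  proof (rule has_integral_spike[OF neg])
    show "((\<lambda>t. (of_real (W t) - z) * f t) has_integral (f' y - f' x)) {x..y}"
      using s that by (auto simp: schroedinger_solution_def)
  qed (use that in auto)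
  then show ?thesis using s by (auto simp: schroedinger_solution_def)
qed

lemma sq_integrable_at_bot_iff_mass_bounded:
  assumes u: "\<And>b. continuous_on {0..b} (\<lambda>x. f (- x))"
  shows "sq_integrable_at_bot f \<longleftrightarrow> (\<exists>C. \<forall>b\<ge>0. mass (\<lambda>x. f (- x)) b \<le> C)"
proof -
  define g where "g = (\<lambda>t. (cmod (f t))\<^sup>2)"
  have gi: "(g has_integral mass (\<lambda>x. f (- x)) b) {- b..0}" for b
  proof -
    have "((\<lambda>x. g (- x)) has_integral mass (\<lambda>x. f (- x)) b) {- 0..- (- b)}"
      using mass_has_integral[OF u[of b]] by (simp add: g_def)
    then show ?thesis by (subst (asm) has_integral_reflect_real)
  qed
  show ?thesis
  proof
    assume "sq_integrable_at_bot f"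
    then have "g integrable_on {..0}" by (simp add: sq_integrable_at_bot_def absolutely_integrable_on_def g_def)
    then have "mass (\<lambda>x. f (- x)) b \<le> integral {..0} g" for b
      unfolding integral_unique[OF gi[of b], symmetric]
      by (intro integral_subset_le has_integral_integrable[OF gi]) (auto simp: g_def)
    then show "\<exists>C. \<forall>b\<ge>0. mass (\<lambda>x. f (- x)) b \<le> C" by blast
  next
    assume "\<exists>C. \<forall>b\<ge>0. mass (\<lambda>x. f (- x)) b \<le> C"
    then obtain C where C: "\<And>b. b \<ge> 0 \<Longrightarrow> mass (\<lambda>x. f (- x)) b \<le> C" by blast
    define h where "h k t = (if t \<in> {- real k..0} then g t else 0)" for k t
    have hi: "(h k has_integral mass (\<lambda>x. f (- x)) (real k)) {..0}" for k
      unfolding h_def by (rule has_integral_restrict[THEN iffD2]) (use gi in auto)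
    have "g integrable_on {..0}"
    proof (rule conjunct1[OF monotone_convergence_increasing[of h]])
      show "h k integrable_on {..0}" for k using hi by (rule has_integral_integrable)
      show "h k x \<le> h (Suc k) x" for k x by (auto simp: h_def g_def)
      show "(\<lambda>k. h k x) \<longlonglongrightarrow> g x" if "x \<in> {..0}" for x
      proof (rule tendsto_eventually, rule eventually_sequentiallyI[of "nat \<lceil>- x\<rceil>"])
        fix k assume "nat \<lceil>- x\<rceil> \<le> k"
        then have "- real k \<le> x" by linarith
        then show "h k x = g x" using that by (simp add: h_def)
      qed
      have "integral {..0} (h k) = mass (\<lambda>x. f (- x)) (real k)" for k using hi by (rule integral_unique)
      then show "bounded (range (\<lambda>k. integral {..0} (h k)))"
        unfolding bounded_iff using C mass_nonneg[OF u] by (intro exI[of _ C]) auto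
    qed
    then show "sq_integrable_at_bot f"
      unfolding sq_integrable_at_bot_def g_def by (intro nonnegative_absolutely_integrable_1) auto
  qed
qed

lemma sq_integrable_reflect:
  assumes "\<And>b. continuous_on {0..b} (\<lambda>x. f (- x))"
  shows "sq_integrable_at_bot f \<longleftrightarrow> sq_integrable_at_top (\<lambda>x. f (- x))"
  unfolding sq_integrable_at_bot_iff_mass_bounded[OF assms] sq_integrable_at_top_iff_mass_bounded[OF assms] ..

lemma locally_integrable_halves:
  assumes "locally_integrable UNIV W"
  shows "locally_integrable {0..} W" "locally_integrable {0..} (\<lambda>x. W (- x))"
proof -
  show "locally_integrable {0..} W" using assms by (auto simp: locally_integrable_def)
  show "locally_integrable {0..} (\<lambda>x. W (- x))"
  proof (rule locally_integrableI)
    fix b :: real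
    have "W absolutely_integrable_on {- b..0}" using assms by (auto simp: locally_integrable_def)
    then show "(\<lambda>x. W (- x)) absolutely_integrable_on {0..b}"
      using absolutely_integrable_reflect_real[where f = W and a = "- b" and b = 0] by simp
  qed
qed

section \<open>The m functions of the potential and of its extensions\<close>

text \<open>By the Wronskian, whatever \<open>SOME\<close> picks is proportional to the explicit
  solution \<open>e\<close>.\<close>

lemma half_line_m_unique:
  assumes q: "locally_integrable {0..} q" and lp: "limit_point_at_top {0..} q"
    and e: "sol q z e e'" "sq_integrable_at_top e" "e 0 \<noteq> 0" "e' 0 = m * e 0"
    and f: "sol q z f f'" "sq_integrable_at_top f" and ne: "f 0 \<noteq> 0 \<or> f' 0 \<noteq> 0"
  shows "f' 0 / f 0 = m"
proof -
  have "e 0 * f' 0 = e' 0 * f 0" by (rule limit_point_wronskian[OF q lp e(1,2) f, symmetric])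
  also have "\<dots> = e 0 * (m * f 0)" by (simp add: e(4))
  finally have f': "f' 0 = m * f 0" using e(3) by (simp only: mult_left_cancel simp_thms)
  then have "f 0 \<noteq> 0" using ne by auto
  with f' show ?thesis by simp
qed

lemma neg_ii_csqrt:
  assumes "Im z > 0"
  shows "Im (- \<i> * csqrt z) < 0" "Re (- \<i> * csqrt z) > 0" "- (- \<i> * csqrt z)\<^sup>2 = z"
proof -
  show "Im (- \<i> * csqrt z) < 0" "Re (- \<i> * csqrt z) > 0"
    using csqrt_upper[OF assms] by auto
  have "- (- \<i> * csqrt z)\<^sup>2 = (csqrt z)\<^sup>2" by (simp only: power_mult_distrib) simp
  then show "- (- \<i> * csqrt z)\<^sup>2 = z" by (simp only: power2_csqrt)
qed

text \<open>\<open>k = - \<i> * csqrt z\<close> is the solution of \<open>- k\<^sup>2 = z\<close>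
  with positive real part, whose Jost solution decays.\<close>

lemma jost_csqrt:
  assumes "Im z > 0"
  defines "k \<equiv> - \<i> * csqrt z"
  shows "sol Vp z (jost k) (jost' k)" "sq_integrable_at_top (jost k)" "jost k 0 \<noteq> 0" "jost' k 0 = Mf k * jost k 0"
proof -
  have k: "Im k \<noteq> 0" "Re k > 0" "- k\<^sup>2 = z" using neg_ii_csqrt[OF assms(1)] by (auto simp: k_def)
  show "sol Vp z (jost k) (jost' k)" using jost_sol[OF k(1)] k(3) by simp
  show "sq_integrable_at_top (jost k)" "jost k 0 \<noteq> 0" "jost' k 0 = Mf k * jost k 0"
    using jost_square_integrable[OF k(1,2)] jost_zero[OF k(1)] by auto
qed

lemma half_schroedinger_m_Vp:
  assumes z: "Im z > 0"
  shows "schroedinger_m_plus {0..} Vp z = Mf (- \<i> * csqrt z)"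
proof -
  note J = jost_csqrt[OF z]
  define p where "p = schroedinger_f_plus {0..} Vp z"
  have "\<exists>p. case p of (f, f') \<Rightarrow> schroedinger_solution {0..} Vp z (f, f') \<and> (\<exists>x\<in>{0..}. f x \<noteq> 0) \<and> sq_integrable_at_top f"
    using J schroedinger_solution_half_iff[OF Vp_locally_integrable] by (intro exI[of _ "(jost (- \<i> * csqrt z), jost' (- \<i> * csqrt z))"]) auto
  from someI_ex[OF this] have "case p of (f, f') \<Rightarrow> schroedinger_solution {0..} Vp z (f, f') \<and> (\<exists>x\<in>{0..}. f x \<noteq> 0) \<and> sq_integrable_at_top f"
    by (simp add: p_def schroedinger_f_plus_def)
  then obtain f f' where p: "p = (f, f')" and f: "schroedinger_solution {0..} Vp z (f, f')" "\<exists>x\<in>{0..}. f x \<noteq> 0" "sq_integrable_at_top f"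
    by (cases p) auto
  have s: "sol Vp z f f'" using f(1) schroedinger_solution_half_iff[OF Vp_locally_integrable] by blast
  have "f 0 \<noteq> 0 \<or> f' 0 \<noteq> 0" using sol_zero(1)[OF Vp_locally_integrable s] f(2) by auto
  from half_line_m_unique[OF Vp_locally_integrable Vp_limit_point J s f(3) this]
  show ?thesis by (simp add: schroedinger_m_plus_def p_def[symmetric] p)
qed

lemma whole_solution_nonzero:
  assumes W: "locally_integrable UNIV W" and s: "schroedinger_solution UNIV W z (f, f')" and x: "f x \<noteq> 0"
  shows "f 0 \<noteq> 0 \<or> f' 0 \<noteq> 0"
proof (rule ccontr)
  assume "\<not> (f 0 \<noteq> 0 \<or> f' 0 \<noteq> 0)"
  then have 0: "f 0 = 0" "f' 0 = 0" by auto
  note Wr = locally_integrable_halves(1)[OF W] and Wl = locally_integrable_halves(2)[OF W]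
  have r: "sol W z f f'"
    using schroedinger_solution_restrict[OF s] schroedinger_solution_half_iff[OF Wr] by blast
  have l: "sol (\<lambda>x. W (- x)) z (\<lambda>x. f (- x)) (\<lambda>x. - f' (- x))"
    using schroedinger_solution_reflect[OF s] schroedinger_solution_half_iff[OF Wl] by blast
  show False
  proof (cases "x \<ge> 0")
    case True
    then show False using sol_zero(1)[OF Wr r 0 True] x by simp
  next
    case False
    then show False using sol_zero(1)[OF Wl l, of "- x"] 0 x by simp
  qed
qed

text \<open>The extension is arbitrary on the left, so the Jost solution is continued there by
  \<open>sol_exists\<close> and glued at 0. This shows that \<open>SOME\<close> has a witness; its
  choice is then compared with the Jost solution on the right half only.\<close>

lemma whole_schroedinger_m_plus:
  assumes W: "schroedinger_op W" and R: "schroedinger_restricts_to W Vp" and z: "Im z > 0"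
  shows "schroedinger_m_plus UNIV W z = Mf (- \<i> * csqrt z)"
proof -
  note J = jost_csqrt[OF z]
  have Wi: "locally_integrable UNIV W" using W by (simp add: schroedinger_op_def)
  note Wl = locally_integrable_halves(2)[OF Wi]
  have ae: "AE x in lebesgue. x > 0 \<longrightarrow> W x = Vp x" "AE x in lebesgue. x > 0 \<longrightarrow> Vp x = W x"
    using R by (auto simp: schroedinger_restricts_to_def elim: eventually_mono)
  define k where "k = - \<i> * csqrt z"
  have jr: "schroedinger_solution {0..} W z (jost k, jost' k)"
    by (rule schroedinger_solution_AE_cong[OF ae(2)])
       (use J schroedinger_solution_half_iff[OF Vp_locally_integrable] k_def in blast)
  obtain u v where l: "sol (\<lambda>x. W (- x)) z u v" "u 0 = jost k 0" "v 0 = - jost' k 0"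
    using sol_exists[OF Wl] by blast
  define F G where "F x = (if x \<ge> 0 then jost k x else u (- x))" and "G x = (if x \<ge> 0 then jost' k x else - v (- x))" for x
  have FG: "schroedinger_solution UNIV W z (F, G)"
    unfolding F_def[abs_def] G_def[abs_def]
  proof (rule schroedinger_solution_glue)
    show "schroedinger_solution {0..} W z (jost k, jost' k)" by (rule jr)
    show "schroedinger_solution {0..} (\<lambda>x. W (- x)) z (u, v)"
      using l(1) schroedinger_solution_half_iff[OF Wl] by blast
  qed (use l in auto)
  have "F 0 \<noteq> 0" using J(3) by (simp add: F_def k_def)
  moreover have "sq_integrable_at_top F"
  proof -
    have cj: "continuous_on {0..b} (jost k)" for b using sol_continuous(1)[OF J(1)] by (simp add: k_def)
    have cF: "continuous_on {0..b} F" for b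
      by (rule continuous_on_eq[OF cj[of b]]) (simp add: F_def)
    have "mass F b = mass (jost k) b" for b unfolding mass_def by (rule integral_cong) (simp add: F_def)
    moreover have "sq_integrable_at_top (jost k)" using J(2) by (simp add: k_def)
    ultimately show ?thesis
      unfolding sq_integrable_at_top_iff_mass_bounded[OF cF] sq_integrable_at_top_iff_mass_bounded[OF cj] by simp
  qed
  define p where "p = schroedinger_f_plus UNIV W z"
  have "\<exists>p. case p of (f, f') \<Rightarrow> schroedinger_solution UNIV W z (f, f') \<and> (\<exists>x\<in>UNIV. f x \<noteq> 0) \<and> sq_integrable_at_top f"
    using FG \<open>F 0 \<noteq> 0\<close> \<open>sq_integrable_at_top F\<close> by (intro exI[of _ "(F, G)"]) auto
  from someI_ex[OF this] have "case p of (f, f') \<Rightarrow> schroedinger_solution UNIV W z (f, f') \<and> (\<exists>x\<in>UNIV. f x \<noteq> 0) \<and> sq_integrable_at_top f"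
    by (simp add: p_def schroedinger_f_plus_def)
  then obtain f f' x where p: "p = (f, f')" and f: "schroedinger_solution UNIV W z (f, f')" "f x \<noteq> 0" "sq_integrable_at_top f"
    by (cases p) auto
  have "schroedinger_solution {0..} Vp z (f, f')"
    by (rule schroedinger_solution_AE_cong[OF ae(1) schroedinger_solution_restrict[OF f(1)]])
  then have s: "sol Vp z f f'" using schroedinger_solution_half_iff[OF Vp_locally_integrable] by blast
  from half_line_m_unique[OF Vp_locally_integrable Vp_limit_point J s f(3) whole_solution_nonzero[OF Wi f(1,2)]]
  show ?thesis by (simp add: schroedinger_m_plus_def p_def[symmetric] p)
qed

lemma reflect_limit_point:
  assumes W: "schroedinger_op W"
  shows "limit_point_at_top {0..} (\<lambda>x. W (- x))"
  unfolding limit_point_at_top_def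
proof (intro notI, elim exE)
  have Wi: "locally_integrable UNIV W" using W by (simp add: schroedinger_op_def)
  note Wl = locally_integrable_halves(2)[OF Wi]
  fix z assume all: "\<forall>f f'. schroedinger_solution {0..} (\<lambda>x. W (- x)) z (f, f') \<longrightarrow> sq_integrable_at_top f"
  have "sq_integrable_at_bot f" if "schroedinger_solution UNIV W z (f, f')" for f f'
  proof -
    note s = schroedinger_solution_reflect[OF that]
    have "sol (\<lambda>x. W (- x)) z (\<lambda>x. f (- x)) (\<lambda>x. - f' (- x))"
      using s schroedinger_solution_half_iff[OF Wl] by blast
    from sq_integrable_reflect[OF sol_continuous(1)[OF this]] show ?thesis using all s by blast
  qed
  then have "\<not> limit_point_at_bot UNIV W" unfolding limit_point_at_bot_def by blast
  then show False using W by (simp add: schroedinger_op_def)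
qed

text \<open>Reflection turns the minus sign in \<open>m\<^sub>-\<close> into the plain quotient of
  derivative and value at 0, so the half line theory of the reflected potential applies.\<close>

lemma whole_schroedinger_m_minus:
  assumes W: "schroedinger_op W" and z: "Im z > 0"
    and sq: "sq_integrable_at_top (weyl (\<lambda>x. W (- x)) z m)"
  shows "schroedinger_m_minus UNIV W z = m"
proof -
  have Wi: "locally_integrable UNIV W" using W by (simp add: schroedinger_op_def)
  note Wr = locally_integrable_halves(1)[OF Wi] and Wl = locally_integrable_halves(2)[OF Wi]
  define q where "q = (\<lambda>x. W (- x))"
  note Wl = Wl[folded q_def]
  note S = weyl_sol[OF Wl, where z = z and m = m]
  obtain f g where r: "sol W z f g" "f 0 = weyl q z m 0" "g 0 = - weyl' q z m 0"
    using sol_exists[OF Wr] by blast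
  define F G where "F x = (if x \<ge> 0 then f x else weyl q z m (- x))" and "G x = (if x \<ge> 0 then g x else - weyl' q z m (- x))" for x
  have FG: "schroedinger_solution UNIV W z (F, G)"
    unfolding F_def[abs_def] G_def[abs_def]
  proof (rule schroedinger_solution_glue)
    show "schroedinger_solution {0..} W z (f, g)" using r(1) schroedinger_solution_half_iff[OF Wr] by blast
    show "schroedinger_solution {0..} (\<lambda>x. W (- x)) z (weyl q z m, weyl' q z m)"
      using S(1) schroedinger_solution_half_iff[OF Wl] unfolding q_def by blast
  qed (use r in auto)
  have F0: "F 0 \<noteq> 0" using r(2) S(2) by (simp add: F_def)
  have Fr: "F (- x) = weyl q z m x" if "x \<ge> 0" for x using that r(2) by (auto simp: F_def)
  have cw: "continuous_on {0..b} (weyl q z m)" for b by (rule sol_continuous(1)[OF S(1)])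
  have cF: "continuous_on {0..b} (\<lambda>x. F (- x))" for b
    by (rule continuous_on_eq[OF cw[of b]]) (simp add: Fr)
  have "mass (\<lambda>x. F (- x)) b = mass (weyl q z m) b" for b unfolding mass_def by (rule integral_cong) (simp add: Fr)
  then have "sq_integrable_at_top (\<lambda>x. F (- x))"
    using sq[folded q_def] unfolding sq_integrable_at_top_iff_mass_bounded[OF cF] sq_integrable_at_top_iff_mass_bounded[OF cw] by simp
  then have sF: "sq_integrable_at_bot F" using sq_integrable_reflect[of F, OF cF] by blast
  define p where "p = schroedinger_f_minus UNIV W z"
  have "\<exists>p. case p of (f, f') \<Rightarrow> schroedinger_solution UNIV W z (f, f') \<and> (\<exists>x\<in>UNIV. f x \<noteq> 0) \<and> sq_integrable_at_bot f"
    using FG F0 sF by (intro exI[of _ "(F, G)"]) auto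
  from someI_ex[OF this] have "case p of (f, f') \<Rightarrow> schroedinger_solution UNIV W z (f, f') \<and> (\<exists>x\<in>UNIV. f x \<noteq> 0) \<and> sq_integrable_at_bot f"
    by (simp add: p_def schroedinger_f_minus_def)
  then obtain h h' x where p: "p = (h, h')" and h: "schroedinger_solution UNIV W z (h, h')" "h x \<noteq> 0" "sq_integrable_at_bot h"
    by (cases p) auto
  have s: "sol q z (\<lambda>x. h (- x)) (\<lambda>x. - h' (- x))"
    using schroedinger_solution_reflect[OF h(1)] schroedinger_solution_half_iff[OF Wl] unfolding q_def by blast
  have sh: "sq_integrable_at_top (\<lambda>x. h (- x))"
    using h(3) sq_integrable_reflect[of h, OF sol_continuous(1)[OF s]] by blast
  have "- h' (- 0) / h (- 0) = m"
  proof (rule half_line_m_unique[OF Wl reflect_limit_point[OF W, folded q_def] S(1) sq[folded q_def] _ _ s sh])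
    show "weyl q z m 0 \<noteq> 0" "weyl' q z m 0 = m * weyl q z m 0" using S(2,3) by simp_all
    show "h (- 0) \<noteq> 0 \<or> - h' (- 0) \<noteq> 0" using whole_solution_nonzero[OF Wi h(1,2)] by simp
  qed
  then show ?thesis by (simp add: schroedinger_m_minus_def p_def[symmetric] p)
qed

section \<open>The forced partner and the contradiction\<close>

lemma Vp_m_minus_Herglotz: "Herglotz (\<lambda>z. - Mf (\<i> * csqrt z))"
proof (rule HerglotzI)
  have im: "Im (\<i> * csqrt z) > 0" if "Im z > 0" for z using csqrt_upper[OF that] by simp
  have "(\<lambda>z. \<i> * csqrt z) holomorphic_on upper_half_plane"
    by (intro holomorphic_intros) (auto simp: complex_nonpos_Reals_iff)
  then have "(Mf \<circ> (\<lambda>z. \<i> * csqrt z)) holomorphic_on upper_half_plane"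
    by (rule holomorphic_on_compose_gen[OF _ Mf_holomorphic]) (use im in fastforce)
  then show "(\<lambda>z. - Mf (\<i> * csqrt z)) holomorphic_on upper_half_plane"
    by (intro holomorphic_on_minus) (simp add: o_def)
  show "Im (- Mf (\<i> * csqrt z)) > 0" if "Im z > 0" for z
  proof -
    have "Im (cnj (\<i> * csqrt z)) < 0" using im[OF that] by simp
    from Im_Mf_pos[OF this] show ?thesis using Mf_cnj[of "\<i> * csqrt z"] im[OF that] by simp
  qed
qed

text \<open>For positive \<open>x\<close> the parameter \<open>k\<close> is purely imaginary, away
  from the poles, and \<open>- k = cnj k\<close>, so that \<open>Mf_cnj\<close> relates the two
  boundary values.\<close>

lemma Vp_boundary_values:
  assumes x: "x > 0"
  shows "\<exists>v. has_boundary_value (\<lambda>z. Mf (- \<i> * csqrt z)) x (- cnj v) \<and> has_boundary_value (\<lambda>z. - Mf (\<i> * csqrt z)) x v"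
proof -
  have cont: "isCont Mf k" if "Im k \<noteq> 0" for k
    using holomorphic_on_imp_continuous_on[OF Mf_holomorphic] that
    by (simp add: continuous_on_eq_continuous_at[OF open_nonreal])
  have "((\<lambda>y. of_real x + \<i> * of_real y) \<longlongrightarrow> of_real x + \<i> * of_real 0) (at_right 0)"
    by (intro tendsto_intros)
  then have C: "((\<lambda>y. Complex x y) \<longlongrightarrow> of_real x) (at_right 0)" by (simp add: Complex_eq)
  have "isCont csqrt (of_real x)" using x by (intro continuous_at_csqrt) (auto simp: complex_nonpos_Reals_iff)
  from isCont_tendsto_compose[OF this C]
  have S: "((\<lambda>y. csqrt (Complex x y)) \<longlongrightarrow> csqrt (of_real x)) (at_right 0)" .
  define s where "s = sqrt x"
  have s: "s > 0" "csqrt (of_real x) = of_real s" using x of_real_sqrt[of x] by (simp_all add: s_def)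
  have "((\<lambda>y. Mf (- \<i> * csqrt (Complex x y))) \<longlongrightarrow> Mf (- \<i> * of_real s)) (at_right 0)"
    by (rule isCont_tendsto_compose[OF cont tendsto_mult_left[OF S[unfolded s(2)]]]) (use s in simp)
  moreover have "((\<lambda>y. - Mf (\<i> * csqrt (Complex x y))) \<longlongrightarrow> - Mf (\<i> * of_real s)) (at_right 0)"
    by (rule tendsto_minus[OF isCont_tendsto_compose[OF cont tendsto_mult_left[OF S[unfolded s(2)]]]]) (use s in simp)
  moreover have "Mf (- \<i> * of_real s) = - cnj (- Mf (\<i> * of_real s))"
    using Mf_cnj[of "\<i> * of_real s"] s by simp
  ultimately show ?thesis unfolding has_boundary_value_def by metis
qed

lemma schroedinger_part:
  "\<exists>V. half_schroedinger_op V \<and> half_schroedinger_reflectionless V {0<..} \<and>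
       \<not> (\<exists>W. schroedinger_op W \<and> schroedinger_reflectionless W {0<..} \<and> schroedinger_restricts_to W V)"
proof (intro exI conjI)
  have bv: "\<exists>v. has_boundary_value (\<lambda>z. Mf (- \<i> * csqrt z)) x (- cnj v) \<and> has_boundary_value (\<lambda>z. - Mf (\<i> * csqrt z)) x v"
    if "x \<in> {0<..}" for x using Vp_boundary_values that by simp
  show "half_schroedinger_op Vp"
    using Vp_locally_integrable Vp_limit_point by (simp add: half_schroedinger_op_def)
  have "emeasure lborel {0<..<1::real} \<le> emeasure lborel {(0::real)<..}" by (rule emeasure_mono) auto
  then have "emeasure lborel {(0::real)<..} > 0" by (simp add: less_le_trans[of 0 1])
  then have "reflectionless_pair (schroedinger_m_plus {0..} Vp) (\<lambda>z. - Mf (\<i> * csqrt z)) {0<..}"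
    by (intro reflectionless_pairI[OF _ _ half_schroedinger_m_Vp bv]) simp_all
  then show "half_schroedinger_reflectionless Vp {0<..}"
    unfolding half_schroedinger_reflectionless_def using Vp_m_minus_Herglotz by blast
  show "\<not> (\<exists>W. schroedinger_op W \<and> schroedinger_reflectionless W {0<..} \<and> schroedinger_restricts_to W Vp)"
  proof (intro notI, elim exE conjE)
    fix W assume W: "schroedinger_op W" and refl: "schroedinger_reflectionless W {0<..}" and R: "schroedinger_restricts_to W Vp"
    have "locally_integrable UNIV W" using W by (simp add: schroedinger_op_def)
    note Wl = locally_integrable_halves(2)[OF this]
    obtain m where m: "Herglotz m" "\<And>z. Im z > 0 \<Longrightarrow> sq_integrable_at_top (weyl (\<lambda>x. W (- x)) z (m z))"
      "\<And>z b. Im z > 0 \<Longrightarrow> b \<ge> 0 \<Longrightarrow> Im z * mass (weyl (\<lambda>x. W (- x)) z (m z)) b \<le> Im (m z)"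
      using weyl_m_function[OF Wl reflect_limit_point[OF W]] by blast
    \<comment> \<open>Identifying \<open>m\<^sub>-\<close> with the limit of the Dirichlet m
      functions gives it both the Herglotz property and the mass bound.\<close>
    have mm: "schroedinger_m_minus UNIV W z = m z" if "Im z > 0" for z
      by (rule whole_schroedinger_m_minus[OF W that m(2)[OF that]])
    have mH: "Herglotz (schroedinger_m_minus UNIV W)"
    proof (rule HerglotzI)
      show "schroedinger_m_minus UNIV W holomorphic_on upper_half_plane"
        by (rule holomorphic_transform[OF HerglotzD(1)[OF m(1)]]) (simp add: mm)
      show "Im (schroedinger_m_minus UNIV W z) > 0" if "Im z > 0" for z
        using HerglotzD(2)[OF m(1) that] mm[OF that] by simp
    qed
    have "m z = - Mf (\<i> * csqrt z)" if z: "Im z > 0" for z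
    proof -
      have "schroedinger_m_minus UNIV W z = - Mf (\<i> * csqrt z)"
        by (rule reflectionless_pair_transfer[OF refl[unfolded schroedinger_reflectionless_def] _ whole_schroedinger_m_plus[OF W R] bv mH Vp_m_minus_Herglotz zero_less_one z])
           auto
      then show ?thesis using mm[OF z] by simp
    qed
    with Mf_not_weyl[OF Wl m(3)] show False by blast
  qed
qed

theorem theorem1p5:
  shows "(\<exists>a b. half_jacobi_matrix a b \<and> half_jacobi_reflectionless a b {-2<..<2} \<and>
            \<not> (\<exists>A B. jacobi_matrix A B \<and> jacobi_reflectionless A B {-2<..<2} \<and>
                  jacobi_restricts_to A B a b)) \<and>
         (\<exists>V. half_schroedinger_op V \<and> half_schroedinger_reflectionless V {0<..} \<and>
            \<not> (\<exists>W. schroedinger_op W \<and> schroedinger_reflectionless W {0<..} \<and>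
                  schroedinger_restricts_to W V))"
  using jacobi_part schroedinger_part ..

end
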